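(* Let $0<\alpha\le 1$. Let $\Phi:(0,\infty)\to(0,\infty)$ be an increasing function satisfying the doubling condition $\Phi(2r)\le D\cdot\Phi(r)$ for all $r>0$, with a constant $D=D(\Phi)$ independent of $r$ such that $1\le D(\Phi)<2^n$. Then there is a constant $C>0$ such that for every sequence $\vec f=(f_1,f_2,\ldots)$ of locally integrable functions on $\mathbb R^n$ ($C$ being independent of $\vec f$), $$\bigg\|\bigg(\sum_{j=1}^\infty\big|\mathcal S_\alpha(f_j)\big|^2\bigg)^{1/2}\bigg\|_{WL^{1,\Phi}}\leq C\,\bigg\|\bigg(\sum_{j=1}^\infty\big|f_j\big|^2\bigg)^{1/2}\bigg\|_{L^{1,\Phi}}.$$
   Context: Intrinsic square function. For $0<\alpha\le1$, let $\mathcal C_\alpha$ be the family of functions $\varphi$ on $\mathbb R^n$ such that $\varphi$ is supported in $\{x\in\mathbb R^n:|x|\le1\}$, $\int_{\mathbb R^n}\varphi(x)\,dx=0$, and $|\varphi(x)-\varphi(x')|\le|x-x'|^\alpha$ for all $x,x'\in\mathbb R^n$. Write $\varphi_t(x)=t^{-n}\varphi(x/t)$ for $t>0$. For $f\in L^1_{loc}(\mathbb R^n)$ and $(y,t)\in\mathbb R^{n+1}_+=\mathbb R^n\times(0,\infty)$ set $$A_\alpha(f)(y,t)=\sup_{\varphi\in\mathcal C_\alpha}|f*\varphi_t(y)|=\sup_{\varphi\in\mathcal C_\alpha}\left|\int_{\mathbb R^n}\varphi_t(y-z)f(z)\,dz\right|,$$ and $$\mathcal S_\alpha(f)(x)=\left(\iint_{\Gamma(x)}\big(A_\alpha(f)(y,t)\big)^2\frac{dy\,dt}{t^{n+1}}\right)^{1/2},\qquad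 \Gamma(x)=\{(y,t)\in\mathbb R^{n+1}_+:|x-y|<t\}.$$ Generalized Morrey spaces. Let $B(x_0,r)=\{x\in\mathbb R^n:|x-x_0|<r\}$ and let $|E|$ denote Lebesgue measure. $L^{1,\Phi}=L^{1,\Phi}(\mathbb R^n)$ is the space of locally integrable functions $f$ on $\mathbb R^n$ for which there is a constant $C>0$ such that for every $x_0\in\mathbb R^n$ and all $r>0$, $$\int_{B(x_0,r)}|f(x)|\,dx\le C\,\Phi(r);$$ $\|f\|_{L^{1,\Phi}}$ is the smallest such constant $C$ (and $+\infty$ if there is none). $WL^{1,\Phi}=WL^{1,\Phi}(\mathbb R^n)$ is the space of measurable functions $f$ for which there is a constant $C>0$ such that for every $x_0\in\mathbb R^n$ and all $r>0$, $$\sup_{\lambda>0}\lambda\cdot\big|\{x\in B(x_0,r):|f(x)|>\lambda\}\big|\le C\,\Phi(r);$$ $\|f\|_{WL^{1,\Phi}}$ is the smallest such constant $C$ (and $+\infty$ if there is none). *)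

theory Defs
  imports "HOL-Analysis.Analysis"
begin

text \<open>
  Functions on \<open>real ^ 'n\<close> take values in \<open>'b :: {real_normed_field, euclidean_space}\<close>; the
  instances are \<open>real\<close> and \<open>complex\<close>, so both scalar fields are covered.  Quantities that may be
  infinite (square functions, norms) take values in \<open>ennreal\<close>.
\<close>

definition ennsqrt :: "ennreal \<Rightarrow> ennreal" where
  "ennsqrt a = (if a = top then top else ennreal (sqrt (enn2real a)))"

definition locally_integrable :: "('a::euclidean_space \<Rightarrow> 'b::euclidean_space) \<Rightarrow> bool" where
  "locally_integrable f \<longleftrightarrow> (\<forall>K. compact K \<longrightarrow> f absolutely_integrable_on K)"

definition holder_class ::
  "real \<Rightarrow> (real ^ 'n \<Rightarrow> 'b::{real_normed_field, euclidean_space}) set" where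
  "holder_class \<alpha> = {\<phi>.
     {x. \<phi> x \<noteq> 0} \<subseteq> cball 0 1 \<and>
     integral\<^sup>L lebesgue \<phi> = 0 \<and>
     (\<forall>x x'. norm (\<phi> x - \<phi> x') \<le> norm (x - x') powr \<alpha>)}"

definition dilate :: "real \<Rightarrow> (real ^ 'n \<Rightarrow> 'b::real_vector) \<Rightarrow> real ^ 'n \<Rightarrow> 'b" where
  "dilate t \<phi> x = (1 / t ^ CARD('n)) *\<^sub>R \<phi> (x /\<^sub>R t)"

definition conv ::
  "(real ^ 'n \<Rightarrow> 'b::{real_normed_field, euclidean_space}) \<Rightarrow> (real ^ 'n \<Rightarrow> 'b) \<Rightarrow> real ^ 'n \<Rightarrow> 'b" where
  "conv f \<psi> y = (LINT z|lebesgue. \<psi> (y - z) * f z)"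

definition intrinsic_max ::
  "real \<Rightarrow> (real ^ 'n \<Rightarrow> 'b::{real_normed_field, euclidean_space}) \<Rightarrow> real ^ 'n \<Rightarrow> real \<Rightarrow> ennreal" where
  "intrinsic_max \<alpha> f y t = (SUP \<phi>\<in>holder_class \<alpha>. ennreal (norm (conv f (dilate t \<phi>) y)))"

definition upward_cone :: "real ^ 'n \<Rightarrow> ((real ^ 'n) \<times> real) set" where
  "upward_cone x = {(y, t). t > 0 \<and> norm (x - y) < t}"

definition intrinsic_square ::
  "real \<Rightarrow> (real ^ 'n \<Rightarrow> 'b::{real_normed_field, euclidean_space}) \<Rightarrow> real ^ 'n \<Rightarrow> ennreal" where
  "intrinsic_square \<alpha> f x = ennsqrt
     (\<integral>\<^sup>+(y, t)\<in>upward_cone x. (intrinsic_max \<alpha> f y t)\<^sup>2 * ennreal (1 / t ^ (CARD('n) + 1)) \<partial>lebesgue)"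

text \<open>
  The two norms below are applied to the modulus \<open>g = \<bar>f\<bar>\<close>, as an extended nonnegative function.
  The infimum over the admissible constants is \<open>\<infinity>\<close> if there is none, in particular if \<open>g\<close> is not
  measurable.  In the Morrey norm, measurability and finite integrals over balls give local
  integrability.
\<close>

definition morrey_norm :: "(real \<Rightarrow> real) \<Rightarrow> (real ^ 'n \<Rightarrow> ennreal) \<Rightarrow> ennreal" where
  "morrey_norm \<Phi> g = Inf {ennreal C | C. C > 0 \<and> g \<in> borel_measurable lebesgue \<and>
     (\<forall>x\<^sub>0. \<forall>r>0. (\<integral>\<^sup>+x\<in>ball x\<^sub>0 r. g x \<partial>lebesgue) \<le> ennreal (C * \<Phi> r))}"

definition weak_morrey_norm :: "(real \<Rightarrow> real) \<Rightarrow> (real ^ 'n \<Rightarrow> ennreal) \<Rightarrow> ennreal" where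
  "weak_morrey_norm \<Phi> g = Inf {ennreal C | C. C > 0 \<and> g \<in> borel_measurable lebesgue \<and>
     (\<forall>x\<^sub>0. \<forall>r>0. (SUP l\<in>{0<..}. ennreal l * emeasure lebesgue {x \<in> ball x\<^sub>0 r. g x > ennreal l})
        \<le> ennreal (C * \<Phi> r))}"

end

theory Submission
  imports Defs
begin

text \<open>
  Up to a constant, the functions \<open>\<phi>\<^sub>t (y - \<cdot>)\<close> in the definition of the square function are Hoelder
  bumps of mean zero adapted to the dyadic cube whose Whitney box contains \<open>(y, t)\<close>.  Hence the
  intrinsic square function is dominated pointwise by a discrete square function: the sum, over the
  dyadic cubes whose window contains \<open>x\<close>, of the squared suprema of the pairings of \<open>f\<close> with bumps.
  Taking components reduces this to real-valued functions.

  Bumps at different scales are almost orthogonal, so the Schur test bounds the discrete square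
  function on \<open>L\<^sup>2\<close>.  A Calderon-Zygmund decomposition of the \<open>\<ell>\<^sup>2\<close> modulus \<open>h\<close> of the sequence gives the
  weak type (1,1) inequality.  The good part is bounded in \<open>L\<^sup>2\<close>; for the bad part, off the dilated
  cubes, the \<open>\<ell>\<^sup>2\<close> sum over bumps may be replaced by an \<open>\<ell>\<^sup>1\<close> sum, to which the cancellation on each
  cube and Minkowski's inequality apply.

  On a ball \<open>B\<close> of radius \<open>r\<close>, the part of the sequence in \<open>2B\<close> is handled by the weak type inequality and the
  doubling of \<open>\<Phi>\<close>.  The part outside only meets bumps of scale at least about \<open>r\<close>, and their size alone
  yields the series of the terms \<open>\<Phi> (2\<^sup>k r) / (2\<^sup>k r)\<^sup>n\<close>, geometric because \<open>D < 2\<^sup>n\<close>.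
\<close>


section \<open>Countable sums and integrals of extended nonnegative reals\<close>

text \<open>The extremal function in \<open>intrinsic_max\<close> depends on \<open>f\<close>, on
  the point and on the scale, so the square function is not linear and belongs to no fixed kernel.
  The remedy is to choose one nearly extremal bump per dyadic cube: for a fixed choice the pairings
  are linear in \<open>f\<close>, and the Schur bound on their Gram matrix does not depend on the
  choice. Its series has ratio \<open>2 powr - \<alpha>\<close>, from mean zero of the finer bump
  against Hoelder continuity of the coarser one. The same play of cancellation against regularity
  returns with the bad part in the role of the finer bump. The Calderon-Zygmund cubes are chosen
  once, for \<open>h\<close>, and serve every component, so the constants do not see the number of
  functions. For the bad part, passing to sums of first powers is affordable because off the dilated
  cubes only windows of at least the scale of the cube occur; their contributions form a geometric
  series, and Tonelli's theorem closes an L^1 estimate.\<close>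

abbreviation vol :: "'a::euclidean_space set \<Rightarrow> ennreal" where
  "vol \<equiv> emeasure lebesgue"

abbreviation csum :: "'i set \<Rightarrow> ('i \<Rightarrow> ennreal) \<Rightarrow> ennreal" where
  "csum I f \<equiv> \<integral>\<^sup>+i. f i \<partial>count_space I"

text \<open>Partial sums along an enumeration of \<open>I\<close> are finite sums. With this the
  Schur estimate has to be proved for finite families only, where linear combinations of bumps raise
  no question of convergence.\<close>

lemma nn_integral_count_space_le:
  assumes "countable I" and le: "\<And>F. finite F \<Longrightarrow> F \<subseteq> I \<Longrightarrow> sum f F \<le> (B::ennreal)"
  shows "csum I (\<lambda>i. f i) \<le> B"
proof (cases "finite I")
  case True
  then show ?thesis
    by (simp add: nn_integral_count_space_finite le)
next
  case False
  note bij = bij_betw_from_nat_into[OF \<open>countable I\<close> False]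
  have "csum I (\<lambda>i. f i) = (\<Sum>n. f (from_nat_into I n))"
    by (simp add: nn_integral_bij_count_space[symmetric, OF bij] nn_integral_count_space_nat)
  also have "\<dots> \<le> B"
    unfolding suminf_eq_SUP
  proof (rule SUP_least)
    fix n :: nat
    have "(\<Sum>i<n. f (from_nat_into I i)) = sum f (from_nat_into I ` {..<n})"
      using bij by (subst sum.reindex) (auto simp: bij_betw_def intro: inj_on_subset)
    also have "\<dots> \<le> B"
      using bij by (intro le) (auto simp: bij_betw_def)
    finally show "(\<Sum>i<n. f (from_nat_into I i)) \<le> B" .
  qed
  finally show ?thesis .
qed

lemma sum_le_nn_integral_count_space:
  assumes "finite F" "F \<subseteq> I"
  shows "sum f F \<le> csum I (\<lambda>i. f i)"
proof -
  have "sum f F = csum F (\<lambda>i. f i)"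
    using assms by (simp add: nn_integral_count_space_finite)
  also have "\<dots> \<le> csum I (\<lambda>i. f i)"
    using assms by (subst (1 2) nn_integral_count_space_indicator)
      (auto intro!: nn_integral_mono simp: indicator_def)
  finally show ?thesis .
qed

text \<open>Each term is at most the whole sum. This embedding of l^1 into l^2 is what later
  replaces square sums over windows by plain sums.\<close>

lemma nn_integral_count_space_power2_le:
  "csum I (\<lambda>i. (f i)\<^sup>2) \<le> (csum I (\<lambda>i. f i))\<^sup>2"
proof -
  let ?S = "csum I (\<lambda>i. f i)"
  have "csum I (\<lambda>i. (f i)\<^sup>2) \<le> csum I (\<lambda>i. f i * ?S)"
    by (intro nn_integral_mono) (auto simp: power2_eq_square intro!: mult_left_mono nn_integral_ge_point)
  also have "\<dots> = ?S\<^sup>2"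
    by (simp add: nn_integral_multc power2_eq_square)
  finally show ?thesis .
qed

lemma nn_integral_count_space_times:
  fixes g :: "nat \<times> 'b \<Rightarrow> ennreal"
  assumes "finite B"
  shows "csum (UNIV \<times> B) (\<lambda>i. g i) = (\<Sum>j. \<Sum>b\<in>B. g (j, b))"
proof -
  have "csum (UNIV \<times> B) (\<lambda>i. g i) = csum UNIV (\<lambda>i. g i * indicator (UNIV \<times> B) i)"
    by (subst nn_integral_count_space_indicator) auto
  also have "\<dots> = csum UNIV (\<lambda>j. csum UNIV (\<lambda>b. g (j, b) * indicator (UNIV \<times> B) (j, b)))"
    by (rule nn_integral_fst_count_space[symmetric])
  also have "\<dots> = csum UNIV (\<lambda>j. csum B (\<lambda>b. g (j, b)))"
    by (intro nn_integral_cong) (auto simp: nn_integral_count_space_indicator[of B] indicator_def intro!: nn_integral_cong)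
  also have "\<dots> = (\<Sum>j. \<Sum>b\<in>B. g (j, b))"
    using assms by (simp add: nn_integral_count_space_finite nn_integral_count_space_nat)
  finally show ?thesis .
qed

lemma nn_integral_UN_countable:
  assumes "countable I" "\<And>i. i \<in> I \<Longrightarrow> A i \<in> sets M" "disjoint_family_on A I"
    and [measurable]: "h \<in> borel_measurable M"
  shows "(\<integral>\<^sup>+x. h x * indicator (\<Union>(A ` I)) x \<partial>M) = csum I (\<lambda>i. (\<integral>\<^sup>+x. h x * indicator (A i) x \<partial>M))"
proof -
  have "\<Union>(A ` I) \<in> sets M" using assms(1,2) by (intro sets.countable_UN') auto
  then have "(\<integral>\<^sup>+x. h x * indicator (\<Union>(A ` I)) x \<partial>M) = emeasure (density M h) (\<Union>(A ` I))"
    by (simp add: emeasure_density)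
  also have "\<dots> = csum I (\<lambda>i. emeasure (density M h) (A i))"
    using assms by (intro emeasure_UN_countable) auto
  also have "\<dots> = csum I (\<lambda>i. (\<integral>\<^sup>+x. h x * indicator (A i) x \<partial>M))"
    using assms by (intro nn_integral_cong) (simp add: emeasure_density)
  finally show ?thesis .
qed

lemma emeasure_UN_le_count_space:
  assumes I: "countable I" and A: "\<And>i. i \<in> I \<Longrightarrow> A i \<in> sets M"
  shows "emeasure M (\<Union>i\<in>I. A i) \<le> csum I (\<lambda>i. emeasure M (A i))"
proof -
  have [measurable]: "(\<Union>i\<in>I. A i) \<in> sets M" using assms by (intro sets.countable_UN') auto
  have "emeasure M (\<Union>i\<in>I. A i) = (\<integral>\<^sup>+x. indicator (\<Union>i\<in>I. A i) x \<partial>M)"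
    by simp
  also have "\<dots> \<le> (\<integral>\<^sup>+x. csum I (\<lambda>i. indicator (A i) x) \<partial>M)"
  proof (intro nn_integral_mono)
    fix x
    show "indicator (\<Union>i\<in>I. A i) x \<le> csum I (\<lambda>i. indicator (A i) x)"
      using nn_integral_ge_point[of _ I "\<lambda>i. indicator (A i) x"] by (fastforce simp: indicator_def)
  qed
  also have "\<dots> = csum I (\<lambda>i. (\<integral>\<^sup>+x. indicator (A i) x \<partial>M))"
    using A by (intro nn_integral_count_space_nn_integral I) auto
  also have "\<dots> = csum I (\<lambda>i. emeasure M (A i))"
    using A by (intro nn_integral_cong) auto
  finally show ?thesis .
qed

lemma borel_measurable_nn_integral_count_space:
  fixes f :: "'i \<Rightarrow> 'a \<Rightarrow> ennreal"
  assumes I: "countable I" and [measurable]: "\<And>i. i \<in> I \<Longrightarrow> f i \<in> borel_measurable M"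
  shows "(\<lambda>x. csum I (\<lambda>i. f i x)) \<in> borel_measurable M"
proof (cases "finite I")
  case True
  then show ?thesis by (simp add: nn_integral_count_space_finite)
next
  case False
  note bij = bij_betw_from_nat_into[OF I False]
  have "I \<noteq> {}" using False by auto
  then have [measurable]: "f (from_nat_into I n) \<in> borel_measurable M" for n
    by (intro assms from_nat_into)
  show ?thesis
    by (simp add: nn_integral_bij_count_space[symmetric, OF bij] nn_integral_count_space_nat)
qed

text \<open>Two one-sided geometric series, split at \<open>q\<close>; the term \<open>k = q\<close>
  is counted in both, hence the numerator 2.\<close>

lemma nn_integral_geometric_int:
  fixes \<rho> :: real and q :: int
  assumes "0 \<le> \<rho>" "\<rho> < 1"
  shows "csum UNIV (\<lambda>k. ennreal (\<rho> ^ nat \<bar>k - q\<bar>)) \<le> ennreal (2 / (1 - \<rho>))"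
proof -
  have geo: "csum UNIV (\<lambda>k. ennreal (\<rho> ^ k)) = ennreal (1 / (1 - \<rho>))"
    using assms by (simp add: nn_integral_count_space_nat suminf_ennreal2 suminf_geometric)
  have bij1: "bij_betw (\<lambda>n. q + int n) UNIV {q..}"
    by (rule bij_betwI[where g = "\<lambda>k. nat (k - q)"]) auto
  have bij2: "bij_betw (\<lambda>n. q - int n) UNIV {..q}"
    by (rule bij_betwI[where g = "\<lambda>k. nat (q - k)"]) auto
  have "csum UNIV (\<lambda>k. ennreal (\<rho> ^ nat \<bar>k - q\<bar>))
    \<le> csum UNIV (\<lambda>k. ennreal (\<rho> ^ nat \<bar>k - q\<bar>) * indicator {q..} k
          + ennreal (\<rho> ^ nat \<bar>k - q\<bar>) * indicator {..q} k)"
    by (intro nn_integral_mono) (auto simp: indicator_def)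
  also have "\<dots> = (\<integral>\<^sup>+k. ennreal (\<rho> ^ nat \<bar>k - q\<bar>) \<partial>count_space {q..})
                  + (\<integral>\<^sup>+k. ennreal (\<rho> ^ nat \<bar>k - q\<bar>) \<partial>count_space {..q})"
    by (simp add: nn_integral_add nn_integral_count_space_indicator)
  also have "\<dots> = ennreal (1 / (1 - \<rho>)) + ennreal (1 / (1 - \<rho>))"
    unfolding nn_integral_bij_count_space[symmetric, OF bij1] nn_integral_bij_count_space[symmetric, OF bij2]
    by (simp add: geo)
  also have "\<dots> = ennreal (2 / (1 - \<rho>))"
    using assms by (subst ennreal_plus[symmetric]) (auto simp: field_simps)
  finally show ?thesis by simp
qed

section \<open>Inequalities for squares of extended nonnegative reals\<close>

lemma ennreal_power2_le_iff: "(a::ennreal)\<^sup>2 \<le> b\<^sup>2 \<longleftrightarrow> a \<le> b"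
proof
  assume *: "a\<^sup>2 \<le> b\<^sup>2"
  show "a \<le> b"
  proof (rule ccontr)
    assume "\<not> a \<le> b"
    then have "b < a" by simp
    then show False
    proof (cases a; cases b)
      fix r s assume rs: "a = ennreal r" "0 \<le> r" "b = ennreal s" "0 \<le> s"
      then have "s < r" using \<open>b < a\<close> by (simp add: ennreal_less_iff)
      then show False using * rs by (simp add: ennreal_power)
    qed (use * in \<open>auto simp: power2_eq_square ennreal_mult_top top_unique ennreal_top_mult ennreal_mult_eq_top_iff\<close>)
  qed
qed (intro power_mono; simp)

lemma ennreal_power2_less_iff: "(a::ennreal)\<^sup>2 < b\<^sup>2 \<longleftrightarrow> a < b"
  using ennreal_power2_le_iff[of b a] by (simp add: not_le[symmetric])

lemma ennreal_add_power2_le: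
  fixes a b :: ennreal
  shows "(a + b)\<^sup>2 \<le> 2 * a\<^sup>2 + 2 * b\<^sup>2"
proof (cases a; cases b)
  fix r s assume rs: "a = ennreal r" "0 \<le> r" "b = ennreal s" "0 \<le> s"
  have "(r + s)\<^sup>2 \<le> 2 * r\<^sup>2 + 2 * s\<^sup>2"
    using zero_le_power2[of "r - s"] by (simp add: power2_eq_square algebra_simps)
  then have "ennreal ((r + s)\<^sup>2) \<le> ennreal (2 * r\<^sup>2 + 2 * s\<^sup>2)"
    by (rule ennreal_leI)
  also have "\<dots> = ennreal (2 * r\<^sup>2) + ennreal (2 * s\<^sup>2)"
    by (rule ennreal_plus) auto
  finally show ?thesis using rs by (simp add: ennreal_power[symmetric] ennreal_mult)
qed (auto simp: power2_eq_square ennreal_mult_top)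

text \<open>Every term is bounded by the largest one, which costs the squared cardinality where
  Cauchy-Schwarz would cost the cardinality. It is applied to the basis of the scalars, so the loss
  is a constant.\<close>

lemma ennreal_sum_power2_le:
  fixes c :: "'i \<Rightarrow> ennreal"
  assumes "finite B"
  shows "(\<Sum>b\<in>B. c b)\<^sup>2 \<le> (of_nat (card B))\<^sup>2 * (\<Sum>b\<in>B. (c b)\<^sup>2)"
proof (cases "B = {}")
  case False
  have "Max (c ` B) \<in> c ` B" using assms False by (intro Max_in) auto
  then obtain b0 where b0: "b0 \<in> B" "c b0 = Max (c ` B)" by auto
  have "(\<Sum>b\<in>B. c b) \<le> (\<Sum>b\<in>B. c b0)"
    using assms b0 by (intro sum_mono) auto
  then have "(\<Sum>b\<in>B. c b)\<^sup>2 \<le> (of_nat (card B) * c b0)\<^sup>2"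
    by (intro power_mono) auto
  also have "\<dots> = (of_nat (card B))\<^sup>2 * (c b0)\<^sup>2" by (rule power_mult_distrib)
  also have "\<dots> \<le> (of_nat (card B))\<^sup>2 * (\<Sum>b\<in>B. (c b)\<^sup>2)"
    using assms b0(1) by (intro mult_left_mono member_le_sum) auto
  finally show ?thesis .
qed simp

lemma ennreal_arith_geo:
  fixes a b :: ennreal
  assumes "0 < t"
  shows "2 * (a * b) \<le> ennreal t * a\<^sup>2 + ennreal (1 / t) * b\<^sup>2"
proof (cases a; cases b)
  fix r s assume rs: "a = ennreal r" "0 \<le> r" "b = ennreal s" "0 \<le> s"
  have "0 \<le> (t * r - s)\<^sup>2 / t" using assms by simp
  also have "(t * r - s)\<^sup>2 / t = t * r\<^sup>2 + 1 / t * s\<^sup>2 - 2 * (r * s)"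
    using assms by (simp add: power2_eq_square field_simps)
  finally have "ennreal (2 * (r * s)) \<le> ennreal (t * r\<^sup>2 + 1 / t * s\<^sup>2)" by (intro ennreal_leI) simp
  also have "ennreal (t * r\<^sup>2 + 1 / t * s\<^sup>2) = ennreal (t * r\<^sup>2) + ennreal (1 / t * s\<^sup>2)"
    using assms by (intro ennreal_plus) auto
  also have "\<dots> = ennreal t * a\<^sup>2 + ennreal (1 / t) * b\<^sup>2"
    using rs assms by (subst (1 2) ennreal_mult) (auto simp: ennreal_power)
  also have "ennreal (2 * (r * s)) = 2 * (a * b)"
    using rs by (simp add: ennreal_mult)
  finally show ?thesis .
qed (use assms in \<open>auto simp: power2_eq_square ennreal_mult_top\<close>)

lemma csum_Cauchy_Schwarz:
  assumes a: "csum I (\<lambda>i. (a i)\<^sup>2) \<le> H\<^sup>2" and b: "csum I (\<lambda>i. (b i)\<^sup>2) \<le> K\<^sup>2"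
  shows "csum I (\<lambda>i. a i * b i) \<le> H * K"
proof -
  have le: "a i \<le> H" "b i \<le> K" if "i \<in> I" for i
    using order_trans[OF nn_integral_ge_point[OF that] a] order_trans[OF nn_integral_ge_point[OF that] b]
    by (simp_all add: ennreal_power2_le_iff)
  \<comment> \<open>A zero majorant is kept apart from an infinite one: since
    \<open>0 * top = 0\<close>, the terms themselves must be shown to vanish there.\<close>
  consider "H = 0 \<or> K = 0" | "H = top \<or> K = top" "H \<noteq> 0" "K \<noteq> 0"
    | r s where "H = ennreal r" "0 < r" "K = ennreal s" "0 < s"
    by (cases H; cases K) (auto simp: less_le)
  then show ?thesis
  proof cases
    case 1
    then have "a i * b i = 0" if "i \<in> I" for i using le[OF that] by auto
    then have "csum I (\<lambda>i. a i * b i) = csum I (\<lambda>i. 0)" by (intro nn_integral_cong) auto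
    then show ?thesis by simp
  next
    case 3
    \<comment> \<open>The weight \<open>s / r\<close> balances the two squares: both terms of the
      upper bound become \<open>r * s\<close>.\<close>
    have "2 * csum I (\<lambda>i. a i * b i) = csum I (\<lambda>i. 2 * (a i * b i))" by (simp add: nn_integral_cmult)
    also have "\<dots> \<le> csum I (\<lambda>i. ennreal (s / r) * (a i)\<^sup>2 + ennreal (1 / (s / r)) * (b i)\<^sup>2)"
      using 3 by (intro nn_integral_mono ennreal_arith_geo) simp
    also have "\<dots> = ennreal (s / r) * csum I (\<lambda>i. (a i)\<^sup>2) + ennreal (1 / (s / r)) * csum I (\<lambda>i. (b i)\<^sup>2)"
      by (simp add: nn_integral_add nn_integral_cmult)
    also have "\<dots> \<le> ennreal (s / r) * H\<^sup>2 + ennreal (1 / (s / r)) * K\<^sup>2"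
      using a b by (intro add_mono mult_left_mono) auto
    also have "\<dots> = 2 * (H * K)"
      using 3 by (simp add: ennreal_power ennreal_mult[symmetric] power2_eq_square mult_2 mult.commute)
    finally show ?thesis by (subst (asm) ennreal_mult_le_mult_iff) auto
  qed (auto simp: ennreal_mult_top ennreal_top_mult)
qed

text \<open>
  Stated with squares and a majorant \<open>h\<close> of the \<open>\<ell>\<^sup>2\<close> modulus, so that no square roots of extended
  reals occur.
\<close>

lemma nn_integral_minkowski_l2:
  fixes u :: "'i \<Rightarrow> 'a \<Rightarrow> ennreal"
  assumes I: "countable I" and u[measurable]: "\<And>i. i \<in> I \<Longrightarrow> u i \<in> borel_measurable M"
    and h[measurable]: "h \<in> borel_measurable M"
    and le: "\<And>x. x \<in> space M \<Longrightarrow> csum I (\<lambda>i. (u i x)\<^sup>2) \<le> (h x)\<^sup>2"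
  shows "csum I (\<lambda>i. (\<integral>\<^sup>+x. u i x \<partial>M)\<^sup>2) \<le> (\<integral>\<^sup>+x. h x \<partial>M)\<^sup>2"
proof -
  \<comment> \<open>Writing the squared integral as a double integral brings the sum over
    \<open>i\<close> onto the products \<open>u i x * u i y\<close>, where Cauchy-Schwarz at the
    pair of points gives a majorant that factorises.\<close>
  have "csum I (\<lambda>i. (\<integral>\<^sup>+x. u i x \<partial>M)\<^sup>2) = csum I (\<lambda>i. \<integral>\<^sup>+x. \<integral>\<^sup>+y. u i x * u i y \<partial>M \<partial>M)"
    by (intro nn_integral_cong) (simp add: nn_integral_cmult nn_integral_multc power2_eq_square)
  also have "\<dots> = (\<integral>\<^sup>+x. csum I (\<lambda>i. \<integral>\<^sup>+y. u i x * u i y \<partial>M) \<partial>M)"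
    by (intro nn_integral_count_space_nn_integral[symmetric] I) (simp add: nn_integral_cmult)
  also have "\<dots> = (\<integral>\<^sup>+x. \<integral>\<^sup>+y. csum I (\<lambda>i. u i x * u i y) \<partial>M \<partial>M)"
    by (intro nn_integral_cong nn_integral_count_space_nn_integral[symmetric] I) simp
  also have "\<dots> \<le> (\<integral>\<^sup>+x. \<integral>\<^sup>+y. h x * h y \<partial>M \<partial>M)"
    by (intro nn_integral_mono csum_Cauchy_Schwarz le)
  also have "\<dots> = (\<integral>\<^sup>+x. h x \<partial>M)\<^sup>2"
    by (simp add: nn_integral_cmult nn_integral_multc power2_eq_square)
  finally show ?thesis .
qed

text \<open>Multiplying by \<open>l\<close> and cancelling the finite nonzero factor
  \<open>a\<close> changes the normalisation of a weak type bound, for instance from a level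
  \<open>l^2 / 4\<close> back to \<open>l\<close>.\<close>

lemma ennreal_rescale_le:
  fixes x y :: ennreal
  assumes "ennreal a * x \<le> ennreal b * y" "0 < a" "0 \<le> b" "0 \<le> l" "0 \<le> c" and le: "l * b \<le> a * c"
  shows "ennreal l * x \<le> ennreal c * y"
proof -
  have "ennreal a * (ennreal l * x) = ennreal l * (ennreal a * x)" by (simp only: mult_ac)
  also have "\<dots> \<le> ennreal l * (ennreal b * y)" by (intro mult_left_mono assms(1)) simp
  also have "\<dots> = ennreal (l * b) * y" using assms by (simp add: ennreal_mult mult.assoc)
  also have "\<dots> \<le> ennreal (a * c) * y" by (intro mult_right_mono ennreal_leI le) simp
  also have "\<dots> = ennreal a * (ennreal c * y)" using assms by (simp add: ennreal_mult mult.assoc)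
  finally show ?thesis
    using \<open>0 < a\<close> by (subst (asm) ennreal_mult_le_mult_iff) (auto simp: ennreal_eq_0_iff)
qed

text \<open>The shape matches \<open>(a + b)^2 \<le> 2 a^2 + 2 b^2\<close>, the form in which square
  functions are subadditive here.\<close>

lemma ennreal_less_two_sum:
  assumes "ennreal (4 * a) < 2 * x + 2 * y" "0 \<le> a"
  shows "ennreal a < x \<or> ennreal a < y"
proof (rule ccontr)
  assume "\<not> (ennreal a < x \<or> ennreal a < y)"
  then have "2 * x + 2 * y \<le> 2 * ennreal a + 2 * ennreal a"
    by (intro add_mono mult_left_mono) (auto simp: not_less)
  also have "\<dots> = ennreal (4 * a)"
    using assms(2) by (simp add: ennreal_mult distrib_right[symmetric])
  finally show False using assms(1) by simp
qed

lemma ennreal_abs_add_le: "ennreal \<bar>a + b\<bar> \<le> ennreal \<bar>a\<bar> + ennreal \<bar>b\<bar>"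
  using ennreal_leI[OF abs_triangle_ineq[of a b]] by (simp add: ennreal_plus)

lemma ennreal_abs_integral_le:
  fixes f :: "'a \<Rightarrow> real"
  shows "ennreal \<bar>LINT x|M. f x\<bar> \<le> (\<integral>\<^sup>+x. ennreal \<bar>f x\<bar> \<partial>M)"
  using integral_norm_bound_ennreal[of M f]
  by (cases "integrable M f") (auto simp: not_integrable_integral_eq)

lemma ennreal_abs_suminf_le:
  fixes a :: "nat \<Rightarrow> real"
  shows "ennreal \<bar>\<Sum>i. a i\<bar> \<le> (\<Sum>i. ennreal \<bar>a i\<bar>)"
proof (cases "summable (\<lambda>i. \<bar>a i\<bar>)")
  case True
  have "(\<Sum>i. ennreal \<bar>a i\<bar>) = ennreal (\<Sum>i. \<bar>a i\<bar>)"
    by (rule suminf_ennreal2[OF abs_ge_zero True])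
  then show ?thesis
    by (simp only: ennreal_leI[OF summable_rabs[OF True]])
next
  case False
  then have "(\<Sum>i. ennreal \<bar>a i\<bar>) = top"
    using summable_suminf_not_top[OF abs_ge_zero] by blast
  then show ?thesis by simp
qed

lemma ennreal_abs_integral_le_sum_parts:
  fixes f :: "'a \<Rightarrow> real"
  assumes S: "countable S" and A: "\<And>p. p \<in> S \<Longrightarrow> A p \<in> sets M" "disjoint_family_on A S"
    and f: "integrable M f" and zero: "\<And>x. x \<notin> \<Union>(A ` S) \<Longrightarrow> f x = 0"
  shows "ennreal \<bar>LINT x|M. f x\<bar> \<le> csum S (\<lambda>p. ennreal \<bar>LINT x|M. f x * indicator (A p) x\<bar>)"
proof -
  let ?J = "to_nat_on S ` S"
  \<comment> \<open>The family is padded with empty sets to a sequence, to which countable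
    additivity of the integral applies; the padding contributes zero.\<close>
  define B where "B j = (if j \<in> ?J then A (from_nat_into S j) else {})" for j
  have B_eq: "B (to_nat_on S p) = A p" if "p \<in> S" for p
    using S that by (simp add: B_def from_nat_into_to_nat_on)
  have UN: "\<Union>(A ` S) = (\<Union>j. B j)"
  proof
    show "\<Union>(A ` S) \<subseteq> (\<Union>j. B j)" using B_eq by blast
    show "(\<Union>j. B j) \<subseteq> \<Union>(A ` S)" using S by (auto simp: B_def from_nat_into_to_nat_on split: if_splits)
  qed
  have Bm: "B j \<in> sets M" for j using A(1) S by (auto simp: B_def from_nat_into_to_nat_on)
  have disj: "B i \<inter> B j = {}" if "i \<noteq> j" for i j
    using A(2) S that by (auto simp: B_def from_nat_into_to_nat_on disjoint_family_on_def) blast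
  have "(LINT x|M. f x) = (LINT x:(\<Union>j. B j)|M. f x)"
    unfolding set_lebesgue_integral_def using zero UN
    by (intro Bochner_Integration.integral_cong) (auto simp: indicator_def)
  also have "\<dots> = (\<Sum>j. LINT x:B j|M. f x)"
    unfolding set_integrable_def
    by (intro lebesgue_integral_countable_add Bm disj)
      (auto simp: set_integrable_def Bm simp del: real_scaleR_def intro!: integrable_mult_indicator f)
  finally have "ennreal \<bar>LINT x|M. f x\<bar> \<le> (\<Sum>j. ennreal \<bar>LINT x:B j|M. f x\<bar>)"
    using ennreal_abs_suminf_le by simp
  also have "\<dots> = csum UNIV (\<lambda>j. ennreal \<bar>LINT x:B j|M. f x\<bar>)"
    by (simp add: nn_integral_count_space_nat)
  also have "\<dots> = (\<integral>\<^sup>+j. ennreal \<bar>LINT x:B j|M. f x\<bar> \<partial>count_space ?J)"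
    by (intro nn_integral_count_space_eq) (auto simp: B_def set_lebesgue_integral_def)
  also have "\<dots> = csum S (\<lambda>p. ennreal \<bar>LINT x:B (to_nat_on S p)|M. f x\<bar>)"
    using S by (intro nn_integral_bij_count_space[symmetric]) (auto simp: bij_betw_def)
  also have "\<dots> = csum S (\<lambda>p. ennreal \<bar>LINT x|M. f x * indicator (A p) x\<bar>)"
    by (intro nn_integral_cong) (simp add: B_eq set_lebesgue_integral_def mult.commute)
  finally show ?thesis .
qed

lemma superlevel_sets[measurable]:
  "f \<in> borel_measurable lebesgue \<Longrightarrow> {x. ennreal a < f x} \<in> sets lebesgue"
  using borel_measurable_less[of "\<lambda>_. ennreal a" lebesgue f] by simp

lemma emeasure_superlevel_le:
  assumes [measurable]: "f \<in> borel_measurable M" and "0 < a"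
  shows "ennreal a * emeasure M {x \<in> space M. ennreal a < f x} \<le> (\<integral>\<^sup>+x. f x \<partial>M)"
proof -
  have "ennreal a * emeasure M {x \<in> space M. ennreal a < f x}
      = (\<integral>\<^sup>+x. ennreal a * indicator {x \<in> space M. ennreal a < f x} x \<partial>M)"
    by (intro nn_integral_cmult_indicator[symmetric]) measurable
  also have "\<dots> \<le> (\<integral>\<^sup>+x. f x \<partial>M)"
    by (intro nn_integral_mono) (auto simp: indicator_def less_imp_le)
  finally show ?thesis .
qed

lemma ennsqrt_power2: "(ennsqrt a)\<^sup>2 = a"
  by (cases a) (auto simp: ennsqrt_def power2_eq_square ennreal_mult_top ennreal_mult[symmetric])

lemma ennsqrt_less_iff: "0 \<le> l \<Longrightarrow> ennreal l < ennsqrt a \<longleftrightarrow> ennreal (l\<^sup>2) < a"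
  using ennreal_power2_less_iff[of "ennreal l" "ennsqrt a"] by (simp add: ennsqrt_power2 ennreal_power)

lemma ennsqrt_measurable[measurable]: "ennsqrt \<in> borel_measurable borel"
  unfolding ennsqrt_def[abs_def] by measurable

section \<open>Local integrability\<close>

lemma set_integrable_cball:
  assumes "locally_integrable f"
  shows "set_integrable lebesgue (cball c r) f"
  using assms unfolding locally_integrable_def by auto

lemma locally_integrableI:
  fixes f :: "'a::euclidean_space \<Rightarrow> 'b::euclidean_space"
  assumes "\<And>r. set_integrable lebesgue (cball 0 r) f"
  shows "locally_integrable f"
  unfolding locally_integrable_def
proof (intro allI impI)
  fix K :: "'a set" assume K: "compact K"
  then obtain r where "K \<subseteq> cball 0 r"
    using bounded_subset_ballD[OF compact_imp_bounded, of K 0] ball_subset_cball by (meson order_trans)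
  then show "f absolutely_integrable_on K"
    using fmeasurableD[OF lmeasurable_compact[OF K]] by (intro set_integrable_subset[OF assms])
qed

lemma locally_integrable_measurable:
  assumes "locally_integrable f"
  shows "f \<in> borel_measurable lebesgue"
proof -
  have "(\<lambda>x. indicator (cball 0 (real i)) x *\<^sub>R f x) \<in> borel_measurable lebesgue" for i :: nat
    using set_integrable_cball[OF assms, of 0 "real i"]
    unfolding set_integrable_def by (rule borel_measurable_integrable)
  moreover have "(\<lambda>i. indicator (cball 0 (real i)) x *\<^sub>R f x) \<longlonglongrightarrow> f x" for x
  proof (rule tendsto_eventually)
    obtain i0 :: nat where "norm x \<le> real i0"
      using real_arch_simple by blast
    then have "\<forall>i\<ge>i0. indicator (cball 0 (real i)) x *\<^sub>R f x = f x"
      by (auto simp: indicator_def)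
    then show "\<forall>\<^sub>F i in sequentially. indicator (cball 0 (real i)) x *\<^sub>R f x = f x"
      unfolding eventually_sequentially by blast
  qed
  ultimately show ?thesis
    by (rule borel_measurable_LIMSEQ_metric)
qed

lemma integrable_imp_locally_integrable:
  assumes "integrable lebesgue f"
  shows "locally_integrable f"
proof (rule locally_integrableI)
  show "set_integrable lebesgue (cball 0 r) f" for r
    using assms unfolding set_integrable_def by (intro integrable_mult_indicator) auto
qed

lemma emeasure_cball_less_top: "emeasure lborel (cball c r) < top"
  using emeasure_lborel_cball_finite[of c r] by simp

text \<open>The ball lies in a cube of side \<open>2 * s\<close>; only the power of \<open>s\<close>
  matters, so the volume of the unit ball never enters.\<close>

lemma emeasure_cball_le:
  fixes c :: "real ^ 'n"
  assumes "0 \<le> s"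
  shows "vol (cball c s) \<le> ennreal ((2 * s) ^ CARD('n))"
proof -
  let ?B = "cbox (c - (\<chi> i. s)) (c + (\<chi> i. s))"
  have "cball c s \<subseteq> ?B"
  proof
    fix z assume "z \<in> cball c s"
    then have "norm (z - c) \<le> s"
      by (simp add: dist_norm norm_minus_commute)
    then have "\<bar>(z - c) $ i\<bar> \<le> s" for i
      using component_le_norm_cart[of "z - c" i] by linarith
    then show "z \<in> ?B"
      by (auto simp: mem_box_cart abs_le_iff algebra_simps)
  qed
  then have "vol (cball c s) \<le> vol (?B)"
    by (intro emeasure_mono) auto
  also have "\<dots> = ennreal (measure lborel (?B))"
    by (simp add: emeasure_eq_measure2)
  also have "measure lborel (?B) = (2 * s) ^ CARD('n)"
  proof -
    have "?B \<noteq> {}"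
      using assms by (simp add: interval_ne_empty_cart)
    then show ?thesis by (simp add: content_cbox_if_cart)
  qed
  finally show ?thesis .
qed

lemma square_integrable_imp_locally_integrable:
  fixes f :: "'a::euclidean_space \<Rightarrow> real"
  assumes f[measurable]: "f \<in> borel_measurable lebesgue" and ff: "integrable lebesgue (\<lambda>x. (f x)\<^sup>2)"
  shows "locally_integrable f"
proof (rule locally_integrableI)
  fix r
  have 1: "integrable lebesgue (indicator (cball 0 r) :: 'a \<Rightarrow> real)"
    by (intro integrable_real_indicator) (simp_all add: emeasure_cball_less_top)
  show "set_integrable lebesgue (cball 0 r) f"
    unfolding set_integrable_def
  proof (rule Bochner_Integration.integrable_bound[OF Bochner_Integration.integrable_add[OF 1 ff]])
    have "\<bar>f x\<bar> \<le> 1 + (f x)\<^sup>2" for x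
      using zero_le_power2[of "\<bar>f x\<bar> - 1"] by (simp add: power2_diff)
    then show "AE x in lebesgue. norm (indicator (cball 0 r) x *\<^sub>R f x)
        \<le> norm (indicator (cball 0 r) x + (f x)\<^sup>2)"
      by (auto simp: indicator_def)
  qed (intro borel_measurable_scaleR borel_measurable_indicator f, auto)
qed

lemma const_locally_integrable: "locally_integrable (\<lambda>_::'a::euclidean_space. (x::real))"
  by (intro locally_integrableI) (auto simp: set_integrable_def emeasure_cball_less_top)

lemma inner_locally_integrable:
  fixes f :: "'a::euclidean_space \<Rightarrow> 'b::euclidean_space"
  assumes "locally_integrable f"
  shows "locally_integrable (\<lambda>z. f z \<bullet> b)"
proof (rule locally_integrableI)
  fix r
  have "integrable lebesgue (\<lambda>x. (indicator (cball 0 r) x *\<^sub>R f x) \<bullet> b)"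
    using set_integrable_cball[OF assms, of 0 r] unfolding set_integrable_def by (rule integrable_inner_left)
  then show "set_integrable lebesgue (cball 0 r) (\<lambda>z. f z \<bullet> b)"
    by (simp add: set_integrable_def)
qed

lemma locally_integrable_mult_indicator:
  fixes u :: "'a::euclidean_space \<Rightarrow> real"
  assumes "locally_integrable u" "A \<in> sets lebesgue"
  shows "locally_integrable (\<lambda>z. u z * indicator A z)"
proof (rule locally_integrableI)
  fix r
  have "integrable lebesgue (\<lambda>x. indicator A x *\<^sub>R (indicator (cball 0 r) x *\<^sub>R u x))"
    using set_integrable_cball[OF assms(1), of 0 r] unfolding set_integrable_def
    by (rule integrable_mult_indicator[OF assms(2)])
  then show "set_integrable lebesgue (cball 0 r) (\<lambda>z. u z * indicator A z)"
    by (simp add: set_integrable_def mult_ac)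
qed

section \<open>Hoelder continuity, affine substitution and components of integrals\<close>

lemma holder_continuous_on:
  fixes \<phi> :: "'a::real_normed_vector \<Rightarrow> 'b::real_normed_vector"
  assumes "0 < \<alpha>" and holder: "\<And>z z'. norm (\<phi> z - \<phi> z') \<le> K * norm (z - z') powr \<alpha>"
  shows "continuous_on A \<phi>"
proof -
  have "(\<phi> \<longlongrightarrow> \<phi> a) (at a)" for a
  proof -
    have lim: "((\<lambda>z. norm (z - a)) \<longlongrightarrow> 0) (at a)"
      by (intro tendsto_norm_zero) (rule LIM_zero[OF tendsto_ident_at])
    have "((\<lambda>z. norm (z - a) powr \<alpha>) \<longlongrightarrow> 0) (at a)"
      by (rule tendsto_zero_powrI[OF lim tendsto_const]) (use \<open>0 < \<alpha>\<close> in auto)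
    then have "((\<lambda>z. K * norm (z - a) powr \<alpha>) \<longlongrightarrow> 0) (at a)"
      by (rule tendsto_mult_right_zero)
    then have "((\<lambda>z. \<phi> z - \<phi> a) \<longlongrightarrow> 0) (at a)"
      by (rule Lim_null_comparison[OF always_eventually, rotated]) (use holder in auto)
    then show ?thesis by (rule LIM_zero_cancel)
  qed
  then show ?thesis
    by (auto simp: continuous_on_def intro: tendsto_within_subset)
qed

lemma integrable_continuous_bounded_support:
  fixes g :: "'a::euclidean_space \<Rightarrow> 'b::{banach, second_countable_topology}"
  assumes "continuous_on UNIV g" "\<And>x. x \<notin> cball c r \<Longrightarrow> g x = 0"
  shows "integrable lebesgue g"
proof -
  have "integrable lborel (\<lambda>x. indicator (cball c r) x *\<^sub>R g x)"
    using assms(1) by (intro borel_integrable_compact) (auto intro: continuous_on_subset)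
  also have "(\<lambda>x. indicator (cball c r) x *\<^sub>R g x) = g"
    using assms(2) by (auto simp: indicator_def fun_eq_iff)
  finally show ?thesis
    using borel_measurable_continuous_onI[OF assms(1)] by (simp add: integrable_completion)
qed

lemma integral_lebesgue_affine:
  fixes g :: "'a::euclidean_space \<Rightarrow> 'b::{banach, second_countable_topology}"
  assumes [measurable]: "g \<in> borel_measurable borel" and c: "c \<noteq> 0"
  shows "(LINT x|lebesgue. g x) = \<bar>c\<bar> ^ DIM('a) *\<^sub>R (LINT x|lebesgue. g (a + c *\<^sub>R x))"
proof -
  have "(LINT x|lborel. g x) = (LINT x|density (distr lborel borel (\<lambda>x. a + c *\<^sub>R x)) (\<lambda>_. \<bar>c\<bar> ^ DIM('a)). g x)"
    using lborel_affine[OF c, of a] by simp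
  also have "\<dots> = (LINT x|distr lborel borel (\<lambda>x. a + c *\<^sub>R x). \<bar>c\<bar> ^ DIM('a) *\<^sub>R g x)"
    by (intro integral_density) auto
  also have "\<dots> = (LINT x|lborel. \<bar>c\<bar> ^ DIM('a) *\<^sub>R g (a + c *\<^sub>R x))"
    by (intro integral_distr) auto
  also have "\<dots> = \<bar>c\<bar> ^ DIM('a) *\<^sub>R (LINT x|lborel. g (a + c *\<^sub>R x))"
    by simp
  finally show ?thesis
    by (simp add: integral_completion)
qed

text \<open>Both factors are expanded in the basis of the scalars. Products of basis vectors have
  norm 1 because the norm of the field is multiplicative, so a complex product is controlled by real
  pairings.\<close>

lemma norm_integral_mult_le_components:
  fixes f g :: "'a \<Rightarrow> 'b::{real_normed_field, euclidean_space}"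
  assumes int: "\<And>b b'. b \<in> Basis \<Longrightarrow> b' \<in> Basis \<Longrightarrow> integrable M (\<lambda>z. (g z \<bullet> b) * (f z \<bullet> b'))"
  shows "norm (LINT z|M. g z * f z) \<le> (\<Sum>b\<in>Basis. \<Sum>b'\<in>Basis. \<bar>LINT z|M. (g z \<bullet> b) * (f z \<bullet> b')\<bar>)"
proof -
  let ?I = "\<lambda>b b'. LINT z|M. (g z \<bullet> b) * (f z \<bullet> b')"
  have eq: "g z * f z = (\<Sum>b\<in>Basis. \<Sum>b'\<in>Basis. ((g z \<bullet> b) * (f z \<bullet> b')) *\<^sub>R (b * b'))" for z
  proof -
    have "g z * f z = (\<Sum>b\<in>Basis. (g z \<bullet> b) *\<^sub>R b) * (\<Sum>b'\<in>Basis. (f z \<bullet> b') *\<^sub>R b')"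
      by (simp only: euclidean_representation)
    also have "\<dots> = (\<Sum>b\<in>Basis. \<Sum>b'\<in>Basis. ((g z \<bullet> b) *\<^sub>R b) * ((f z \<bullet> b') *\<^sub>R b'))"
      by (rule sum_product)
    finally show ?thesis by (simp add: mult.commute)
  qed
  have "(LINT z|M. g z * f z) = (\<Sum>b\<in>Basis. \<Sum>b'\<in>Basis. ?I b b' *\<^sub>R (b * b'))"
    unfolding eq using int
    by (subst Bochner_Integration.integral_sum)
      (auto intro!: sum.cong simp: Bochner_Integration.integral_sum)
  also have "norm \<dots> \<le> (\<Sum>b\<in>Basis. norm (\<Sum>b'\<in>Basis. ?I b b' *\<^sub>R (b * b')))"
    by (rule norm_sum)
  also have "\<dots> \<le> (\<Sum>b\<in>Basis. \<Sum>b'\<in>Basis. norm (?I b b' *\<^sub>R (b * b')))"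
    by (intro sum_mono norm_sum)
  also have "\<dots> = (\<Sum>b\<in>Basis. \<Sum>b'\<in>Basis. \<bar>LINT z|M. (g z \<bullet> b) * (f z \<bullet> b')\<bar>)"
    by (intro sum.cong) (auto simp: norm_mult)
  finally show ?thesis .
qed

section \<open>Dyadic cubes\<close>

definition lattice_point :: "real \<Rightarrow> int ^ 'n \<Rightarrow> real ^ 'n" where
  "lattice_point s m = (\<chi> i. s * real_of_int (m $ i))"

text \<open>Each entry of \<open>m\<close> is confined to an interval of length
  \<open>2 * R\<close>, which holds at most \<open>2 * R + 1\<close> integers.\<close>

lemma lattice_points_near:
  fixes y :: "real ^ 'n"
  assumes "s > 0" "R \<ge> 0"
  shows "finite {m. dist (lattice_point s m) y \<le> R * s}"
    and "real (card {m. dist (lattice_point s m) y \<le> R * s}) \<le> (2 * R + 1) ^ CARD('n)"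
proof -
  let ?A = "{m. dist (lattice_point s m) y \<le> R * s}"
  let ?J = "\<lambda>i. {\<lceil>y $ i / s - R\<rceil>..\<lfloor>y $ i / s + R\<rfloor>}"
  let ?B = "(\<lambda>g. \<chi> i. g i) ` (PiE UNIV ?J)"
  have sub: "?A \<subseteq> ?B"
  proof
    fix m assume "m \<in> ?A"
    then have *: "norm (lattice_point s m - y) \<le> R * s" by (simp add: dist_norm)
    have "m $ i \<in> ?J i" for i
    proof -
      have "\<bar>s * m $ i - y $ i\<bar> \<le> R * s"
        using component_le_norm_cart[of "lattice_point s m - y" i] * by (simp add: lattice_point_def)
      then have "\<bar>m $ i - y $ i / s\<bar> \<le> R"
        using assms(1) by (auto simp: abs_le_iff field_simps)
      then show ?thesis by (auto simp: ceiling_le_iff le_floor_iff abs_le_iff)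
    qed
    then show "m \<in> ?B"
      by (intro image_eqI[of _ _ "\<lambda>i. m $ i"]) auto
  qed
  have fin: "finite (PiE UNIV ?J)" by (intro finite_PiE) auto
  show "finite ?A" using sub fin finite_subset by blast
  have "card ?A \<le> card (PiE UNIV ?J)"
    using card_mono[OF _ sub] fin card_image_le[OF fin, of "\<lambda>g. \<chi> i. g i"] by (meson finite_imageI le_trans)
  also have "card (PiE UNIV ?J) = (\<Prod>i\<in>UNIV. card (?J i))"
    by (simp add: card_PiE)
  finally have "real (card ?A) \<le> (\<Prod>i\<in>(UNIV::'n set). real (card (?J i)))"
    by (simp only: of_nat_prod[symmetric] of_nat_le_iff)
  also have "\<dots> \<le> (\<Prod>i\<in>(UNIV::'n set). 2 * R + 1)"
  proof (intro prod_mono conjI)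
    fix i :: 'n
    have "real_of_int (\<lfloor>y $ i / s + R\<rfloor> - \<lceil>y $ i / s - R\<rceil>) \<le> 2 * R"
      by linarith
    then show "real (card (?J i)) \<le> 2 * R + 1" using assms(2) by auto
  qed auto
  finally show "real (card ?A) \<le> (2 * R + 1) ^ CARD('n)" by simp
qed

lemma emeasure_lattice_points_near:
  fixes y :: "real ^ 'n"
  assumes "s > 0" "R \<ge> 0"
  shows "csum UNIV (\<lambda>m. indicator {m. dist (lattice_point s m) y \<le> R * s} m)
    \<le> ennreal ((2 * R + 1) ^ CARD('n))"
  using lattice_points_near[OF assms, of y]
  by (subst nn_integral_indicator) (auto simp: emeasure_count_space ennreal_of_nat_eq_real_of_nat ennreal_leI)

text \<open>The common frame of all later sums over cubes: at scale \<open>k\<close> the number of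
  cubes that contribute times the bound \<open>b k\<close> must decay geometrically away from a
  reference scale \<open>j\<close>. The radius \<open>R k\<close> may vary with \<open>k\<close>,
  since many small cubes lie near one large cube.\<close>

lemma sum_over_dyadic_le:
  fixes f :: "int \<times> (int ^ 'n) \<Rightarrow> ennreal" and y :: "real ^ 'n" and R b :: "int \<Rightarrow> real"
  assumes le: "\<And>k m. f (k, m)
      \<le> indicator {m. dist (lattice_point (2 powi k) m) y \<le> R k * 2 powi k} m * ennreal (b k)"
    and R: "\<And>k. 0 \<le> R k" and b: "\<And>k. 0 \<le> b k" and \<rho>: "0 \<le> \<rho>" "\<rho> < 1" and c: "0 \<le> c"
    and geo: "\<And>k. (2 * R k + 1) ^ CARD('n) * b k \<le> c * \<rho> ^ nat \<bar>k - j\<bar>"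
  shows "csum UNIV (\<lambda>q. f q) \<le> ennreal (c * (2 / (1 - \<rho>)))"
proof -
  let ?A = "\<lambda>k. {m. dist (lattice_point (2 powi k) m) y \<le> R k * 2 powi k}"
  have "csum UNIV (\<lambda>q. f q) = csum UNIV (\<lambda>k. csum UNIV (\<lambda>m. f (k, m)))"
    by (rule nn_integral_fst_count_space[symmetric])
  also have "\<dots> \<le> csum UNIV (\<lambda>k. csum UNIV (\<lambda>m. indicator (?A k) m * ennreal (b k)))"
    by (intro nn_integral_mono le)
  also have "\<dots> \<le> csum UNIV (\<lambda>k. ennreal c * ennreal (\<rho> ^ nat \<bar>k - j\<bar>))"
  proof (intro nn_integral_mono)
    fix k
    have "csum UNIV (\<lambda>m. indicator (?A k) m * ennreal (b k))
      = csum UNIV (\<lambda>m. indicator (?A k) m) * ennreal (b k)"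
      by (intro nn_integral_multc) auto
    also have "\<dots> \<le> ennreal ((2 * R k + 1) ^ CARD('n)) * ennreal (b k)"
      by (intro mult_right_mono emeasure_lattice_points_near R) auto
    also have "\<dots> = ennreal ((2 * R k + 1) ^ CARD('n) * b k)"
      using R[of k] b[of k] by (intro ennreal_mult[symmetric]) auto
    also have "\<dots> \<le> ennreal (c * \<rho> ^ nat \<bar>k - j\<bar>)"
      by (intro ennreal_leI geo)
    also have "\<dots> = ennreal c * ennreal (\<rho> ^ nat \<bar>k - j\<bar>)"
      using c \<rho> by (intro ennreal_mult) auto
    finally show "csum UNIV (\<lambda>m. indicator (?A k) m * ennreal (b k)) \<le> \<dots>" .
  qed
  also have "\<dots> = ennreal c * csum UNIV (\<lambda>k. ennreal (\<rho> ^ nat \<bar>k - j\<bar>))"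
    by (intro nn_integral_cmult) auto
  also have "\<dots> \<le> ennreal c * ennreal (2 / (1 - \<rho>))"
    by (intro mult_left_mono nn_integral_geometric_int \<rho>) auto
  also have "\<dots> = ennreal (c * (2 / (1 - \<rho>)))"
    using c \<rho> by (intro ennreal_mult[symmetric]) auto
  finally show ?thesis .
qed

lemma powi_ratio_powr:
  fixes j k :: int
  assumes "j \<le> k"
  shows "((2::real) powi j / 2 powi k) powr \<alpha> = (2 powr - \<alpha>) ^ nat (k - j)"
proof -
  have "(2::real) powi j / 2 powi k = 2 powi (j - k)"
    by (simp add: power_int_diff)
  also have "\<dots> = 2 powr (real_of_int (j - k))"
    using powr_real_of_int'[of 2 "j - k"] by (simp del: of_int_diff)
  finally have "((2::real) powi j / 2 powi k) powr \<alpha> = 2 powr (real_of_int (j - k) * \<alpha>)"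
    by (simp add: powr_powr)
  also have "real_of_int (j - k) * \<alpha> = - \<alpha> * real (nat (k - j))"
    using assms by (simp add: algebra_simps)
  also have "2 powr (- \<alpha> * real (nat (k - j))) = (2 powr - \<alpha>) ^ nat (k - j)"
    by (simp only: powr_powr[symmetric]) (simp add: powr_realpow)
  finally show ?thesis .
qed

lemma ex_dyadic_scale:
  fixes t :: real
  assumes "t > 0"
  obtains k :: int where "2 powi k / 2 < t" "t \<le> 2 powi k"
proof -
  let ?k = "\<lceil>log 2 t\<rceil>"
  have e: "(2::real) powi k = 2 powr real_of_int k" for k
    using powr_real_of_int'[of 2 k] by simp
  have "t = 2 powr log 2 t" using assms by simp
  also have "\<dots> \<le> 2 powr real_of_int ?k" by (intro powr_mono) auto
  finally have 1: "t \<le> 2 powi ?k" by (simp add: e)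
  have "2 powi ?k / 2 = 2 powr (real_of_int ?k - 1)" by (simp add: e powr_diff)
  also have "\<dots> < 2 powr log 2 t" by (intro powr_less_mono) linarith+
  also have "\<dots> = t" using assms by simp
  finally show thesis using that[of ?k] 1 by simp
qed

text \<open>
  A pair \<open>(k, m)\<close> encodes the dyadic cube with side \<open>2\<^sup>k\<close> and corner \<open>2\<^sup>k m\<close>.
\<close>

definition side :: "int \<times> (int ^ 'n) \<Rightarrow> real" where
  "side p = 2 powi fst p"

definition corner :: "int \<times> (int ^ 'n) \<Rightarrow> real ^ 'n" where
  "corner p = lattice_point (side p) (snd p)"

lemma side_pos[simp]: "side p > 0"
  by (simp add: side_def)

lemma side_neq_0[simp]: "side p \<noteq> 0"
  using side_pos[of p] by linarith

lemma side_le_iff: "side p \<le> side q \<longleftrightarrow> fst p \<le> fst q"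
  using power_int_increasing[of "fst p" "fst q" "2::real"]
    power_int_strict_increasing[of "fst q" "fst p" "2::real"]
  by (auto simp: side_def not_le[symmetric])

text \<open>Floors make the cubes half-open, so those of one side partition the space and membership
  is an equation for \<open>cube_at\<close>.\<close>

definition cube :: "int \<times> (int ^ 'n) \<Rightarrow> (real ^ 'n) set" where
  "cube p = {z. \<forall>i. \<lfloor>z $ i / side p\<rfloor> = snd p $ i}"

definition cube_at :: "int \<Rightarrow> real ^ 'n \<Rightarrow> int \<times> (int ^ 'n)" where
  "cube_at k x = (k, \<chi> i. \<lfloor>x $ i / 2 powi k\<rfloor>)"

lemma fst_cube_at[simp]: "fst (cube_at k x) = k"
  by (simp add: cube_at_def)

lemma side_cube_at[simp]: "side (cube_at k x) = 2 powi k"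
  by (simp add: side_def)

lemma mem_cube_at[simp]: "x \<in> cube (cube_at k x)"
  by (simp add: cube_def cube_at_def side_def)

lemma mem_cube_iff: "x \<in> cube p \<longleftrightarrow> cube_at (fst p) x = p"
  by (cases p) (auto simp: cube_def cube_at_def side_def vec_eq_iff)

lemma mem_cube_iff_bounds:
  "z \<in> cube p \<longleftrightarrow> (\<forall>i. corner p $ i \<le> z $ i \<and> z $ i < corner p $ i + side p)"
  by (auto simp: cube_def corner_def lattice_point_def floor_eq_iff field_simps)

lemma cube_sets[measurable, simp]: "cube p \<in> sets borel" "cube p \<in> sets lebesgue"
proof -
  have "cube p = (\<Inter>i. {z. corner p $ i \<le> z $ i} \<inter> {z. z $ i < corner p $ i + side p})"
    by (auto simp: mem_cube_iff_bounds)
  moreover have "{z. corner p $ i \<le> z $ i} \<inter> {z. z $ i < corner p $ i + side p} \<in> sets borel" for i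
    by (intro sets.Int borel_closed borel_open closed_Collect_le open_Collect_less continuous_intros)
  ultimately show 1: "cube p \<in> sets borel"
    by (auto intro!: sets.finite_INT)
  show "cube p \<in> sets lebesgue"
    using 1 by (metis sets_completionI_sets sets_lborel)
qed

lemma emeasure_cube[simp]:
  fixes p :: "int \<times> (int ^ 'n)"
  shows "vol (cube p) = ennreal (side p ^ CARD('n))"
proof (rule antisym)
  let ?b = "corner p + (\<chi> i. side p)"
  have ne: "\<And>i. corner p $ i \<le> ?b $ i" by (simp add: less_imp_le)
  have c: "emeasure lborel (cbox (corner p) ?b) = ennreal (side p ^ CARD('n))"
    using ne by (subst emeasure_lborel_cbox_eq)
      (auto simp: emeasure_eq_measure2 content_cbox_cart interval_ne_empty_cart less_imp_le
        Basis_vec_def inner_axis axis_eq_axis prod.UNION_disjoint cart_eq_inner_axis[symmetric] power_eq_if)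
  have b: "emeasure lborel (box (corner p) ?b) = ennreal (side p ^ CARD('n))"
    using c by (simp add: emeasure_lborel_box_eq emeasure_lborel_cbox_eq)
  have "cube p \<subseteq> cbox (corner p) ?b"
    by (auto simp: mem_cube_iff_bounds mem_box_cart less_imp_le)
  then show "vol (cube p) \<le> ennreal (side p ^ CARD('n))"
    using emeasure_mono[of "cube p" "cbox (corner p) ?b" lebesgue] c by simp
  have "box (corner p) ?b \<subseteq> cube p"
    by (auto simp: mem_cube_iff_bounds mem_box_cart less_imp_le)
  then show "ennreal (side p ^ CARD('n)) \<le> vol (cube p)"
    using emeasure_mono[of "box (corner p) ?b" "cube p" lebesgue] b by simp
qed

text \<open>Bounding the norm by the sum of the coordinates gives the factor \<open>CARD('n)\<close>
  in place of its square root.\<close>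

lemma cube_dist_corner_le:
  fixes p :: "int \<times> (int ^ 'n)"
  assumes "z \<in> cube p"
  shows "dist z (corner p) \<le> real CARD('n) * side p"
proof -
  have "dist z (corner p) \<le> (\<Sum>i\<in>UNIV. \<bar>(z - corner p) $ i\<bar>)"
    unfolding dist_norm by (rule norm_le_l1_cart)
  also have "\<dots> \<le> (\<Sum>i\<in>(UNIV::'n set). side p)"
    using assms by (intro sum_mono) (auto simp: mem_cube_iff_bounds abs_le_iff algebra_simps less_imp_le)
  finally show ?thesis by simp
qed

lemma cube_nested:
  assumes "x \<in> cube p" "fst p \<le> k"
  shows "cube p \<subseteq> cube (cube_at k x)"
proof
  fix z assume z: "z \<in> cube p"
  let ?d = "2 ^ nat (k - fst p) :: int"
  have k: "(2::real) powi k = side p * real_of_int ?d"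
  proof -
    have "(2::real) powi k = 2 powi (fst p + int (nat (k - fst p)))" using assms(2) by simp
    also have "\<dots> = side p * real_of_int ?d"
      using assms(2) by (subst power_int_add) (auto simp: side_def power_int_def)
    finally show ?thesis .
  qed
  \<comment> \<open>Passing to a coarser grid is integer division of the index, so points with equal
    fine indices have equal coarse ones.\<close>
  have *: "\<lfloor>y / 2 powi k\<rfloor> = \<lfloor>y / side p\<rfloor> div ?d" for y :: real
    unfolding k by (subst floor_divide_real_eq_div[symmetric]) (auto simp: field_simps)
  show "z \<in> cube (cube_at k x)"
    using assms(1) z by (auto simp: cube_def cube_at_def side_def[of "(k, _)"] *)
qed

text \<open>Dyadic cubes that meet are nested, so the cubes that are largest among those meeting them
  form a disjoint family.\<close>

lemma maximal_cubes:
  fixes F :: "(int \<times> (int ^ 'n)) set"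
  assumes bdd: "\<And>p. p \<in> F \<Longrightarrow> fst p \<le> K"
  obtains S where "S \<subseteq> F" "disjoint_family_on cube S" "\<Union>(cube ` S) = \<Union>(cube ` F)"
    "\<And>p q. p \<in> S \<Longrightarrow> q \<in> F \<Longrightarrow> cube p \<inter> cube q \<noteq> {} \<Longrightarrow> fst q \<le> fst p"
proof
  define S where "S = {p \<in> F. \<forall>q\<in>F. cube p \<inter> cube q \<noteq> {} \<longrightarrow> fst q \<le> fst p}"
  show "S \<subseteq> F" by (auto simp: S_def)
  show "\<And>p q. p \<in> S \<Longrightarrow> q \<in> F \<Longrightarrow> cube p \<inter> cube q \<noteq> {} \<Longrightarrow> fst q \<le> fst p"
    by (auto simp: S_def)
  show "disjoint_family_on cube S"
    unfolding disjoint_family_on_def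
  proof (intro ballI impI, rule ccontr)
    fix p q assume pq: "p \<in> S" "q \<in> S" "p \<noteq> q" "cube p \<inter> cube q \<noteq> {}"
    then have "fst p = fst q" unfolding S_def by (auto simp: Int_commute intro!: antisym)
    moreover obtain z where "z \<in> cube p" "z \<in> cube q" using pq by auto
    ultimately have "p = q" unfolding mem_cube_iff by metis
    then show False using pq by simp
  qed
  show "\<Union>(cube ` S) = \<Union>(cube ` F)"
  proof
    show "\<Union>(cube ` F) \<subseteq> \<Union>(cube ` S)"
    proof
      fix x assume "x \<in> \<Union>(cube ` F)"
      then obtain p where p: "p \<in> F" "x \<in> cube p" by auto
      \<comment> \<open>Scales in \<open>F\<close> are at most \<open>K\<close>, so
        \<open>K - fst q\<close> is a natural number, and its minimum picks the largest cube of
        \<open>F\<close> that contains \<open>x\<close>.\<close>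
      let ?P = "\<lambda>j. \<exists>q\<in>F. x \<in> cube q \<and> nat (K - fst q) = j"
      define j where "j = (LEAST j. ?P j)"
      have "?P j" unfolding j_def using p by (intro LeastI[of ?P "nat (K - fst p)"]) auto
      then obtain q where q: "q \<in> F" "x \<in> cube q" "nat (K - fst q) = j" by auto
      have max: "fst r \<le> fst q" if "r \<in> F" "x \<in> cube r" for r
      proof -
        have "j \<le> nat (K - fst r)" unfolding j_def using that by (intro Least_le) auto
        then show ?thesis using q bdd[OF \<open>r \<in> F\<close>] bdd[OF \<open>q \<in> F\<close>] by linarith
      qed
      have "q \<in> S"
        unfolding S_def
      proof (intro CollectI conjI ballI impI q(1), rule ccontr)
        fix r assume r: "r \<in> F" "cube q \<inter> cube r \<noteq> {}" "\<not> fst r \<le> fst q"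
        then obtain z where z: "z \<in> cube q" "z \<in> cube r" by auto
        have "cube q \<subseteq> cube (cube_at (fst r) z)" using z r by (intro cube_nested) auto
        also have "cube_at (fst r) z = r" using z by (simp add: mem_cube_iff)
        finally show False using max[OF r(1)] q(2) r(3) by auto
      qed
      then show "x \<in> \<Union>(cube ` S)" using q by auto
    qed
  qed (auto simp: S_def)
qed

text \<open>The bound \<open>k \<le> 0\<close> supplies the upper bound on scales that the selection
  of maximal cubes asks for.\<close>

lemma small_cube_in_open:
  fixes x :: "real ^ 'n"
  assumes "open T" "x \<in> T"
  obtains k where "k \<le> 0" "cube (cube_at k x) \<subseteq> T"
proof -
  obtain e where e: "e > 0" "ball x e \<subseteq> T" using assms openE by blast
  obtain j :: nat where j: "(1/2) ^ j < e / (2 * real CARD('n))"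
    using real_arch_pow_inv[of "e / (2 * real CARD('n))" "1/2"] e by auto
  let ?k = "- int j"
  have s: "2 powi ?k = ((1/2) ^ j :: real)"
    by (simp add: power_int_minus power_one_over inverse_eq_divide)
  have "cube (cube_at ?k x) \<subseteq> ball x e"
  proof
    fix z assume "z \<in> cube (cube_at ?k x)"
    then have "dist z (corner (cube_at ?k x)) \<le> real CARD('n) * (1/2) ^ j"
      using cube_dist_corner_le by (metis s side_cube_at)
    moreover have "dist x (corner (cube_at ?k x)) \<le> real CARD('n) * (1/2) ^ j"
      using cube_dist_corner_le[OF mem_cube_at, of x ?k] by (metis s side_cube_at)
    ultimately have "dist x z \<le> 2 * real CARD('n) * (1/2) ^ j"
      using dist_triangle2[of x z "corner (cube_at ?k x)"] by linarith
    also have "\<dots> < e" using j by (simp add: field_simps)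
    finally show "z \<in> ball x e" by simp
  qed
  then show thesis using e that[of ?k] by auto
qed

section \<open>The Calderon-Zygmund decomposition\<close>

abbreviation mass :: "(real ^ 'n \<Rightarrow> ennreal) \<Rightarrow> (real ^ 'n) set \<Rightarrow> ennreal" where
  "mass h A \<equiv> \<integral>\<^sup>+x. h x * indicator A x \<partial>lebesgue"

text \<open>
  This replaces the Lebesgue differentiation theorem: the set \<open>E\<close> is covered by disjoint dyadic
  cubes that meet \<open>E\<close> and lie in an open set of nearly the same measure.
\<close>

lemma null_set_if_small_averages:
  fixes h :: "real ^ 'n \<Rightarrow> ennreal" and a l :: real
  assumes h[measurable]: "h \<in> borel_measurable lebesgue"
    and l: "0 < l" "l < a"
    and E: "E \<in> sets lebesgue" "vol E < top"
    and big: "\<And>x. x \<in> E \<Longrightarrow> ennreal a \<le> h x"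
    and avg: "\<And>x p. x \<in> E \<Longrightarrow> x \<in> cube p \<Longrightarrow>
      (mass h (cube p)) \<le> ennreal l * vol (cube p)"
  shows "vol E = 0"
proof -
  obtain m where m: "vol E = ennreal m" "m \<ge> 0"
    using E(2) by (cases "vol E") auto
  \<comment> \<open>With \<open>T\<close> open around \<open>E\<close> and excess below
    \<open>e\<close>, the covering cubes carry mass at least \<open>a * m\<close> and at most
    \<open>l * (m + e)\<close>. Letting \<open>e\<close> tend to 0 then forces
    \<open>m = 0\<close>.\<close>
  have "(a - l) * m \<le> l * e" if "e > 0" for e
  proof -
    obtain T where T: "open T" "E \<subseteq> T" "vol (T - E) < ennreal e"
      using sets_lebesgue_outer_open[OF E(1) \<open>e > 0\<close>] by metis
    have [measurable]: "T \<in> sets lebesgue" using T(1) by auto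
    let ?F = "{p. fst p \<le> 0 \<and> cube p \<subseteq> T \<and> cube p \<inter> E \<noteq> {}}"
    obtain S where S: "S \<subseteq> ?F" "disjoint_family_on cube S" "\<Union>(cube ` S) = \<Union>(cube ` ?F)"
      by (rule maximal_cubes[of ?F 0]) auto
    have cover: "E \<subseteq> \<Union>(cube ` S)"
      unfolding S(3)
    proof
      fix x assume "x \<in> E"
      then obtain k where "k \<le> 0" "cube (cube_at k x) \<subseteq> T"
        using T small_cube_in_open by (meson subsetD)
      moreover from this have "cube (cube_at k x) \<inter> E \<noteq> {}"
        using \<open>x \<in> E\<close> mem_cube_at[of x k] by blast
      ultimately show "x \<in> \<Union>(cube ` ?F)"
        by (intro UN_I[of "cube_at k x"]) auto
    qed
    have "ennreal a * vol E = (\<integral>\<^sup>+x. ennreal a * indicator E x \<partial>lebesgue)"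
      using E(1) by (simp add: nn_integral_cmult_indicator)
    also have "\<dots> \<le> mass h (\<Union>(cube ` S))"
      using big cover by (intro nn_integral_mono) (auto simp: indicator_def)
    also have "\<dots> = csum S (\<lambda>p. mass h (cube p))"
      using S by (intro nn_integral_UN_countable) auto
    also have "\<dots> \<le> csum S (\<lambda>p. ennreal l * vol (cube p))"
      using S(1) avg by (intro nn_integral_mono) (force simp del: emeasure_cube)
    also have "\<dots> = ennreal l * vol (\<Union>(cube ` S))"
      using S by (subst emeasure_UN_countable) (auto simp: nn_integral_cmult simp del: emeasure_cube)
    also have "\<dots> \<le> ennreal l * vol (E \<union> (T - E))"
      using S(1) by (intro mult_left_mono emeasure_mono) (use E in auto)
    also have "\<dots> \<le> ennreal l * (vol E + vol (T - E))"
      using E by (intro mult_left_mono emeasure_subadditive) auto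
    also have "\<dots> \<le> ennreal l * (vol E + ennreal e)"
      using T(3) by (intro mult_left_mono add_mono) auto
    finally have "ennreal (a * m) \<le> ennreal (l * (m + e))"
      using m l \<open>e > 0\<close> by (simp add: ennreal_mult)
    then have "a * m \<le> l * (m + e)"
      using m l \<open>e > 0\<close> by (subst (asm) ennreal_le_iff) auto
    then show ?thesis by (simp add: algebra_simps)
  qed
  note le = this
  have "m = 0"
  proof (rule ccontr)
    assume "m \<noteq> 0"
    then have "(a - l) * m > 0" using m l by simp
    then have "(a - l) * m \<le> (a - l) * m / 2"
      using le[of "(a - l) * m / (2 * l)"] l by simp
    then show False using \<open>(a - l) * m > 0\<close> by linarith
  qed
  then show ?thesis using m by simp
qed

text \<open>The cubes of \<open>S\<close> are the maximal ones on which the average of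
  \<open>h\<close> exceeds \<open>l\<close>. Finite total mass bounds their scale, so they exist;
  the parent of a maximal cube has average at most \<open>l\<close>, whence the factor
  \<open>2 ^ CARD('n)\<close>. Off the cubes every dyadic average is at most
  \<open>l\<close>.\<close>

theorem calderon_zygmund:
  fixes h :: "real ^ 'n \<Rightarrow> ennreal" and l :: real
  assumes h[measurable]: "h \<in> borel_measurable lebesgue"
    and fin: "(\<integral>\<^sup>+x. h x \<partial>lebesgue) < top" and l: "0 < l"
  obtains S :: "(int \<times> (int ^ 'n)) set" where "disjoint_family_on cube S"
    "\<And>p. p \<in> S \<Longrightarrow> ennreal l * ennreal (side p ^ CARD('n)) \<le> mass h (cube p)"
    "\<And>p. p \<in> S \<Longrightarrow> (mass h (cube p)) \<le> ennreal (2 ^ CARD('n) * l) * ennreal (side p ^ CARD('n))"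
    "AE x in lebesgue. x \<notin> \<Union>(cube ` S) \<longrightarrow> h x \<le> ennreal l"
proof -
  let ?n = "CARD('n)"
  let ?I = "\<lambda>p. mass h (cube p)"
  define F where "F = {p::int \<times> (int ^ 'n). ennreal l * ennreal (side p ^ ?n) < ?I p}"
  obtain H where H: "(\<integral>\<^sup>+x. h x \<partial>lebesgue) = ennreal H" "H \<ge> 0"
    using fin by (cases "\<integral>\<^sup>+x. h x \<partial>lebesgue") auto
  \<comment> \<open>A cube of \<open>F\<close> with scale \<open>k \<ge> 0\<close> satisfies
    \<open>k < 2 ^ k \<le> side p ^ ?n < H / l\<close>.\<close>
  have bdd: "fst p \<le> max 0 \<lceil>H / l\<rceil>" if "p \<in> F" for p
  proof (cases "fst p \<ge> 0")
    case True
    have "ennreal (l * side p ^ ?n) < ennreal H"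
    proof -
      have "ennreal (l * side p ^ ?n) < ?I p"
        using that l by (simp add: F_def ennreal_mult less_imp_le)
      also have "?I p \<le> ennreal H"
        unfolding H(1)[symmetric] by (intro nn_integral_mono) (auto simp: indicator_def)
      finally show ?thesis .
    qed
    then have "l * side p ^ ?n < H"
      using l by (subst (asm) ennreal_less_iff) (auto simp: less_imp_le)
    then have *: "side p ^ ?n < H / l" using l by (simp add: field_simps)
    obtain j where j: "fst p = int j" using True nonneg_int_cases by blast
    have "real j < 2 ^ j" by (rule of_nat_less_two_power)
    also have "2 ^ j = side p" by (simp add: side_def j)
    also have "side p \<le> side p ^ ?n"
      using power_increasing[of 1 ?n "side p"] by (simp add: side_def j)
    finally show ?thesis using * j by (simp add: le_max_iff_disj le_ceiling_iff)
  qed auto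
  obtain S where S: "S \<subseteq> F" "disjoint_family_on cube S" "\<Union>(cube ` S) = \<Union>(cube ` F)"
    "\<And>p q. p \<in> S \<Longrightarrow> q \<in> F \<Longrightarrow> cube p \<inter> cube q \<noteq> {} \<Longrightarrow> fst q \<le> fst p"
    using maximal_cubes[of F, OF bdd] by blast
  have not_F: "?I p \<le> ennreal l * ennreal (side p ^ ?n)" if "p \<notin> F" for p
    using that by (simp add: F_def)
  show thesis
  proof (rule that[of S])
    fix p assume p: "p \<in> S"
    show "ennreal l * ennreal (side p ^ ?n) \<le> ?I p"
      using p S(1) by (auto simp: F_def intro: less_imp_le)
    have c: "corner p \<in> cube p" by (simp add: mem_cube_iff_bounds)
    \<comment> \<open>The dyadic parent meets \<open>p\<close> at a larger scale, so maximality
      keeps it out of \<open>F\<close>.\<close>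
    let ?q = "cube_at (fst p + 1) (corner p)"
    have sub: "cube p \<subseteq> cube ?q" using c by (intro cube_nested) auto
    have "?q \<notin> F"
    proof
      assume "?q \<in> F"
      then have "fst ?q \<le> fst p" using p c by (intro S(4)) auto
      then show False by simp
    qed
    have "?I p \<le> ?I ?q"
      using sub by (intro nn_integral_mono) (auto simp: indicator_def)
    also have "\<dots> \<le> ennreal l * ennreal (side ?q ^ ?n)"
      using \<open>?q \<notin> F\<close> by (rule not_F)
    also have "side ?q = 2 * side p"
      by (simp add: side_def power_int_add)
    also have "ennreal l * ennreal ((2 * side p) ^ ?n) = ennreal (2 ^ ?n * l) * ennreal (side p ^ ?n)"
      using l by (simp add: ennreal_mult[symmetric] less_imp_le power_mult_distrib mult_ac)
    finally show "?I p \<le> ennreal (2 ^ ?n * l) * ennreal (side p ^ ?n)" .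
  next
    let ?\<Omega> = "\<Union>(cube ` S)"
    have [measurable]: "?\<Omega> \<in> sets lebesgue" by (intro sets.countable_UN') auto
    \<comment> \<open>Smallness of averages yields a null set only at levels strictly above
      \<open>l\<close>; these sets exhaust the points off the cubes with
      \<open>h x > l\<close>.\<close>
    define E where "E j = {x. x \<notin> ?\<Omega> \<and> h x \<ge> ennreal (l + 1 / Suc j)}" for j
    have E[measurable]: "E j \<in> sets lebesgue" for j
    proof -
      have "{x \<in> space lebesgue. x \<notin> ?\<Omega> \<and> h x \<ge> ennreal (l + 1 / Suc j)} \<in> sets lebesgue"
        by measurable
      then show ?thesis by (simp add: E_def)
    qed
    have "vol (E j) = 0" for j
    proof (rule null_set_if_small_averages[OF h l])
      have "ennreal l * vol (E j) = (\<integral>\<^sup>+x. ennreal l * indicator (E j) x \<partial>lebesgue)"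
        by (simp add: nn_integral_cmult_indicator)
      also have "\<dots> \<le> (\<integral>\<^sup>+x. h x \<partial>lebesgue)"
      proof (intro nn_integral_mono)
        fix x
        have "ennreal l \<le> ennreal (l + 1 / Suc j)" by (intro ennreal_leI) simp
        then show "ennreal l * indicator (E j) x \<le> h x"
          by (auto simp: E_def indicator_def)
      qed
      finally show "vol (E j) < top"
        using fin l by (auto simp: ennreal_mult_less_top less_top[symmetric] ennreal_mult_eq_top_iff top_unique)
      fix x p assume "x \<in> E j" "x \<in> cube p"
      then have "p \<notin> F" using S(3) by (auto simp: E_def)
      then show "?I p \<le> ennreal l * vol (cube p)"
        using not_F by simp
    qed (use E in \<open>auto simp: E_def\<close>)
    then have ae: "AE x in lebesgue. \<forall>j. x \<notin> E j"
      by (intro AE_all_countable[THEN iffD2] allI AE_not_in) (auto simp: null_sets_def)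
    have "h x \<le> ennreal l" if *: "\<forall>j. x \<notin> E j" "x \<notin> ?\<Omega>" for x
    proof (rule ccontr)
      assume "\<not> h x \<le> ennreal l"
      then have "ennreal l < h x" by simp
      then obtain r where r: "ennreal l < ennreal r" "ennreal r < h x"
        using dense[of "ennreal l" "h x"] by (metis ennreal_cases not_le top_greatest)
      then have "l < r" using l by (simp add: ennreal_less_iff)
      then obtain j where "inverse (real (Suc j)) < r - l" using reals_Archimedean[of "r - l"] by auto
      then have "ennreal (l + 1 / Suc j) \<le> ennreal r" by (intro ennreal_leI) (simp add: field_simps)
      also note r(2)
      finally have "x \<in> E j" using *(2) by (simp add: E_def less_imp_le)
      then show False using *(1) by simp
    qed
    note small = this
    show "AE x in lebesgue. x \<notin> ?\<Omega> \<longrightarrow> h x \<le> ennreal l"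
      by (rule eventually_mono[OF ae], intro impI, rule small)
  qed (rule S(2))
qed

section \<open>Averaging over the selected cubes\<close>

definition cube_avg :: "(real ^ 'n \<Rightarrow> real) \<Rightarrow> int \<times> (int ^ 'n) \<Rightarrow> real" where
  "cube_avg u p = (LINT x|lebesgue. u x * indicator (cube p) x) / side p ^ CARD('n)"

text \<open>For a disjoint family at most one cube contains \<open>x\<close>, so the description is
  unambiguous. The family is a parameter rather than derived from \<open>u\<close>, because all
  components share the cubes found for their joint modulus.\<close>

definition good_part :: "(int \<times> (int ^ 'n)) set \<Rightarrow> (real ^ 'n \<Rightarrow> real) \<Rightarrow> real ^ 'n \<Rightarrow> real" where
  "good_part S u x = (if x \<in> \<Union>(cube ` S) then cube_avg u (THE p. p \<in> S \<and> x \<in> cube p) else u x)"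

lemma good_part_on_cube:
  assumes "disjoint_family_on cube S" "p \<in> S" "x \<in> cube p"
  shows "good_part S u x = cube_avg u p"
proof -
  have "(THE p. p \<in> S \<and> x \<in> cube p) = p"
    using assms by (intro the_equality) (auto simp: disjoint_family_on_def)
  then show ?thesis using assms by (auto simp: good_part_def)
qed

lemma good_part_outside: "x \<notin> \<Union>(cube ` S) \<Longrightarrow> good_part S u x = u x"
  by (simp add: good_part_def)

lemma UN_cube_sets[measurable]: "\<Union>(cube ` S) \<in> sets lebesgue"
  by (intro sets.countable_UN') auto

lemma Compl_UN_cube_sets[measurable]: "- \<Union>(cube ` S) \<in> sets lebesgue"
  using sets.compl_sets[OF UN_cube_sets[of S]] by (simp only: Compl_eq_Diff_UNIV) simp

lemma good_part_measurable:
  assumes S: "disjoint_family_on cube S" and u[measurable]: "u \<in> borel_measurable lebesgue"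
  shows "good_part S u \<in> borel_measurable lebesgue"
proof (rule measurable_piecewise_restrict[of "insert (- \<Union>(cube ` S)) (cube ` S)"])
  fix X assume "X \<in> insert (- \<Union>(cube ` S)) (cube ` S)"
  then consider "X = - \<Union>(cube ` S)" | p where "p \<in> S" "X = cube p" by auto
  then show "good_part S u \<in> borel_measurable (restrict_space lebesgue X)"
  proof cases
    case 1
    have "u \<in> borel_measurable (restrict_space lebesgue X)"
      by (intro measurable_restrict_space1 u)
    then show ?thesis
      by (subst measurable_cong[of _ _ u]) (auto simp: 1 space_restrict_space good_part_outside)
  next
    case 2
    then show ?thesis
      by (subst measurable_cong[of _ _ "\<lambda>_. cube_avg u p"])
        (auto simp: space_restrict_space good_part_on_cube[OF S])
  qed
  show "X \<inter> space lebesgue \<in> sets lebesgue"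
    using \<open>X \<in> _\<close> Compl_UN_cube_sets[of S] by (auto simp del: Compl_UN)
qed auto

lemma cube_avg_bound:
  fixes u :: "real ^ 'n \<Rightarrow> real"
  shows "ennreal \<bar>cube_avg u p\<bar> * ennreal (side p ^ CARD('n))
    \<le> mass (\<lambda>x. ennreal \<bar>u x\<bar>) (cube p)"
proof -
  have "\<bar>cube_avg u p\<bar> * side p ^ CARD('n) = \<bar>LINT x|lebesgue. u x * indicator (cube p) x\<bar>"
    using side_pos[of p] by (simp add: cube_avg_def less_imp_le abs_mult)
  then have "ennreal \<bar>cube_avg u p\<bar> * ennreal (side p ^ CARD('n))
      = ennreal \<bar>LINT x|lebesgue. u x * indicator (cube p) x\<bar>"
    by (subst ennreal_mult[symmetric]) (auto simp: less_imp_le)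
  also have "\<dots> \<le> (\<integral>\<^sup>+x. ennreal \<bar>u x * indicator (cube p) x\<bar> \<partial>lebesgue)"
    by (rule ennreal_abs_integral_le)
  also have "\<dots> = mass (\<lambda>x. ennreal \<bar>u x\<bar>) (cube p)"
    by (intro nn_integral_cong) (auto simp: indicator_def)
  finally show ?thesis .
qed

lemma nn_integral_split_cubes:
  fixes g :: "real ^ 'n \<Rightarrow> ennreal"
  assumes S: "disjoint_family_on cube S" and [measurable]: "g \<in> borel_measurable lebesgue"
  shows "(\<integral>\<^sup>+x. g x \<partial>lebesgue) = mass g (- \<Union>(cube ` S))
    + csum S (\<lambda>p. mass g (cube p))"
proof -
  have "(\<integral>\<^sup>+x. g x \<partial>lebesgue)
    = (\<integral>\<^sup>+x. g x * indicator (- \<Union>(cube ` S)) x + g x * indicator (\<Union>(cube ` S)) x \<partial>lebesgue)"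
    by (intro nn_integral_cong) (auto simp: indicator_def)
  also have "\<dots> = mass g (- \<Union>(cube ` S))
    + mass g (\<Union>(cube ` S))"
    by (intro nn_integral_add) measurable
  also have "mass g (\<Union>(cube ` S))
    = csum S (\<lambda>p. mass g (cube p))"
    using S by (intro nn_integral_UN_countable) auto
  finally show ?thesis .
qed

text \<open>On each cube the constant average carries at most the mass of \<open>u\<close>, so the
  L^1 norm does not grow.\<close>

lemma good_part_integrable:
  fixes u :: "real ^ 'n \<Rightarrow> real"
  assumes S: "disjoint_family_on cube S" and u: "integrable lebesgue u"
  shows "integrable lebesgue (good_part S u)"
proof (rule integrableI_bounded)
  have [measurable]: "u \<in> borel_measurable lebesgue" using u by simp
  show [measurable]: "good_part S u \<in> borel_measurable lebesgue"
    by (intro good_part_measurable S) simp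
  have "(\<integral>\<^sup>+x. ennreal (norm (good_part S u x)) \<partial>lebesgue)
    = (\<integral>\<^sup>+x. ennreal \<bar>good_part S u x\<bar> * indicator (- \<Union>(cube ` S)) x \<partial>lebesgue)
    + csum S (\<lambda>p. (\<integral>\<^sup>+x. ennreal \<bar>good_part S u x\<bar> * indicator (cube p) x \<partial>lebesgue))"
    unfolding real_norm_def by (intro nn_integral_split_cubes S) measurable
  also have "csum S (\<lambda>p. (\<integral>\<^sup>+x. ennreal \<bar>good_part S u x\<bar> * indicator (cube p) x \<partial>lebesgue))
    = csum S (\<lambda>p. ennreal \<bar>cube_avg u p\<bar> * ennreal (side p ^ CARD('n)))"
  proof (intro nn_integral_cong)
    fix p assume "p \<in> space (count_space S)"
    then have "(\<integral>\<^sup>+x. ennreal \<bar>good_part S u x\<bar> * indicator (cube p) x \<partial>lebesgue)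
      = mass (\<lambda>x. ennreal \<bar>cube_avg u p\<bar>) (cube p)"
      using good_part_on_cube[OF S] by (intro nn_integral_cong) (auto simp: indicator_def)
    then show "(\<integral>\<^sup>+x. ennreal \<bar>good_part S u x\<bar> * indicator (cube p) x \<partial>lebesgue)
      = ennreal \<bar>cube_avg u p\<bar> * ennreal (side p ^ CARD('n))"
      by (simp add: nn_integral_cmult_indicator)
  qed
  also have "(\<integral>\<^sup>+x. ennreal \<bar>good_part S u x\<bar> * indicator (- \<Union>(cube ` S)) x \<partial>lebesgue)
    = mass (\<lambda>x. ennreal \<bar>u x\<bar>) (- \<Union>(cube ` S))"
    by (intro nn_integral_cong) (auto simp: indicator_def good_part_outside)
  also have "\<dots> + csum S (\<lambda>p. ennreal \<bar>cube_avg u p\<bar> * ennreal (side p ^ CARD('n)))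
    \<le> \<dots> + csum S (\<lambda>p. mass (\<lambda>x. ennreal \<bar>u x\<bar>) (cube p))"
    by (intro add_left_mono nn_integral_mono cube_avg_bound)
  also have "\<dots> = (\<integral>\<^sup>+x. ennreal \<bar>u x\<bar> \<partial>lebesgue)"
    by (intro nn_integral_split_cubes[symmetric] S) measurable
  also have "\<dots> < \<infinity>"
    using u by (simp add: integrable_iff_bounded)
  finally show "(\<integral>\<^sup>+x. ennreal (norm (good_part S u x)) \<partial>lebesgue) < \<infinity>" .
qed

text \<open>The index set is arbitrary so that it can consist of pairs of a sequence index and a
  basis vector of the scalars; \<open>h\<close> is then the modulus of the whole vector-valued
  sequence.\<close>

definition l2_modulus :: "'i set \<Rightarrow> ('i \<Rightarrow> real ^ 'n \<Rightarrow> real) \<Rightarrow> (real ^ 'n \<Rightarrow> ennreal) \<Rightarrow> bool" where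
  "l2_modulus I u h \<longleftrightarrow> countable I \<and> (\<forall>i\<in>I. u i \<in> borel_measurable lebesgue) \<and>
     h \<in> borel_measurable lebesgue \<and> (\<forall>x. csum I (\<lambda>i. ennreal ((u i x)\<^sup>2)) = (h x)\<^sup>2)"

lemma l2_modulusD:
  assumes "l2_modulus I u h"
  shows "countable I" "\<And>i. i \<in> I \<Longrightarrow> u i \<in> borel_measurable lebesgue" "h \<in> borel_measurable lebesgue"
    "\<And>x. csum I (\<lambda>i. ennreal ((u i x)\<^sup>2)) = (h x)\<^sup>2"
  using assms by (auto simp: l2_modulus_def)

lemma l2_modulus_set_integral:
  assumes uh: "l2_modulus I u h" and [measurable]: "A \<in> sets lebesgue"
  shows "csum I (\<lambda>i. (mass (\<lambda>x. ennreal \<bar>u i x\<bar>) A)\<^sup>2)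
    \<le> (mass h A)\<^sup>2"
proof (rule nn_integral_minkowski_l2[OF l2_modulusD(1)[OF uh]])
  note [measurable] = l2_modulusD(2,3)[OF uh]
  show "(\<lambda>x. ennreal \<bar>u i x\<bar> * indicator A x) \<in> borel_measurable lebesgue" if "i \<in> I" for i
    using that by measurable
  show "(\<lambda>x. h x * indicator A x) \<in> borel_measurable lebesgue" by measurable
  fix x
  have "csum I (\<lambda>i. (ennreal \<bar>u i x\<bar> * indicator A x)\<^sup>2)
    = csum I (\<lambda>i. ennreal ((u i x)\<^sup>2) * indicator A x)"
    by (intro nn_integral_cong) (auto simp: indicator_def ennreal_power)
  also have "\<dots> = (h x * indicator A x)\<^sup>2"
    by (subst nn_integral_multc) (auto simp: l2_modulusD(4)[OF uh] indicator_def)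
  finally show "csum I (\<lambda>i. (ennreal \<bar>u i x\<bar> * indicator A x)\<^sup>2) \<le> (h x * indicator A x)\<^sup>2"
    by simp
qed

text \<open>Off the cubes \<open>h^2 \<le> l * h\<close>. On a cube, Minkowski's inequality bounds
  the l^2 norm of the averages by the average of \<open>h\<close>, which is at most
  \<open>2 ^ CARD('n) * l\<close>. In both places only one of the two factors is estimated by the
  level, so the result is linear in \<open>h\<close>.\<close>

lemma good_part_l2_le:
  fixes u :: "'i \<Rightarrow> real ^ 'n \<Rightarrow> real" and h :: "real ^ 'n \<Rightarrow> ennreal"
  assumes uh: "l2_modulus I u h"
    and l: "0 < l" and S: "disjoint_family_on cube S"
    and avg: "\<And>p. p \<in> S \<Longrightarrow> (mass h (cube p))
      \<le> ennreal (2 ^ CARD('n) * l) * ennreal (side p ^ CARD('n))"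
    and off: "AE x in lebesgue. x \<notin> \<Union>(cube ` S) \<longrightarrow> h x \<le> ennreal l"
  shows "(\<integral>\<^sup>+x. csum I (\<lambda>i. ennreal ((good_part S (u i) x)\<^sup>2)) \<partial>lebesgue)
    \<le> ennreal ((1 + 2 ^ CARD('n)) * l) * (\<integral>\<^sup>+x. h x \<partial>lebesgue)"
proof -
  note I = l2_modulusD(1)[OF uh] and [measurable] = l2_modulusD(2,3)[OF uh]
  let ?n = "CARD('n)"
  let ?\<Omega> = "\<Union>(cube ` S)"
  let ?H = "\<integral>\<^sup>+x. h x \<partial>lebesgue"
  define G where "G x = csum I (\<lambda>i. ennreal ((good_part S (u i) x)\<^sup>2))" for x
  have [measurable]: "good_part S (u i) \<in> borel_measurable lebesgue" if "i \<in> I" for i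
    using that by (intro good_part_measurable S) simp
  have [measurable]: "G \<in> borel_measurable lebesgue"
    unfolding G_def[abs_def] by (intro borel_measurable_nn_integral_count_space I) measurable
  have "mass G (- ?\<Omega>) \<le> (\<integral>\<^sup>+x. ennreal l * h x \<partial>lebesgue)"
  proof (rule nn_integral_mono_AE, rule eventually_mono[OF off])
    fix x assume x: "x \<notin> ?\<Omega> \<longrightarrow> h x \<le> ennreal l"
    show "G x * indicator (- ?\<Omega>) x \<le> ennreal l * h x"
    proof (cases "x \<in> ?\<Omega>")
      case False
      then have "G x = (h x)\<^sup>2"
        unfolding G_def l2_modulusD(4)[OF uh, symmetric] by (simp add: good_part_outside)
      then show ?thesis
        using False x by (auto simp: power2_eq_square intro!: mult_right_mono)
    qed simp
  qed
  also have "\<dots> = ennreal l * ?H" by (intro nn_integral_cmult) measurable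
  finally have 1: "mass G (- ?\<Omega>) \<le> ennreal l * ?H" .
  have 2: "mass G (cube p)
    \<le> ennreal (2 ^ ?n * l) * mass h (cube p)" if p: "p \<in> S" for p
  proof -
    let ?c = "csum I (\<lambda>i. ennreal ((cube_avg (u i) p)\<^sup>2))"
    let ?s = "ennreal (side p ^ ?n)"
    let ?J = "mass h (cube p)"
    have "mass G (cube p) = (\<integral>\<^sup>+x. ?c * indicator (cube p) x \<partial>lebesgue)"
      using good_part_on_cube[OF S p] by (intro nn_integral_cong) (auto simp: indicator_def G_def)
    also have "\<dots> = ?c * ?s" by (simp add: nn_integral_cmult_indicator)
    finally have eq: "mass G (cube p) = ?c * ?s" .
    \<comment> \<open>A second factor of the volume turns averages into integrals, to which
      Minkowski's inequality applies; it is cancelled at the end.\<close>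
    have "?c * ?s * ?s = csum I (\<lambda>i. ennreal ((cube_avg (u i) p)\<^sup>2) * (?s * ?s))"
      by (subst nn_integral_multc) (auto simp: mult.assoc)
    also have "\<dots> = csum I (\<lambda>i. (ennreal \<bar>cube_avg (u i) p\<bar> * ?s)\<^sup>2)"
      by (intro nn_integral_cong) (simp add: power_mult_distrib ennreal_power power2_eq_square[of ?s, symmetric])
    also have "\<dots> \<le> csum I (\<lambda>i. (mass (\<lambda>x. ennreal \<bar>u i x\<bar>) (cube p))\<^sup>2)"
      by (intro nn_integral_mono power_mono cube_avg_bound) auto
    also have "\<dots> \<le> ?J\<^sup>2" by (intro l2_modulus_set_integral uh) simp
    also have "?J\<^sup>2 \<le> ennreal (2 ^ ?n * l) * ?s * ?J"
      using avg[OF p] by (auto simp: power2_eq_square intro!: mult_right_mono)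
    finally have "?s * (?c * ?s) \<le> ?s * (ennreal (2 ^ ?n * l) * ?J)"
      by (simp add: mult_ac)
    moreover have "?s \<noteq> 0"
      using zero_less_power[OF side_pos[of p], of ?n] by (simp add: ennreal_eq_0_iff not_le del: zero_less_power)
    ultimately show ?thesis unfolding eq
      by (subst (asm) ennreal_mult_le_mult_iff) auto
  qed
  have "csum S (\<lambda>p. mass G (cube p))
    \<le> csum S (\<lambda>p. ennreal (2 ^ ?n * l) * mass h (cube p))"
    by (intro nn_integral_mono 2) auto
  also have "\<dots> = ennreal (2 ^ ?n * l) * csum S (\<lambda>p. mass h (cube p))"
    by (intro nn_integral_cmult) auto
  also have "\<dots> \<le> ennreal (2 ^ ?n * l) * ?H"
    by (subst nn_integral_split_cubes[OF S, of h]) (auto intro!: mult_left_mono)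
  finally have "(\<integral>\<^sup>+x. G x \<partial>lebesgue) \<le> ennreal l * ?H + ennreal (2 ^ ?n * l) * ?H"
    unfolding nn_integral_split_cubes[OF S \<open>G \<in> _\<close>] using 1 by (intro add_mono)
  also have "\<dots> = ennreal ((1 + 2 ^ ?n) * l) * ?H"
    using l by (simp add: distrib_right[symmetric] ennreal_plus[symmetric] del: ennreal_plus) (simp add: algebra_simps)
  finally show ?thesis by (simp add: G_def)
qed

section \<open>Wave packet coefficients and almost orthogonality\<close>

text \<open>
  With \<open>c p\<close> the coefficient of \<open>f\<close> against \<open>\<psi> p\<close> and \<open>G = (\<Sum>p\<in>F. w p * c p * \<psi> p)\<close>, the bound on the
  row sums gives \<open>\<integral>G\<^sup>2 \<le> R * (\<Sum>p\<in>F. w p * (c p)\<^sup>2)\<close>; then expand \<open>0 \<le> \<integral>(R f - G)\<^sup>2\<close>.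
\<close>

lemma almost_orthogonality:
  fixes \<psi> :: "'p \<Rightarrow> 'a \<Rightarrow> real" and w :: "'p \<Rightarrow> real"
  assumes "finite F" "R > 0" and w: "\<And>p. p \<in> F \<Longrightarrow> 0 \<le> w p"
    and \<psi>\<psi>: "\<And>p q. p \<in> F \<Longrightarrow> q \<in> F \<Longrightarrow> integrable M (\<lambda>x. \<psi> p x * \<psi> q x)"
    and \<psi>f: "\<And>p. p \<in> F \<Longrightarrow> integrable M (\<lambda>x. \<psi> p x * f x)"
    and ff: "integrable M (\<lambda>x. (f x)\<^sup>2)"
    and row: "\<And>p. p \<in> F \<Longrightarrow> (\<Sum>q\<in>F. w q * \<bar>LINT x|M. \<psi> p x * \<psi> q x\<bar>) \<le> R"
  shows "(\<Sum>p\<in>F. w p * (LINT x|M. \<psi> p x * f x)\<^sup>2) \<le> R * (LINT x|M. (f x)\<^sup>2)"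
proof -
  define c where "c p = (LINT x|M. \<psi> p x * f x)" for p
  define K where "K p q = (LINT x|M. \<psi> p x * \<psi> q x)" for p q
  define X where "X = (\<Sum>p\<in>F. w p * (c p)\<^sup>2)"
  define G where "G x = (\<Sum>p\<in>F. w p * c p * \<psi> p x)" for x
  have K_sym: "K p q = K q p" for p q by (simp add: K_def mult.commute)
  have GG_eq: "(G x)\<^sup>2 = (\<Sum>p\<in>F. \<Sum>q\<in>F. w p * c p * (w q * c q) * (\<psi> p x * \<psi> q x))" for x
    unfolding G_def power2_eq_square sum_product by (simp add: mult_ac)
  have Gf_eq: "G x * f x = (\<Sum>p\<in>F. w p * c p * (\<psi> p x * f x))" for x
    unfolding G_def sum_distrib_right by (simp add: mult.assoc)
  have GG: "integrable M (\<lambda>x. (G x)\<^sup>2)" unfolding GG_eq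
    by (intro Bochner_Integration.integrable_sum integrable_mult_right \<psi>\<psi>)
  have Gf: "integrable M (\<lambda>x. G x * f x)" unfolding Gf_eq
    by (intro Bochner_Integration.integrable_sum integrable_mult_right \<psi>f)
  have int_Gf: "(LINT x|M. G x * f x) = X"
    unfolding Gf_eq X_def using \<psi>f
    by (simp add: Bochner_Integration.integral_sum c_def power2_eq_square mult.assoc)
  have "(LINT x|M. (G x)\<^sup>2) = (\<Sum>p\<in>F. \<Sum>q\<in>F. w p * c p * (w q * c q) * K p q)"
    unfolding GG_eq K_def
    by (simp add: Bochner_Integration.integral_sum Bochner_Integration.integrable_sum integrable_mult_right \<psi>\<psi>)
  \<comment> \<open>The inequality between arithmetic and geometric means decouples
    \<open>c p\<close> from \<open>c q\<close>. Since \<open>K\<close> is symmetric, the bound on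
    rows also controls columns.\<close>
  also have "\<dots> \<le> (\<Sum>p\<in>F. \<Sum>q\<in>F. w p * w q * \<bar>K p q\<bar> * (((c p)\<^sup>2 + (c q)\<^sup>2) / 2))"
  proof (intro sum_mono)
    fix p q assume pq: "p \<in> F" "q \<in> F"
    have "\<bar>c p * c q\<bar> \<le> ((c p)\<^sup>2 + (c q)\<^sup>2) / 2"
      using zero_le_power2[of "\<bar>c p\<bar> - \<bar>c q\<bar>"] by (simp add: power2_diff abs_mult)
    then have "w p * w q * \<bar>K p q\<bar> * \<bar>c p * c q\<bar> \<le> w p * w q * \<bar>K p q\<bar> * (((c p)\<^sup>2 + (c q)\<^sup>2) / 2)"
      using w pq by (intro mult_left_mono) auto
    moreover have "w p * c p * (w q * c q) * K p q \<le> \<bar>w p * c p * (w q * c q) * K p q\<bar>" by simp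
    ultimately show "w p * c p * (w q * c q) * K p q \<le> w p * w q * \<bar>K p q\<bar> * (((c p)\<^sup>2 + (c q)\<^sup>2) / 2)"
      using w pq by (simp add: abs_mult mult_ac)
  qed
  also have "\<dots> = (\<Sum>p\<in>F. \<Sum>q\<in>F. w p * (c p)\<^sup>2 / 2 * (w q * \<bar>K p q\<bar>))
                  + (\<Sum>p\<in>F. \<Sum>q\<in>F. w q * (c q)\<^sup>2 / 2 * (w p * \<bar>K q p\<bar>))"
    unfolding sum.distrib[symmetric] by (intro sum.cong refl) (simp add: K_sym field_simps)
  also have "(\<Sum>p\<in>F. \<Sum>q\<in>F. w q * (c q)\<^sup>2 / 2 * (w p * \<bar>K q p\<bar>))
      = (\<Sum>p\<in>F. \<Sum>q\<in>F. w p * (c p)\<^sup>2 / 2 * (w q * \<bar>K p q\<bar>))"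
    by (rule sum.swap)
  also have "(\<Sum>p\<in>F. \<Sum>q\<in>F. w p * (c p)\<^sup>2 / 2 * (w q * \<bar>K p q\<bar>)) + \<dots>
      = (\<Sum>p\<in>F. w p * (c p)\<^sup>2 * (\<Sum>q\<in>F. w q * \<bar>K p q\<bar>))"
    by (simp add: sum_distrib_left sum.distrib[symmetric] mult_ac)
  also have "\<dots> \<le> (\<Sum>p\<in>F. w p * (c p)\<^sup>2 * R)"
    using w row unfolding K_def by (intro sum_mono mult_left_mono) auto
  also have "\<dots> = R * X" by (simp add: X_def sum_distrib_left mult_ac)
  finally have int_GG: "(LINT x|M. (G x)\<^sup>2) \<le> R * X" .
  have "0 \<le> (LINT x|M. (R * f x - G x)\<^sup>2)" by simp
  also have "\<dots> = (LINT x|M. R\<^sup>2 * (f x)\<^sup>2 + (G x)\<^sup>2 - 2 * R * (G x * f x))"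
    by (intro Bochner_Integration.integral_cong) (auto simp: power2_diff power_mult_distrib)
  also have "\<dots> = R\<^sup>2 * (LINT x|M. (f x)\<^sup>2) + (LINT x|M. (G x)\<^sup>2) - 2 * R * X"
    using ff GG Gf by (simp add: int_Gf)
  finally have "R * X \<le> R * (R * (LINT x|M. (f x)\<^sup>2))"
    using int_GG by (simp add: power2_eq_square algebra_simps)
  then show ?thesis using \<open>R > 0\<close> by (simp add: X_def c_def)
qed

text \<open>
  The factor \<open>n + 1\<close> leaves room for the ball of radius \<open>s\<close> around any point of the cube with corner
  \<open>c\<close> and side \<open>s\<close>.
\<close>

definition supp_ball :: "real ^ 'n \<Rightarrow> real \<Rightarrow> (real ^ 'n) set" where
  "supp_ball c s = cball c ((real CARD('n) + 1) * s)"

lemma supp_ball_sets[measurable, simp]: "supp_ball c s \<in> sets lebesgue" "supp_ball c s \<in> sets borel"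
  by (auto simp: supp_ball_def)

abbreviation window :: "int \<times> (int ^ 'n) \<Rightarrow> (real ^ 'n) set" where
  "window q \<equiv> supp_ball (corner q) (side q)"

abbreviation pairing :: "(real ^ 'n \<Rightarrow> real) \<Rightarrow> (real ^ 'n \<Rightarrow> real) \<Rightarrow> real" where
  "pairing f g \<equiv> LINT z|lebesgue. f z * g z"

section \<open>Hoelder bumps and their inner products\<close>

locale holder_exponent =
  fixes \<alpha> :: real
  assumes \<alpha>: "0 < \<alpha>" "\<alpha> \<le> 1"
begin

text \<open>The L^1 normalised Hoelder class at scale \<open>s\<close>: height and modulus of
  continuity carry \<open>1 / s ^ n\<close>, as for a dilated function of
  \<open>holder_class\<close>. All \<open>\<phi>\<^sub>t (y - \<cdot>)\<close> with
  \<open>(y, t)\<close> in one Whitney box are to fit, up to a constant, into a single such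
  class.\<close>

definition bumps :: "real ^ 'n \<Rightarrow> real \<Rightarrow> (real ^ 'n \<Rightarrow> real) set" where
  "bumps c s = {\<psi>.
     (\<forall>z. \<psi> z \<noteq> 0 \<longrightarrow> z \<in> supp_ball c s) \<and>
     integral\<^sup>L lebesgue \<psi> = 0 \<and>
     (\<forall>z z'. \<bar>\<psi> z - \<psi> z'\<bar> \<le> (norm (z - z') / s) powr \<alpha> / s ^ CARD('n))}"

definition coef :: "real ^ 'n \<Rightarrow> real \<Rightarrow> (real ^ 'n \<Rightarrow> real) \<Rightarrow> ennreal" where
  "coef c s f = (SUP \<psi>\<in>bumps c s. ennreal \<bar>pairing \<psi> f\<bar>)"

abbreviation dcoef :: "int \<times> (int ^ 'n) \<Rightarrow> (real ^ 'n \<Rightarrow> real) \<Rightarrow> ennreal" where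
  "dcoef q \<equiv> coef (corner q) (side q)"

abbreviation dbumps :: "int \<times> (int ^ 'n) \<Rightarrow> (real ^ 'n \<Rightarrow> real) set" where
  "dbumps q \<equiv> bumps (corner q) (side q)"

lemma zero_in_bumps: "s > 0 \<Longrightarrow> (\<lambda>_. 0) \<in> bumps c s"
  by (auto simp: bumps_def)

lemma bumps_continuous:
  assumes "\<psi> \<in> bumps c s" "s > 0"
  shows "continuous_on A \<psi>"
proof (rule holder_continuous_on[OF \<alpha>(1)])
  fix z z' :: "real ^ 'a"
  have "norm (\<psi> z - \<psi> z') \<le> (norm (z - z') / s) powr \<alpha> / s ^ CARD('a)"
    using assms(1) by (simp add: bumps_def)
  then show "norm (\<psi> z - \<psi> z') \<le> 1 / (s powr \<alpha> * s ^ CARD('a)) * norm (z - z') powr \<alpha>"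
    using assms(2) by (simp add: powr_divide)
qed

lemma bumps_measurable:
  assumes "\<psi> \<in> bumps c s" "s > 0"
  shows "\<psi> \<in> borel_measurable borel" "\<psi> \<in> borel_measurable lebesgue"
proof -
  show 1: "\<psi> \<in> borel_measurable borel"
    by (rule borel_measurable_continuous_onI[OF bumps_continuous[OF assms]])
  show "\<psi> \<in> borel_measurable lebesgue"
    using 1 by (intro measurable_completion) simp
qed

text \<open>Hoelder continuity against a zero: moving by \<open>3 * N * s\<close>, with N = n + 1,
  leaves the support ball, whose diameter is \<open>2 * N * s\<close>. Then
  \<open>\<alpha> \<le> 1\<close> removes the exponent from the constant.\<close>

lemma bumps_abs_le:
  fixes c :: "real ^ 'n"
  assumes \<psi>: "\<psi> \<in> bumps c s" "s > 0"
  shows "\<bar>\<psi> z\<bar> \<le> 3 * (real CARD('n) + 1) / s ^ CARD('n)"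
proof (cases "z \<in> supp_ball c s")
  case True
  let ?N = "real CARD('n) + 1"
  obtain e :: "real ^ 'n" where e: "norm e = 3 * ?N * s"
    using vector_choose_size[of "3 * ?N * s"] \<open>s > 0\<close> by auto
  have "norm (z - c) \<le> ?N * s"
    using True by (simp add: supp_ball_def dist_norm norm_minus_commute)
  moreover have "norm e \<le> norm (z + e - c) + norm (z - c)"
    using norm_triangle_ineq4[of "z + e - c" "z - c"] by simp
  moreover have "?N * s > 0" using \<open>s > 0\<close> by simp
  ultimately have "z + e \<notin> supp_ball c s"
    using e by (simp add: supp_ball_def dist_norm norm_minus_commute[of c] algebra_simps)
  then have "\<psi> (z + e) = 0"
    using \<psi> by (auto simp: bumps_def)
  then have "\<bar>\<psi> z\<bar> \<le> (norm (z - (z + e)) / s) powr \<alpha> / s ^ CARD('n)"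
    using \<psi>(1) unfolding bumps_def by (smt (verit) mem_Collect_eq)
  also have "norm (z - (z + e)) / s = 3 * ?N"
    using e \<open>s > 0\<close> by simp
  also have "(3 * ?N) powr \<alpha> \<le> (3 * ?N) powr 1"
    using \<alpha> by (intro powr_mono) auto
  finally show ?thesis using \<open>s > 0\<close> by (simp add: divide_right_mono)
next
  case False
  then have "\<psi> z = 0" using \<psi> by (auto simp: bumps_def)
  then show ?thesis using \<open>s > 0\<close> by simp
qed

lemma bumps_mult_integrable:
  fixes c :: "real ^ 'n"
  assumes \<psi>: "\<psi> \<in> bumps c s" "s > 0" and f: "locally_integrable f"
  shows "integrable lebesgue (\<lambda>z. \<psi> z * f z)"
proof (rule Bochner_Integration.integrable_bound)
  let ?K = "3 * (real CARD('n) + 1) / s ^ CARD('n)"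
  show "integrable lebesgue (\<lambda>z. ?K * (indicator (supp_ball c s) z *\<^sub>R f z))"
    using set_integrable_cball[OF f] unfolding supp_ball_def set_integrable_def
    by (intro integrable_mult_right)
  have [simp]: "0 \<le> ?K" using \<open>s > 0\<close> by simp
  have "\<bar>\<psi> z * f z\<bar> \<le> \<bar>?K * (indicator (supp_ball c s) z * f z)\<bar>" for z
  proof (cases "z \<in> supp_ball c s")
    case True
    then show ?thesis
      using mult_right_mono[OF bumps_abs_le[OF \<psi>, of z], of "\<bar>f z\<bar>"] \<open>s > 0\<close>
      by (simp add: abs_mult)
  qed (use \<psi> in \<open>auto simp: bumps_def\<close>)
  then show "AE z in lebesgue. norm (\<psi> z * f z) \<le> norm (?K * (indicator (supp_ball c s) z *\<^sub>R f z))"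
    by simp
  note [measurable] = bumps_measurable(2)[OF \<psi>] locally_integrable_measurable[OF f]
  show "(\<lambda>z. \<psi> z * f z) \<in> borel_measurable lebesgue" by measurable
qed

lemma bumps_integrable:
  assumes "\<psi> \<in> bumps c s" "s > 0"
  shows "integrable lebesgue \<psi>"
  using bumps_mult_integrable[OF assms const_locally_integrable[of 1]] by simp

lemma bumps_locally_integrable:
  assumes "\<psi> \<in> bumps c s" "s > 0"
  shows "locally_integrable \<psi>"
  by (rule integrable_imp_locally_integrable[OF bumps_integrable[OF assms]])

text \<open>Only the size of the bumps enters. This serves for finiteness of the coefficients and
  for the far part of the sequence, where no cancellation is used.\<close>

lemma coef_le_nn_integral:
  fixes c :: "real ^ 'n"
  assumes "s > 0" and [measurable]: "f \<in> borel_measurable lebesgue"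
  shows "coef c s f \<le> ennreal (3 * (real CARD('n) + 1) / s ^ CARD('n))
    * mass (\<lambda>z. ennreal \<bar>f z\<bar>) (supp_ball c s)"
  unfolding coef_def
proof (rule SUP_least)
  fix \<psi> assume \<psi>: "\<psi> \<in> bumps c s"
  let ?K = "3 * (real CARD('n) + 1) / s ^ CARD('n)"
  have [simp]: "0 \<le> ?K" using \<open>s > 0\<close> by simp
  have "ennreal \<bar>pairing \<psi> f\<bar> \<le> (\<integral>\<^sup>+z. ennreal \<bar>\<psi> z * f z\<bar> \<partial>lebesgue)"
    by (rule ennreal_abs_integral_le)
  also have "\<dots> \<le> (\<integral>\<^sup>+z. ennreal ?K * (ennreal \<bar>f z\<bar> * indicator (supp_ball c s) z) \<partial>lebesgue)"
  proof (intro nn_integral_mono)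
    fix z
    show "ennreal \<bar>\<psi> z * f z\<bar> \<le> ennreal ?K * (ennreal \<bar>f z\<bar> * indicator (supp_ball c s) z)"
    proof (cases "z \<in> supp_ball c s")
      case True
      have "ennreal (\<bar>\<psi> z\<bar> * \<bar>f z\<bar>) \<le> ennreal (?K * \<bar>f z\<bar>)"
        by (intro ennreal_leI mult_right_mono bumps_abs_le[OF \<psi> \<open>s > 0\<close>]) simp
      also have "\<dots> = ennreal ?K * ennreal \<bar>f z\<bar>"
        using \<open>s > 0\<close> by (intro ennreal_mult) auto
      finally show ?thesis using True by (simp add: abs_mult)
    qed (use \<psi> in \<open>auto simp: bumps_def\<close>)
  qed
  also have "\<dots> = ennreal ?K * mass (\<lambda>z. ennreal \<bar>f z\<bar>) (supp_ball c s)"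
    by (intro nn_integral_cmult) measurable
  finally show "ennreal \<bar>pairing \<psi> f\<bar> \<le> \<dots>" .
qed

lemma coef_finite:
  assumes "s > 0" and f: "locally_integrable f"
  shows "coef c s f < top"
proof -
  note [measurable] = locally_integrable_measurable[OF f]
  have "mass (\<lambda>z. ennreal \<bar>f z\<bar>) (supp_ball c s) < top"
    using set_integrable_cball[OF f] unfolding supp_ball_def set_integrable_def integrable_iff_bounded
    by (auto simp: ennreal_mult abs_mult ennreal_indicator mult.commute less_top)
  then show ?thesis
    using coef_le_nn_integral[OF \<open>s > 0\<close>, of f c]
    by (auto intro: le_less_trans simp: ennreal_mult_less_top)
qed

text \<open>Half of a finite positive supremum is exceeded by some bump. One such choice per cube
  linearises the coefficients; the 2 becomes the 4 in the L^2 bound.\<close>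

lemma coef_almost_attained:
  assumes "s > 0" and f: "locally_integrable f"
  obtains \<psi> where "\<psi> \<in> bumps c s" "coef c s f \<le> 2 * ennreal \<bar>pairing \<psi> f\<bar>"
proof (cases "coef c s f = 0")
  case True
  then show ?thesis using that[OF zero_in_bumps[OF \<open>s > 0\<close>]] by simp
next
  case False
  obtain r where r: "coef c s f = ennreal r" "0 < r"
    using coef_finite[OF assms] False by (cases "coef c s f") (auto simp: less_le)
  then have "ennreal (r / 2) < coef c s f"
    by (simp add: ennreal_less_iff)
  then obtain \<psi> where \<psi>: "\<psi> \<in> bumps c s" "ennreal (r / 2) < ennreal \<bar>pairing \<psi> f\<bar>"
    unfolding coef_def less_SUP_iff by blast
  have "coef c s f = ennreal (2 * (r / 2))"
    using r by simp
  also have "\<dots> = ennreal 2 * ennreal (r / 2)"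
    using r by (intro ennreal_mult) auto
  also have "\<dots> \<le> ennreal 2 * ennreal \<bar>pairing \<psi> f\<bar>"
    by (intro mult_left_mono less_imp_le[OF \<psi>(2)]) auto
  finally show ?thesis using that[OF \<psi>(1)] by simp
qed

lemma coef_add_le:
  assumes "s > 0" "locally_integrable f" "locally_integrable g"
  shows "coef c s (\<lambda>z. f z + g z) \<le> coef c s f + coef c s g"
  unfolding coef_def[of _ _ "\<lambda>z. f z + g z"]
proof (rule SUP_least)
  fix \<psi> assume \<psi>: "\<psi> \<in> bumps c s"
  have "(LINT z|lebesgue. \<psi> z * (f z + g z)) = (pairing \<psi> f) + (pairing \<psi> g)"
    using bumps_mult_integrable[OF \<psi> \<open>s > 0\<close>] assms(2,3)
    by (simp add: distrib_left)
  then have "ennreal \<bar>LINT z|lebesgue. \<psi> z * (f z + g z)\<bar>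
    \<le> ennreal \<bar>pairing \<psi> f\<bar> + ennreal \<bar>pairing \<psi> g\<bar>"
    by (simp only: ennreal_abs_add_le)
  also have "\<dots> \<le> coef c s f + coef c s g"
    unfolding coef_def using \<psi> by (intro add_mono SUP_upper)
  finally show "ennreal \<bar>LINT z|lebesgue. \<psi> z * (f z + g z)\<bar> \<le> \<dots>" .
qed

text \<open>Mean zero of the finer bump \<open>\<psi>\<close> allows the constant
  \<open>\<psi>' c\<close> to be subtracted from \<open>\<psi>'\<close>. On the support of
  \<open>\<psi>\<close> the difference is at most
  \<open>N * (s / s') powr \<alpha> / s' ^ n\<close>, and height times volume bounds the L^1 norm of
  \<open>\<psi>\<close> by \<open>3 * N * (2 * N) ^ n\<close>.\<close>

lemma bumps_inner_le:
  fixes c c' :: "real ^ 'n"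
  defines "N \<equiv> real CARD('n) + 1"
  assumes \<psi>: "\<psi> \<in> bumps c s" "\<psi>' \<in> bumps c' s'" and s: "0 < s" "s \<le> s'"
  shows "\<bar>pairing \<psi> \<psi>'\<bar>
    \<le> 3 * N ^ 2 * (2 * N) ^ CARD('n) * (s / s') powr \<alpha> / s' ^ CARD('n)"
proof -
  let ?n = "CARD('n)"
  have N: "N \<ge> 1" by (simp add: N_def)
  have s': "s' > 0" using s by simp
  note i = bumps_mult_integrable[OF \<psi>(1) s(1) bumps_locally_integrable[OF \<psi>(2) s']]
    bumps_integrable[OF \<psi>(1) s(1)]
  have "(pairing \<psi> \<psi>') = (LINT z|lebesgue. \<psi> z * (\<psi>' z - \<psi>' c))"
    using i \<psi>(1) by (simp add: right_diff_distrib bumps_def)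
  also have "\<bar>\<dots>\<bar> \<le> (LINT z|lebesgue. 3 * N / s ^ ?n * ((N * s / s') powr \<alpha> / s' ^ ?n)
      * indicator (supp_ball c s) z)"
    unfolding real_norm_def[symmetric]
  proof (rule Bochner_Integration.integral_norm_bound_integral)
    show "integrable lebesgue (\<lambda>z. \<psi> z * (\<psi>' z - \<psi>' c))"
      using i by (simp add: right_diff_distrib)
    show "integrable lebesgue (\<lambda>z. 3 * N / s ^ ?n * ((N * s / s') powr \<alpha> / s' ^ ?n)
      * indicator (supp_ball c s) z)"
      by (intro integrable_mult_right integrable_real_indicator)
        (auto simp: supp_ball_def emeasure_cball_less_top)
    fix z
    show "norm (\<psi> z * (\<psi>' z - \<psi>' c)) \<le> 3 * N / s ^ ?n * ((N * s / s') powr \<alpha> / s' ^ ?n)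
      * indicator (supp_ball c s) z"
    proof (cases "z \<in> supp_ball c s")
      case True
      then have "norm (z - c) \<le> N * s"
        by (simp add: supp_ball_def N_def dist_norm norm_minus_commute)
      then have "(norm (z - c) / s') powr \<alpha> \<le> (N * s / s') powr \<alpha>"
        using s' \<alpha> by (intro powr_mono2 divide_right_mono) auto
      then have "\<bar>\<psi>' z - \<psi>' c\<bar> \<le> (N * s / s') powr \<alpha> / s' ^ ?n"
        using \<psi>(2) s' unfolding bumps_def
        by (smt (verit) divide_right_mono mem_Collect_eq zero_le_power)
      then have "\<bar>\<psi> z\<bar> * \<bar>\<psi>' z - \<psi>' c\<bar> \<le> 3 * N / s ^ ?n * ((N * s / s') powr \<alpha> / s' ^ ?n)"
        using bumps_abs_le[OF \<psi>(1) s(1), of z] s N unfolding N_def[symmetric]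
        by (intro mult_mono) auto
      then show ?thesis using True by (simp add: abs_mult)
    next
      case False
      then show ?thesis using \<psi>(1) by (auto simp: bumps_def)
    qed
  qed
  also have "\<dots> = 3 * N / s ^ ?n * ((N * s / s') powr \<alpha> / s' ^ ?n) * measure lebesgue (supp_ball c s)"
    by (subst integral_mult_right_zero) simp
  also have "\<dots> \<le> 3 * N / s ^ ?n * (N * (s / s') powr \<alpha> / s' ^ ?n) * ((2 * N) ^ ?n * s ^ ?n)"
  proof (intro mult_mono divide_right_mono)
    have "(N * s / s') powr \<alpha> = N powr \<alpha> * (s / s') powr \<alpha>"
      using N s s' by (simp add: powr_mult powr_divide)
    also have "N powr \<alpha> \<le> N powr 1"
      using \<alpha> N by (intro powr_mono) auto
    finally show "(N * s / s') powr \<alpha> \<le> N * (s / s') powr \<alpha>"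
      using N by (auto simp: mult_right_mono)
    have "vol (supp_ball c s) \<le> ennreal ((2 * (N * s)) ^ ?n)"
      unfolding supp_ball_def N_def using s by (intro emeasure_cball_le) auto
    also have "(2 * (N * s)) ^ ?n = (2 * N) ^ ?n * s ^ ?n"
      by (simp only: power_mult_distrib mult.assoc)
    finally show "measure lebesgue (supp_ball c s) \<le> (2 * N) ^ ?n * s ^ ?n"
      using N s unfolding measure_def by (intro enn2real_leI) auto
  qed (use N s s' in auto)
  also have "\<dots> = 3 * N ^ 2 * (2 * N) ^ ?n * (s / s') powr \<alpha> / s' ^ ?n"
    using s by (simp add: power2_eq_square)
  finally show ?thesis .
qed

lemma bumps_inner_eq_0:
  fixes c c' :: "real ^ 'n"
  assumes \<psi>: "\<psi> \<in> bumps c s" "\<psi>' \<in> bumps c' s'"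
    and far: "dist c c' > (real CARD('n) + 1) * (s + s')"
  shows "(pairing \<psi> \<psi>') = 0"
proof -
  have "\<psi> z * \<psi>' z = 0" for z
  proof (rule ccontr)
    assume "\<psi> z * \<psi>' z \<noteq> 0"
    then have "z \<in> supp_ball c s" "z \<in> supp_ball c' s'"
      using \<psi> by (auto simp: bumps_def)
    then have "dist c c' \<le> (real CARD('n) + 1) * s + (real CARD('n) + 1) * s'"
      unfolding supp_ball_def mem_cball using dist_triangle2[of c c' z] dist_commute by (smt (verit))
    then show False using far by (simp add: distrib_left)
  qed
  then show ?thesis by (simp only: Bochner_Integration.integral_zero)
qed

lemma bumps_inner_dyadic_le:
  fixes p q :: "int \<times> (int ^ 'n)"
  defines "N \<equiv> real CARD('n) + 1"
  assumes \<psi>: "\<psi> \<in> dbumps p" "\<psi>' \<in> dbumps q"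
  shows "\<bar>pairing \<psi> \<psi>'\<bar>
    \<le> 3 * N ^ 2 * (2 * N) ^ CARD('n) * (2 powr - \<alpha>) ^ nat \<bar>fst q - fst p\<bar> / max (side p) (side q) ^ CARD('n)"
proof (cases "fst p \<le> fst q")
  case True
  then have "max (side p) (side q) = side q" by (simp add: max_def side_le_iff)
  then show ?thesis
    using bumps_inner_le[OF \<psi> side_pos] True powi_ratio_powr[OF True, of \<alpha>]
    by (simp add: side_le_iff N_def) (simp add: side_def)
next
  case False
  then have le: "fst q \<le> fst p" by simp
  then have "max (side p) (side q) = side p" by (intro max_absorb1) (simp add: side_le_iff)
  then show ?thesis
    using bumps_inner_le[OF \<psi>(2,1) side_pos] le powi_ratio_powr[OF le, of \<alpha>]
    by (simp add: side_le_iff N_def mult.commute[of "\<psi> _"]) (simp add: side_def)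
qed

text \<open>At scale \<open>k\<close>, with \<mu> the larger of \<open>side p\<close> and
  \<open>2 powi k\<close>, supports can meet only for corners within \<open>2 * N * \<mu>\<close> of
  each other, which leaves on the order of \<open>(\<mu> / 2 powi k) ^ n\<close> cubes. The weight
  \<open>side q ^ n\<close> and the factor \<open>1 / \<mu> ^ n\<close> of the inner product cancel
  this count exactly, and the decay in \<open>\<bar>k - fst p\<bar>\<close> remains.\<close>

lemma bumps_inner_row_sum_le:
  fixes p :: "int \<times> (int ^ 'n)"
  defines "N \<equiv> real CARD('n) + 1"
  assumes \<psi>: "\<And>q. \<psi> q \<in> dbumps q"
  shows "csum UNIV (\<lambda>q. ennreal (side q ^ CARD('n) * \<bar>pairing (\<psi> p) (\<psi> q)\<bar>))
    \<le> ennreal (3 * N ^ 2 * (2 * N) ^ CARD('n) * (4 * N + 1) ^ CARD('n) * (2 / (1 - 2 powr - \<alpha>)))"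
proof -
  let ?n = "CARD('n)"
  let ?K = "3 * N ^ 2 * (2 * N) ^ ?n"
  let ?\<rho> = "2 powr - \<alpha>"
  have N: "N \<ge> 1" by (simp add: N_def)
  have \<rho>: "0 \<le> ?\<rho>" "?\<rho> < 1" using \<alpha> by (auto intro: powr_less_one)
  let ?s = "\<lambda>k. 2 powi k :: real"
  let ?\<mu> = "\<lambda>k. max (side p) (?s k)"
  let ?A = "\<lambda>k. {m. dist (lattice_point (?s k) m) (corner p) \<le> (2 * N * ?\<mu> k / ?s k) * ?s k}"
  let ?B = "\<lambda>k. ?s k ^ ?n * (?K * ?\<rho> ^ nat \<bar>k - fst p\<bar> / ?\<mu> k ^ ?n)"
  have \<mu>: "0 \<le> ?\<mu> k" for k by (rule max.coboundedI1) (simp add: less_imp_le)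
  have B: "0 \<le> ?B k" for k
    using N by (intro mult_nonneg_nonneg divide_nonneg_nonneg zero_le_power \<mu>) auto
  have le: "ennreal (side (k, m) ^ ?n * \<bar>pairing (\<psi> p) (\<psi> (k, m))\<bar>)
    \<le> indicator (?A k) m * ennreal (?B k)" for k m
  proof (cases "m \<in> ?A k")
    case True
    have "side (k, m) ^ ?n * \<bar>pairing (\<psi> p) (\<psi> (k, m))\<bar> \<le> ?B k"
      using bumps_inner_dyadic_le[OF \<psi>[of p] \<psi>[of "(k, m)"]]
      by (intro mult_mono) (auto simp: N_def side_def)
    then show ?thesis using True by (simp add: ennreal_leI)
  next
    case False
    have "N * (side p + ?s k) \<le> N * (2 * ?\<mu> k)"
      using N by (intro mult_left_mono) auto
    then have "N * (side p + ?s k) < dist (corner p) (corner (k, m))"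
      using False by (simp add: dist_commute corner_def side_def)
    then have "(pairing (\<psi> p) (\<psi> (k, m))) = 0"
      by (intro bumps_inner_eq_0[OF \<psi> \<psi>]) (simp add: N_def side_def)
    then show ?thesis by simp
  qed
  show ?thesis
  proof (rule sum_over_dyadic_le[where j = "fst p" and b = ?B, OF le _ B \<rho>])
    fix k :: int
    have s: "?s k > 0" by simp
    have \<mu>: "?\<mu> k > 0" "?\<mu> k \<ge> ?s k" by (auto simp: max_def)
    let ?R = "2 * N * ?\<mu> k / ?s k"
    show R: "0 \<le> ?R" using N s by (intro divide_nonneg_pos mult_nonneg_nonneg less_imp_le[OF \<mu>(1)]) auto
    have "2 * ?R + 1 \<le> (4 * N + 1) * ?\<mu> k / ?s k"
      using \<mu> s by (simp add: field_simps)
    then have "(2 * ?R + 1) ^ ?n \<le> ((4 * N + 1) * ?\<mu> k / ?s k) ^ ?n"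
      using R by (intro power_mono) auto
    then have "(2 * ?R + 1) ^ ?n * ?B k \<le> ((4 * N + 1) * ?\<mu> k / ?s k) ^ ?n * ?B k"
      by (intro mult_right_mono B)
    also have "\<dots> = ?K * (4 * N + 1) ^ ?n * ?\<rho> ^ nat \<bar>k - fst p\<bar>"
      using \<mu>(1) s by (simp add: power_divide power_mult_distrib)
    finally show "(2 * ?R + 1) ^ ?n * ?B k \<le> \<dots>" .
  qed (use N in auto)
qed

text \<open>Almost orthogonality is applied to nearly extremal bumps chosen for the given
  \<open>f\<close>. This is legitimate because the row bound holds for every choice of one bump per
  cube.\<close>

lemma sum_coef_power2_le:
  obtains C :: real where "C > 0" and
    "\<And>f :: real ^ 'n \<Rightarrow> real. f \<in> borel_measurable lebesgue \<Longrightarrow>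
      (csum UNIV (\<lambda>p. ennreal (side p ^ CARD('n)) * (dcoef p f)\<^sup>2))
      \<le> ennreal C * (\<integral>\<^sup>+x. ennreal ((f x)\<^sup>2) \<partial>lebesgue)"
proof -
  let ?n = "CARD('n)"
  define N where "N = real ?n + 1"
  define R where "R = 3 * N ^ 2 * (2 * N) ^ ?n * (4 * N + 1) ^ ?n * (2 / (1 - 2 powr - \<alpha>))"
  have "2 powr - \<alpha> < 1" using \<alpha> by (auto intro: powr_less_one)
  then have R: "R > 0" by (auto simp: R_def N_def intro!: mult_pos_pos zero_less_power divide_pos_pos)
  show thesis
  proof (rule that[of "4 * R"])
    fix f :: "real ^ 'n \<Rightarrow> real" assume f[measurable]: "f \<in> borel_measurable lebesgue"
    show "csum UNIV (\<lambda>p. ennreal (side p ^ ?n) * (dcoef p f)\<^sup>2)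
      \<le> ennreal (4 * R) * (\<integral>\<^sup>+x. ennreal ((f x)\<^sup>2) \<partial>lebesgue)"
    proof (cases "(\<integral>\<^sup>+x. ennreal ((f x)\<^sup>2) \<partial>lebesgue) < top")
      case True
      then have ff: "integrable lebesgue (\<lambda>x. (f x)\<^sup>2)"
        by (intro integrableI_bounded) auto
      note f_loc = square_integrable_imp_locally_integrable[OF f ff]
      have "\<exists>\<psi>. \<psi> \<in> dbumps p \<and>
          dcoef p f \<le> 2 * ennreal \<bar>pairing \<psi> f\<bar>" for p
        using coef_almost_attained[OF side_pos f_loc] by blast
      then obtain \<psi> where \<psi>: "\<And>p. \<psi> p \<in> dbumps p"
        "\<And>p. dcoef p f \<le> 2 * ennreal \<bar>pairing (\<psi> p) f\<bar>"
        by metis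
      note \<psi>_loc = bumps_locally_integrable[OF \<psi>(1) side_pos]
      show ?thesis
      proof (rule nn_integral_count_space_le[OF countableI_type])
        fix F :: "(int \<times> (int ^ 'n)) set" assume F: "finite F"
        have "(\<Sum>p\<in>F. ennreal (side p ^ ?n) * (dcoef p f)\<^sup>2)
          \<le> (\<Sum>p\<in>F. ennreal (4 * (side p ^ ?n * (pairing (\<psi> p) f)\<^sup>2)))"
        proof (rule sum_mono)
          fix p
          have "(dcoef p f)\<^sup>2 \<le> (ennreal (2 * \<bar>pairing (\<psi> p) f\<bar>))\<^sup>2"
            using \<psi>(2)[of p] by (intro power_mono) (auto simp: ennreal_mult)
          also have "\<dots> = ennreal (4 * (pairing (\<psi> p) f)\<^sup>2)"
            by (simp add: ennreal_power power_mult_distrib)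
          finally have "ennreal (side p ^ ?n) * (dcoef p f)\<^sup>2
              \<le> ennreal (side p ^ ?n) * ennreal (4 * (pairing (\<psi> p) f)\<^sup>2)"
            by (intro mult_left_mono) auto
          also have "\<dots> = ennreal (side p ^ ?n * (4 * (pairing (\<psi> p) f)\<^sup>2))"
            by (intro ennreal_mult[symmetric]) (auto simp: less_imp_le)
          finally show "ennreal (side p ^ ?n) * (dcoef p f)\<^sup>2
              \<le> ennreal (4 * (side p ^ ?n * (pairing (\<psi> p) f)\<^sup>2))"
            by (simp add: mult_ac)
        qed
        also have "\<dots> = ennreal (4 * (\<Sum>p\<in>F. side p ^ ?n * (pairing (\<psi> p) f)\<^sup>2))"
          by (subst sum_ennreal) (auto simp: sum_distrib_left less_imp_le)
        also have "\<dots> \<le> ennreal (4 * (R * (LINT x|lebesgue. (f x)\<^sup>2)))"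
        proof (intro ennreal_leI mult_left_mono almost_orthogonality F R ff)
          show "(\<Sum>q\<in>F. side q ^ ?n * \<bar>pairing (\<psi> p) (\<psi> q)\<bar>) \<le> R" for p
          proof -
            have "ennreal (\<Sum>q\<in>F. side q ^ ?n * \<bar>pairing (\<psi> p) (\<psi> q)\<bar>)
              = (\<Sum>q\<in>F. ennreal (side q ^ ?n * \<bar>pairing (\<psi> p) (\<psi> q)\<bar>))"
              by (intro sum_ennreal[symmetric]) (auto simp: less_imp_le)
            also have "\<dots> \<le> csum UNIV (\<lambda>q. ennreal (side q ^ ?n * \<bar>pairing (\<psi> p) (\<psi> q)\<bar>))"
              using F by (intro sum_le_nn_integral_count_space) auto
            also have "\<dots> \<le> ennreal R"
              unfolding R_def N_def by (intro bumps_inner_row_sum_le \<psi>(1))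
            finally show ?thesis using R by (simp add: ennreal_le_iff)
          qed
        qed (use bumps_mult_integrable[OF \<psi>(1) side_pos] f_loc \<psi>_loc in \<open>auto simp: less_imp_le\<close>)
        also have "\<dots> = ennreal (4 * R) * ennreal (LINT x|lebesgue. (f x)\<^sup>2)"
          using R by (subst ennreal_mult[symmetric]) (auto simp: mult.assoc)
        also have "ennreal (LINT x|lebesgue. (f x)\<^sup>2) = (\<integral>\<^sup>+x. ennreal ((f x)\<^sup>2) \<partial>lebesgue)"
          using ff by (intro nn_integral_eq_integral[symmetric]) auto
        finally show "(\<Sum>p\<in>F. ennreal (side p ^ ?n) * (dcoef p f)\<^sup>2)
          \<le> ennreal (4 * R) * (\<integral>\<^sup>+x. ennreal ((f x)\<^sup>2) \<partial>lebesgue)" .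
      qed
    next
      case False
      then show ?thesis using R by (simp add: less_top[symmetric] ennreal_mult_top)
    qed
  qed (use R in simp)
qed

section \<open>The weak type estimate\<close>

text \<open>No power of \<open>side q\<close> occurs: the measure \<open>dy dt / t ^ (n + 1)\<close>
  of a Whitney box is bounded above and below by constants.\<close>

definition dsq :: "(real ^ 'n \<Rightarrow> real) \<Rightarrow> real ^ 'n \<Rightarrow> ennreal" where
  "dsq u x = csum UNIV (\<lambda>q. (dcoef q u)\<^sup>2 * indicator (window q) x)"

lemma dsq_measurable[measurable]: "dsq u \<in> borel_measurable lebesgue"
  unfolding dsq_def[abs_def] by (intro borel_measurable_nn_integral_count_space) auto

lemma dsq_le_if_dcoef_le:
  assumes "\<And>q. dcoef q u \<le> a q + b q"
  shows "dsq u x \<le> 2 * csum UNIV (\<lambda>q. (a q)\<^sup>2 * indicator (window q) x)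
    + 2 * csum UNIV (\<lambda>q. (b q)\<^sup>2 * indicator (window q) x)"
proof -
  have "dsq u x \<le> csum UNIV (\<lambda>q. 2 * ((a q)\<^sup>2 * indicator (window q) x)
      + 2 * ((b q)\<^sup>2 * indicator (window q) x))"
    unfolding dsq_def
  proof (intro nn_integral_mono)
    fix q
    have "(dcoef q u)\<^sup>2 \<le> 2 * (a q)\<^sup>2 + 2 * (b q)\<^sup>2"
      by (rule order_trans[OF power_mono[OF assms] ennreal_add_power2_le]) simp
    then show "(dcoef q u)\<^sup>2 * indicator (window q) x
        \<le> 2 * ((a q)\<^sup>2 * indicator (window q) x) + 2 * ((b q)\<^sup>2 * indicator (window q) x)"
      by (auto simp: indicator_def)
  qed
  then show ?thesis by (simp add: nn_integral_add nn_integral_cmult)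
qed

lemma dsq_add_le:
  fixes u v :: "real ^ 'n \<Rightarrow> real"
  assumes "locally_integrable u" "locally_integrable v"
  shows "dsq (\<lambda>z. u z + v z) x \<le> 2 * dsq u x + 2 * dsq v x"
  unfolding dsq_def[of u] dsq_def[of v]
  by (rule dsq_le_if_dcoef_le) (rule coef_add_le[OF side_pos assms])

text \<open>Integration turns the indicator of a window into its volume, at most a multiple of
  \<open>side q ^ n\<close>, which is the weight of the almost orthogonality bound.\<close>

lemma nn_integral_dsq_le:
  obtains C :: real where "C > 0" and
    "\<And>f :: real ^ 'n \<Rightarrow> real. f \<in> borel_measurable lebesgue \<Longrightarrow>
      (\<integral>\<^sup>+x. dsq f x \<partial>lebesgue) \<le> ennreal C * (\<integral>\<^sup>+x. ennreal ((f x)\<^sup>2) \<partial>lebesgue)"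
proof (rule sum_coef_power2_le[where 'n = 'n], goal_cases)
  case (1 C)
  note C = 1(2,3)
  let ?n = "CARD('n)"
  let ?N = "real ?n + 1"
  show thesis
  proof (rule that[of "(2 * ?N) ^ ?n * C"])
    fix f :: "real ^ 'n \<Rightarrow> real" assume f: "f \<in> borel_measurable lebesgue"
    let ?c = "\<lambda>q. dcoef q f"
    have "(\<integral>\<^sup>+x. dsq f x \<partial>lebesgue)
      = csum UNIV (\<lambda>q. (\<integral>\<^sup>+x. (?c q)\<^sup>2 * indicator (window q) x \<partial>lebesgue))"
      unfolding dsq_def by (intro nn_integral_count_space_nn_integral) auto
    also have "\<dots> = csum UNIV (\<lambda>q. (?c q)\<^sup>2 * vol (window q))"
      by (simp add: nn_integral_cmult_indicator)
    also have "\<dots> \<le> csum UNIV (\<lambda>q. ennreal ((2 * ?N) ^ ?n) * (ennreal (side q ^ ?n) * (?c q)\<^sup>2))"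
    proof (intro nn_integral_mono)
      fix q :: "int \<times> (int ^ 'n)"
      have "vol (window q) \<le> ennreal ((2 * (?N * side q)) ^ ?n)"
        unfolding supp_ball_def by (intro emeasure_cball_le) (simp add: less_imp_le)
      also have "(2 * (?N * side q)) ^ ?n = (2 * ?N) ^ ?n * side q ^ ?n"
        by (simp only: power_mult_distrib mult.assoc)
      also have "ennreal \<dots> = ennreal ((2 * ?N) ^ ?n) * ennreal (side q ^ ?n)"
        by (intro ennreal_mult) (auto simp: less_imp_le)
      finally show "(?c q)\<^sup>2 * vol (window q)
        \<le> ennreal ((2 * ?N) ^ ?n) * (ennreal (side q ^ ?n) * (?c q)\<^sup>2)"
        by (subst mult.commute, subst mult.assoc[symmetric]) (intro mult_right_mono, auto)
    qed
    also have "\<dots> = ennreal ((2 * ?N) ^ ?n) * csum UNIV (\<lambda>q. ennreal (side q ^ ?n) * (?c q)\<^sup>2)"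
      by (intro nn_integral_cmult) auto
    also have "\<dots> \<le> ennreal ((2 * ?N) ^ ?n) * (ennreal C * (\<integral>\<^sup>+x. ennreal ((f x)\<^sup>2) \<partial>lebesgue))"
      by (intro mult_left_mono C f) auto
    also have "\<dots> = ennreal ((2 * ?N) ^ ?n * C) * (\<integral>\<^sup>+x. ennreal ((f x)\<^sup>2) \<partial>lebesgue)"
      using C(1) by (subst ennreal_mult) (auto simp: mult.assoc)
    finally show "(\<integral>\<^sup>+x. dsq f x \<partial>lebesgue) \<le> \<dots>" .
  qed (use C(1) in simp)
qed

text \<open>A bound for the oscillation over \<open>cube p\<close> of a bump at \<open>q\<close>:
  points of the cube are within \<open>CARD('n) * side p\<close> of its corner.\<close>

definition bad_weight :: "int \<times> (int ^ 'n) \<Rightarrow> int \<times> (int ^ 'n) \<Rightarrow> ennreal" where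
  "bad_weight q p = (if cube p \<inter> window q = {} then 0
     else ennreal ((real CARD('n) * side p / side q) powr \<alpha> / side q ^ CARD('n)))"

text \<open>
  Far from the cube \<open>p\<close>, a window \<open>q\<close> that meets \<open>p\<close> has at least the scale of \<open>p\<close>; dropping the smaller
  scales makes the sum over \<open>q\<close> converge.
\<close>

abbreviation outer_weight :: "int \<times> (int ^ 'n) \<Rightarrow> int \<times> (int ^ 'n) \<Rightarrow> ennreal" where
  "outer_weight q p \<equiv> if fst p \<le> fst q then bad_weight q p else 0"

text \<open>Since \<open>u - cube_avg u p\<close> has mean zero on the cube, the value of the bump
  at the corner may be subtracted, leaving its oscillation. The 2 arises because the average has at
  most the mass of \<open>u\<close> there.\<close>

lemma bump_cancellation_on_cube:
  fixes u :: "real ^ 'n \<Rightarrow> real"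
  assumes u: "integrable lebesgue u"
    and \<psi>: "\<psi> \<in> dbumps q"
  shows "ennreal \<bar>LINT x|lebesgue. \<psi> x * (u x - cube_avg u p) * indicator (cube p) x\<bar>
    \<le> bad_weight q p * (2 * mass (\<lambda>x. ennreal \<bar>u x\<bar>) (cube p))" (is "ennreal \<bar>?L\<bar> \<le> _")
proof (cases "cube p \<inter> window q = {}")
  case True
  then have "\<psi> x * (u x - cube_avg u p) * indicator (cube p) x = 0" for x
    using \<psi> by (auto simp: bumps_def indicator_def)
  then have "?L = 0"
    by (simp only: Bochner_Integration.integral_zero)
  then show ?thesis by simp
next
  case False
  let ?n = "CARD('n)"
  define w where "w = (\<lambda>x. (u x - cube_avg u p) * indicator (cube p) x)"
  have uc: "integrable lebesgue (\<lambda>x. u x * indicator (cube p) x)"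
    using integrable_mult_indicator[OF cube_sets(2) u, of p] by (simp add: mult.commute)
  have ac: "integrable lebesgue (\<lambda>x. cube_avg u p * indicator (cube p) x)"
    by (intro integrable_mult_right integrable_real_indicator) auto
  have w: "integrable lebesgue w"
    using uc ac by (simp add: w_def left_diff_distrib)
  have "(LINT x|lebesgue. w x) = (LINT x|lebesgue. u x * indicator (cube p) x) - cube_avg u p * measure lebesgue (cube p)"
    using uc ac by (simp add: w_def left_diff_distrib)
  also have "measure lebesgue (cube p) = side p ^ ?n"
    by (simp add: measure_def less_imp_le)
  finally have w0: "(LINT x|lebesgue. w x) = 0"
    using side_pos[of p] by (simp add: cube_avg_def)
  have \<psi>w: "integrable lebesgue (\<lambda>x. \<psi> x * w x)"
    using bumps_mult_integrable[OF \<psi> side_pos integrable_imp_locally_integrable[OF w]] .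
  let ?\<tau> = "(real ?n * side p / side q) powr \<alpha> / side q ^ ?n"
  have [simp]: "0 \<le> ?\<tau>" by (simp add: less_imp_le)
  let ?z = "corner p"
  have "?L = (LINT x|lebesgue. \<psi> x * w x)"
    by (simp add: w_def mult.assoc)
  also have "\<dots> = (LINT x|lebesgue. (\<psi> x - \<psi> ?z) * w x)"
    using \<psi>w w w0 by (simp add: left_diff_distrib)
  finally have "ennreal \<bar>?L\<bar>
    = ennreal \<bar>LINT x|lebesgue. (\<psi> x - \<psi> ?z) * w x\<bar>" by simp
  also have "\<dots> \<le> (\<integral>\<^sup>+x. ennreal \<bar>(\<psi> x - \<psi> ?z) * w x\<bar> \<partial>lebesgue)"
    by (rule ennreal_abs_integral_le)
  also have "\<dots> \<le> (\<integral>\<^sup>+x. ennreal ?\<tau> * (ennreal \<bar>u x\<bar> * indicator (cube p) x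
      + ennreal \<bar>cube_avg u p\<bar> * indicator (cube p) x) \<partial>lebesgue)"
  proof (intro nn_integral_mono)
    fix x
    show "ennreal \<bar>(\<psi> x - \<psi> ?z) * w x\<bar> \<le> ennreal ?\<tau> * (ennreal \<bar>u x\<bar> * indicator (cube p) x
      + ennreal \<bar>cube_avg u p\<bar> * indicator (cube p) x)"
    proof (cases "x \<in> cube p")
      case True
      have "\<bar>\<psi> x - \<psi> ?z\<bar> \<le> (norm (x - ?z) / side q) powr \<alpha> / side q ^ ?n"
        using \<psi> by (auto simp: bumps_def)
      also have "\<dots> \<le> ?\<tau>"
        using cube_dist_corner_le[OF True] \<alpha>
        by (intro divide_right_mono powr_mono2) (auto simp: dist_norm less_imp_le)
      finally have "\<bar>(\<psi> x - \<psi> ?z) * w x\<bar> \<le> ?\<tau> * (\<bar>u x\<bar> + \<bar>cube_avg u p\<bar>)"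
        using True unfolding abs_mult by (intro mult_mono) (auto simp: w_def)
      then have "ennreal \<bar>(\<psi> x - \<psi> ?z) * w x\<bar> \<le> ennreal (?\<tau> * (\<bar>u x\<bar> + \<bar>cube_avg u p\<bar>))"
        by (rule ennreal_leI)
      also have "\<dots> = ennreal ?\<tau> * (ennreal \<bar>u x\<bar> + ennreal \<bar>cube_avg u p\<bar>)"
        by (subst ennreal_mult) (auto simp: less_imp_le)
      finally show ?thesis using True by simp
    qed (simp add: w_def)
  qed
  also have "\<dots> = ennreal ?\<tau> * (mass (\<lambda>x. ennreal \<bar>u x\<bar>) (cube p)
      + ennreal \<bar>cube_avg u p\<bar> * ennreal (side p ^ ?n))"
    using borel_measurable_integrable[OF u]
    by (simp add: nn_integral_cmult nn_integral_add nn_integral_cmult_indicator)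
  also have "\<dots> \<le> ennreal ?\<tau> * (mass (\<lambda>x. ennreal \<bar>u x\<bar>) (cube p)
      + mass (\<lambda>x. ennreal \<bar>u x\<bar>) (cube p))"
    by (intro mult_left_mono add_left_mono cube_avg_bound) auto
  also have "\<dots> = bad_weight q p * (2 * mass (\<lambda>x. ennreal \<bar>u x\<bar>) (cube p))"
    using False by (simp add: bad_weight_def mult_2)
  finally show ?thesis .
qed

text \<open>The pairing with the bad part is split over the cubes before absolute values are taken,
  so the mean zero on each cube is not lost.\<close>

lemma coef_le_good_bad:
  fixes u :: "real ^ 'n \<Rightarrow> real"
  assumes u: "integrable lebesgue u"
    and S: "disjoint_family_on cube S"
  shows "dcoef q u \<le> dcoef q (good_part S u)
    + csum S (\<lambda>p. bad_weight q p * (2 * mass (\<lambda>x. ennreal \<bar>u x\<bar>) (cube p)))"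
  unfolding coef_def[of _ _ u]
proof (rule SUP_least)
  fix \<psi> assume \<psi>: "\<psi> \<in> dbumps q"
  let ?g = "good_part S u"
  note g = good_part_integrable[OF S u]
  note \<psi>u = bumps_mult_integrable[OF \<psi> side_pos integrable_imp_locally_integrable[OF u]]
  note \<psi>g = bumps_mult_integrable[OF \<psi> side_pos integrable_imp_locally_integrable[OF g]]
  have "(pairing \<psi> u) = (pairing \<psi> ?g) + (LINT x|lebesgue. \<psi> x * (u x - ?g x))"
    using \<psi>u \<psi>g by (simp add: right_diff_distrib)
  then have "ennreal \<bar>pairing \<psi> u\<bar>
    \<le> ennreal \<bar>pairing \<psi> ?g\<bar> + ennreal \<bar>LINT x|lebesgue. \<psi> x * (u x - ?g x)\<bar>"
    by (simp only: ennreal_abs_add_le)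
  also have "\<dots> \<le> dcoef q ?g
    + csum S (\<lambda>p. ennreal \<bar>LINT x|lebesgue. \<psi> x * (u x - ?g x) * indicator (cube p) x\<bar>)"
    unfolding coef_def using \<psi>u \<psi>g S
    by (intro add_mono SUP_upper \<psi> ennreal_abs_integral_le_sum_parts)
      (auto simp: right_diff_distrib good_part_outside)
  also have "\<dots> \<le> dcoef q ?g + csum S (\<lambda>p. bad_weight q p
      * (2 * mass (\<lambda>x. ennreal \<bar>u x\<bar>) (cube p)))"
  proof (intro add_left_mono nn_integral_mono)
    fix p assume "p \<in> space (count_space S)"
    then have "(LINT x|lebesgue. \<psi> x * (u x - ?g x) * indicator (cube p) x)
        = (LINT x|lebesgue. \<psi> x * (u x - cube_avg u p) * indicator (cube p) x)"
      using good_part_on_cube[OF S]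
      by (intro Bochner_Integration.integral_cong) (auto simp: indicator_def)
    then show "ennreal \<bar>LINT x|lebesgue. \<psi> x * (u x - ?g x) * indicator (cube p) x\<bar>
      \<le> bad_weight q p * (2 * mass (\<lambda>x. ennreal \<bar>u x\<bar>) (cube p))"
      using bump_cancellation_on_cube[OF u \<psi>, of p] by simp
  qed
  finally show "ennreal \<bar>pairing \<psi> u\<bar> \<le> \<dots>" .
qed

text \<open>A window of scale at least that of \<open>p\<close> that meets \<open>cube p\<close> has
  its corner within \<open>2 * N\<close> of its sides from \<open>corner p\<close>, so each scale
  contributes at most \<open>(4 * N + 1) ^ n\<close> windows. Their volume cancels
  \<open>1 / side q ^ n\<close>, and the Hoelder factor gives the geometric decay.\<close>

lemma bad_weight_sum_le:
  fixes p :: "int \<times> (int ^ 'n)"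
  defines "N \<equiv> real CARD('n) + 1"
  shows "csum UNIV (\<lambda>q. outer_weight q p * vol (window q))
    \<le> ennreal (N * (2 * N) ^ CARD('n) * (4 * N + 1) ^ CARD('n) * (2 / (1 - 2 powr - \<alpha>)))"
proof -
  let ?n = "CARD('n)"
  let ?\<rho> = "2 powr - \<alpha>"
  have N: "N \<ge> 1" by (simp add: N_def)
  have \<rho>: "0 \<le> ?\<rho>" "?\<rho> < 1" using \<alpha> by (auto intro: powr_less_one)
  let ?s = "\<lambda>k. 2 powi k :: real"
  let ?A = "\<lambda>k. {m. dist (lattice_point (?s k) m) (corner p) \<le> (2 * N) * ?s k}"
  let ?K = "N * (2 * N) ^ ?n"
  have le: "outer_weight (k, m) p
      * vol (window (k, m))
    \<le> indicator (?A k) m * ennreal (?K * ?\<rho> ^ nat \<bar>k - fst p\<bar>)" for k m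
  proof (cases "fst p \<le> k \<and> cube p \<inter> window (k, m) \<noteq> {}")
    case True
    then obtain z where z: "z \<in> cube p" "z \<in> window (k, m)" by auto
    have s: "side p \<le> ?s k" using True side_le_iff[of p "(k, m)"] by (simp add: side_def)
    have pos: "?s k > 0" by simp
    have "dist (corner (k, m)) (corner p) \<le> N * ?s k + real ?n * side p"
      using cube_dist_corner_le[OF z(1)] z(2) dist_triangle[of "corner (k, m)" "corner p" z]
      by (simp add: supp_ball_def N_def side_def)
    also have "real ?n * side p \<le> N * ?s k"
      using s less_imp_le[OF side_pos[of p]] by (intro mult_mono) (auto simp: N_def)
    finally have m: "m \<in> ?A k" by (simp add: corner_def side_def)
    have "bad_weight (k, m) p = ennreal ((real ?n * side p / ?s k) powr \<alpha> / ?s k ^ ?n)"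
      using True by (simp add: bad_weight_def side_def)
    also have "\<dots> \<le> ennreal (N * ?\<rho> ^ nat \<bar>k - fst p\<bar> / ?s k ^ ?n)"
    proof (intro ennreal_leI divide_right_mono)
      have "(real ?n * side p / ?s k) powr \<alpha> \<le> (N * (side p / ?s k)) powr \<alpha>"
        using \<alpha> pos by (intro powr_mono2) (auto simp: N_def field_simps less_imp_le intro!: mult_right_mono)
      also have "\<dots> = N powr \<alpha> * (side p / ?s k) powr \<alpha>"
        by (rule powr_mult)
      also have "\<dots> \<le> N * (side p / ?s k) powr \<alpha>"
        using powr_mono[of \<alpha> 1 N] \<alpha> N by (intro mult_right_mono) auto
      also have "(side p / ?s k) powr \<alpha> = ?\<rho> ^ nat \<bar>k - fst p\<bar>"
        using powi_ratio_powr[of "fst p" k \<alpha>] True by (simp add: side_def)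
      finally show "(real ?n * side p / ?s k) powr \<alpha> \<le> N * ?\<rho> ^ nat \<bar>k - fst p\<bar>" .
    qed simp
    finally have "bad_weight (k, m) p * vol (window (k, m))
      \<le> ennreal (N * ?\<rho> ^ nat \<bar>k - fst p\<bar> / ?s k ^ ?n) * ennreal ((2 * (N * ?s k)) ^ ?n)"
      using emeasure_cball_le[of "N * ?s k" "corner (k, m)"] N
      by (intro mult_mono) (auto simp: supp_ball_def N_def side_def)
    also have "\<dots> = ennreal (N * ?\<rho> ^ nat \<bar>k - fst p\<bar> / ?s k ^ ?n * (2 * (N * ?s k)) ^ ?n)"
      using N by (intro ennreal_mult[symmetric]) auto
    also have "N * ?\<rho> ^ nat \<bar>k - fst p\<bar> / ?s k ^ ?n * (2 * (N * ?s k)) ^ ?n = ?K * ?\<rho> ^ nat \<bar>k - fst p\<bar>"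
      by (simp add: power_mult_distrib)
    finally show ?thesis using True m by simp
  qed (auto simp: bad_weight_def)
  show ?thesis
    by (rule sum_over_dyadic_le[where j = "fst p", OF le _ _ \<rho>]) (use N in \<open>auto simp: mult_ac\<close>)
qed

text \<open>If a window through \<open>x\<close> with \<open>side q \<le> side p\<close> met
  \<open>cube p\<close>, then \<open>x\<close> would lie within
  \<open>2 * N * side q + N * side p \<le> 3 * N * side p\<close> of the corner, against
  \<open>off\<close>. So only outer weights occur.\<close>

lemma bad_part_pointwise_le:
  fixes u :: "'i \<Rightarrow> real ^ 'n \<Rightarrow> real" and h :: "real ^ 'n \<Rightarrow> ennreal"
  assumes uh: "l2_modulus I u h"
    and off: "\<And>p. p \<in> S \<Longrightarrow> x \<notin> cball (corner p) (3 * (real CARD('n) + 1) * side p)"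
  shows "csum I (\<lambda>i. csum UNIV (\<lambda>q. (csum S (\<lambda>p. bad_weight q p * (2 * mass (\<lambda>y. ennreal \<bar>u i y\<bar>) (cube p))))\<^sup>2 * indicator (window q) x))
    \<le> (csum UNIV (\<lambda>q. indicator (window q) x * csum S (\<lambda>p. outer_weight q p
        * (2 * mass h (cube p)))))\<^sup>2"
proof -
  note I = l2_modulusD(1)[OF uh] and [measurable] = l2_modulusD(2,3)[OF uh]
  let ?N = "real CARD('n) + 1"
  let ?U = "\<lambda>i p. mass (\<lambda>y. ennreal \<bar>u i y\<bar>) (cube p)"
  let ?J = "\<lambda>p. mass h (cube p)"
  let ?w = outer_weight
  let ?e = "\<lambda>q. indicator (window q) x :: ennreal"
  have far: "bad_weight q p = ?w q p" if q: "x \<in> window q" and p: "p \<in> S" for p q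
  proof (rule ccontr)
    assume "bad_weight q p \<noteq> ?w q p"
    then have le: "fst q \<le> fst p" and "cube p \<inter> window q \<noteq> {}"
      by (auto simp: bad_weight_def split: if_splits)
    then obtain z where z: "z \<in> cube p" "z \<in> window q" by auto
    have "side q \<le> side p" using le by (simp add: side_le_iff)
    then have "?N * side q \<le> ?N * side p" by (intro mult_left_mono) auto
    moreover have "dist x z \<le> ?N * side q + ?N * side q"
    proof -
      have "dist x (corner q) \<le> ?N * side q" "dist z (corner q) \<le> ?N * side q"
        using q z(2) by (simp_all add: supp_ball_def dist_commute)
      then show ?thesis using dist_triangle2[of x z "corner q"] by linarith
    qed
    moreover have "dist z (corner p) \<le> ?N * side p"
      using cube_dist_corner_le[OF z(1)] side_pos[of p] unfolding distrib_right mult_1_left by linarith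
    ultimately have "dist x (corner p) \<le> 3 * ?N * side p"
      using dist_triangle[of x "corner p" z] by (simp add: algebra_simps)
    then show False using off[OF p] by (simp add: dist_commute)
  qed
  have "csum I (\<lambda>i. csum UNIV (\<lambda>q. (csum S (\<lambda>p. bad_weight q p * (2 * ?U i p)))\<^sup>2 * ?e q))
    = csum I (\<lambda>i. csum UNIV (\<lambda>q. (?e q * csum S (\<lambda>p. ?w q p * (2 * ?U i p)))\<^sup>2))"
    using far by (intro nn_integral_cong) (auto simp: indicator_def intro!: nn_integral_cong arg_cong[where f = "\<lambda>t. t\<^sup>2"])
  \<comment> \<open>Once the sum over \<open>q\<close> stands inside the square, Minkowski's
    inequality carries the l^2 sum over \<open>i\<close> through the sums over \<open>q\<close> and
    \<open>p\<close> onto the masses of \<open>h\<close>.\<close>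
  also have "\<dots> \<le> csum I (\<lambda>i. (csum UNIV (\<lambda>q. ?e q * csum S (\<lambda>p. ?w q p * (2 * ?U i p))))\<^sup>2)"
    by (intro nn_integral_mono nn_integral_count_space_power2_le)
  also have "\<dots> \<le> (csum UNIV (\<lambda>q. ?e q * csum S (\<lambda>p. ?w q p * (2 * ?J p))))\<^sup>2"
  proof (rule nn_integral_minkowski_l2[OF I])
    fix q
    have "csum I (\<lambda>i. (?e q * csum S (\<lambda>p. ?w q p * (2 * ?U i p)))\<^sup>2)
      = (?e q)\<^sup>2 * csum I (\<lambda>i. (csum S (\<lambda>p. ?w q p * (2 * ?U i p)))\<^sup>2)"
      by (subst nn_integral_cmult[symmetric]) (auto simp: power_mult_distrib)
    also have "csum I (\<lambda>i. (csum S (\<lambda>p. ?w q p * (2 * ?U i p)))\<^sup>2)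
      \<le> (csum S (\<lambda>p. ?w q p * (2 * ?J p)))\<^sup>2"
    proof (rule nn_integral_minkowski_l2[OF I])
      fix p
      have "csum I (\<lambda>i. (?w q p * (2 * ?U i p))\<^sup>2) = (?w q p * 2)\<^sup>2 * csum I (\<lambda>i. (?U i p)\<^sup>2)"
        by (subst nn_integral_cmult[symmetric]) (auto simp: power_mult_distrib mult.assoc)
      also have "\<dots> \<le> (?w q p * 2)\<^sup>2 * (?J p)\<^sup>2"
        by (intro mult_left_mono l2_modulus_set_integral uh) auto
      finally show "csum I (\<lambda>i. (?w q p * (2 * ?U i p))\<^sup>2) \<le> (?w q p * (2 * ?J p))\<^sup>2"
        by (simp add: power_mult_distrib mult.assoc)
    qed auto
    finally show "csum I (\<lambda>i. (?e q * csum S (\<lambda>p. ?w q p * (2 * ?U i p)))\<^sup>2)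
      \<le> (?e q * csum S (\<lambda>p. ?w q p * (2 * ?J p)))\<^sup>2"
      by (simp add: power_mult_distrib mult_left_mono)
  qed auto
  finally show ?thesis .
qed

text \<open>The level set is covered by the dilated cubes \<open>star\<close>, a level set
  \<open>ZA\<close> of the good part, and a level set \<open>ZY\<close> of a majorant of the bad
  part that is linear in the masses of the cubes. Each is measured by a different estimate.\<close>

theorem dsq_weak_type:
  obtains C :: real where "C > 0" and
    "\<And>(I :: 'i set) (u :: 'i \<Rightarrow> real ^ 'n \<Rightarrow> real) h l. l2_modulus I u h \<Longrightarrow> 0 < l \<Longrightarrow>
      ennreal l * vol {x. ennreal (l\<^sup>2) < csum I (\<lambda>i. dsq (u i) x)}
      \<le> ennreal C * (\<integral>\<^sup>+x. h x \<partial>lebesgue)"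
proof (rule nn_integral_dsq_le[where 'n = 'n], goal_cases)
  case (1 C1)
  note C1 = 1(2,3)
  let ?n = "CARD('n)"
  let ?N = "real ?n + 1"
  \<comment> \<open>A ball of radius \<open>3 * ?N * side p\<close> lies in a cube of side
    \<open>6 * ?N * side p\<close>.\<close>
  define Cs where "Cs = (6 * ?N) ^ ?n"
  define Cb where "Cb = ?N * (2 * ?N) ^ ?n * (4 * ?N + 1) ^ ?n * (2 / (1 - 2 powr - \<alpha>))"
  have "2 powr - \<alpha> < 1" using \<alpha> by (auto intro: powr_less_one)
  then have Cb: "Cb > 0" by (auto simp: Cb_def intro!: mult_pos_pos zero_less_power divide_pos_pos)
  have Cs: "Cs > 0" by (auto simp: Cs_def intro!: zero_less_power)
  let ?C = "Cs + 4 * C1 * (1 + 2 ^ ?n) + 4 * Cb"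
  show thesis
  proof (rule that[of ?C])
    show "0 < ?C"
      using Cs C1(1) Cb by (intro add_pos_pos mult_pos_pos) auto
    fix I :: "'i set" and u :: "'i \<Rightarrow> real ^ 'n \<Rightarrow> real" and h l
    assume uh: "l2_modulus I u h" and l: "0 < (l::real)"
    note I = l2_modulusD(1)[OF uh] and u[measurable] = l2_modulusD(2)[OF uh] and h[measurable] = l2_modulusD(3)[OF uh]
    let ?H = "\<integral>\<^sup>+x. h x \<partial>lebesgue"
    let ?Z = "{x. ennreal (l\<^sup>2) < csum I (\<lambda>i. dsq (u i) x)}"
    show "ennreal l * vol ?Z \<le> ennreal ?C * ?H"
    proof (cases "?H < top")
      case False
      moreover have "ennreal ?C \<noteq> 0"
        using \<open>0 < ?C\<close> by (simp add: ennreal_eq_0_iff not_le)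
      ultimately show ?thesis by (simp add: less_top[symmetric] ennreal_mult_top)
    next
      case True
      obtain S where S: "disjoint_family_on cube S"
        "\<And>p. p \<in> S \<Longrightarrow> ennreal l * ennreal (side p ^ ?n) \<le> mass h (cube p)"
        "\<And>p. p \<in> S \<Longrightarrow> (mass h (cube p)) \<le> ennreal (2 ^ ?n * l) * ennreal (side p ^ ?n)"
        "AE x in lebesgue. x \<notin> \<Union>(cube ` S) \<longrightarrow> h x \<le> ennreal l"
        by (rule calderon_zygmund[OF h True l]) blast
      let ?J = "\<lambda>p. mass h (cube p)"
      have sum_J: "csum S ?J \<le> ?H"
        by (subst nn_integral_split_cubes[OF S(1), of h]) auto
      have u_int: "integrable lebesgue (u i)" if "i \<in> I" for i
      proof (rule integrableI_bounded)
        have "ennreal (norm (u i x)) \<le> h x" for x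
        proof -
          have "(ennreal (norm (u i x)))\<^sup>2 \<le> (h x)\<^sup>2"
            using nn_integral_ge_point[of i I "\<lambda>i. ennreal ((u i x)\<^sup>2)"] that l2_modulusD(4)[OF uh, of x] by (simp add: ennreal_power)
          then show ?thesis by (simp only: ennreal_power2_le_iff)
        qed
        then have "(\<integral>\<^sup>+x. ennreal (norm (u i x)) \<partial>lebesgue) \<le> ?H" by (intro nn_integral_mono)
        then show "(\<integral>\<^sup>+x. ennreal (norm (u i x)) \<partial>lebesgue) < \<infinity>" using True by (auto intro: le_less_trans)
      qed (rule u[OF that])
      let ?e = "\<lambda>q x. indicator (window q) x :: ennreal"
      define \<beta> where "\<beta> i q = csum S (\<lambda>p. bad_weight q p * (2 * mass (\<lambda>y. ennreal \<bar>u i y\<bar>) (cube p)))" for i q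
      define A where "A x = csum I (\<lambda>i. dsq (good_part S (u i)) x)" for x
      define B where "B x = csum I (\<lambda>i. csum UNIV (\<lambda>q. (\<beta> i q)\<^sup>2 * ?e q x))" for x
      define W where "W q = csum S (\<lambda>p. outer_weight q p * (2 * ?J p))" for q
      define Y where "Y x = csum UNIV (\<lambda>q. ?e q x * W q)" for x
      define star where "star = (\<Union>p\<in>S. cball (corner p) (3 * ?N * side p))"
      \<comment> \<open>From \<open>2 * A x + 2 * B x > l^2\<close>, one of \<open>A x\<close>,
        \<open>B x\<close> exceeds \<open>l^2 / 4\<close>. Off \<open>star\<close>,
        \<open>B x \<le> (Y x)^2\<close>, so \<open>Y\<close> is tested at the root
        \<open>l / 2\<close>.\<close>
      define ZA where "ZA = {x. ennreal (l\<^sup>2 / 4) < A x}"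
      define ZY where "ZY = {x. ennreal (l / 2) < Y x}"
      have star_sets[measurable]: "star \<in> sets lebesgue"
        unfolding star_def by (intro sets.countable_UN') auto
      have A_meas[measurable]: "A \<in> borel_measurable lebesgue"
        unfolding A_def[abs_def] by (intro borel_measurable_nn_integral_count_space I) measurable
      have Y_meas[measurable]: "Y \<in> borel_measurable lebesgue"
        unfolding Y_def[abs_def] by (intro borel_measurable_nn_integral_count_space) auto
      have ZA_sets: "ZA \<in> sets lebesgue" and ZY_sets: "ZY \<in> sets lebesgue"
        unfolding ZA_def ZY_def by (intro superlevel_sets A_meas Y_meas)+
      have dsq_le: "csum I (\<lambda>i. dsq (u i) x) \<le> 2 * A x + 2 * B x" for x
      proof -
        have "csum I (\<lambda>i. dsq (u i) x)
          \<le> csum I (\<lambda>i. 2 * dsq (good_part S (u i)) x + 2 * csum UNIV (\<lambda>q. (\<beta> i q)\<^sup>2 * ?e q x))"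
        proof (intro nn_integral_mono)
          fix i assume "i \<in> space (count_space I)"
          then have i: "i \<in> I" by simp
          show "dsq (u i) x \<le> 2 * dsq (good_part S (u i)) x + 2 * csum UNIV (\<lambda>q. (\<beta> i q)\<^sup>2 * ?e q x)"
            unfolding dsq_def[of "good_part S (u i)"] \<beta>_def
            by (intro dsq_le_if_dcoef_le coef_le_good_bad u_int[OF i] S(1))
        qed
        also have "\<dots> = 2 * A x + 2 * B x"
          unfolding A_def B_def by (subst nn_integral_add) (auto simp: nn_integral_cmult)
        finally show ?thesis .
      qed
      have sub: "?Z \<subseteq> star \<union> (ZA \<union> ZY)"
      proof
        fix x assume "x \<in> ?Z"
        then have "ennreal (4 * (l\<^sup>2 / 4)) < 2 * A x + 2 * B x"
          using dsq_le[of x] by simp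
        then have AB: "ennreal (l\<^sup>2 / 4) < A x \<or> ennreal (l\<^sup>2 / 4) < B x"
          by (rule ennreal_less_two_sum) simp
        have "B x \<le> (Y x)\<^sup>2" if "x \<notin> star"
          unfolding B_def \<beta>_def Y_def W_def
          by (rule bad_part_pointwise_le[OF uh]) (use that in \<open>auto simp: star_def\<close>)
        moreover have "ennreal (l\<^sup>2 / 4) = (ennreal (l / 2))\<^sup>2"
          using l by (simp add: ennreal_power power_divide)
        ultimately have "ennreal (l / 2) < Y x" if "x \<notin> star" "ennreal (l\<^sup>2 / 4) < B x"
          using that ennreal_power2_less_iff[of "ennreal (l / 2)" "Y x"] by auto
        then show "x \<in> star \<union> (ZA \<union> ZY)"
          using AB by (auto simp: ZA_def ZY_def)
      qed
      \<comment> \<open>The lower bound for the averages over selected cubes turns \<open>l\<close>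
        times volume into mass of \<open>h\<close>.\<close>
      have b1: "ennreal l * vol star \<le> ennreal Cs * ?H"
      proof -
        have "vol star \<le> csum S (\<lambda>p. vol (cball (corner p) (3 * ?N * side p)))"
          unfolding star_def by (intro emeasure_UN_le_count_space) auto
        also have "\<dots> \<le> csum S (\<lambda>p. ennreal Cs * ennreal (side p ^ ?n))"
        proof (intro nn_integral_mono)
          fix p :: "int \<times> (int ^ 'n)"
          have "vol (cball (corner p) (3 * ?N * side p)) \<le> ennreal ((2 * (3 * ?N * side p)) ^ ?n)"
            by (intro emeasure_cball_le) (simp add: less_imp_le)
          also have "2 * (3 * ?N * side p) = (6 * ?N) * side p" by simp
          also have "((6 * ?N) * side p) ^ ?n = Cs * side p ^ ?n"
            unfolding Cs_def by (rule power_mult_distrib)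
          also have "ennreal (Cs * side p ^ ?n) = ennreal Cs * ennreal (side p ^ ?n)"
            using Cs by (intro ennreal_mult) (auto simp: less_imp_le)
          finally show "vol (cball (corner p) (3 * ?N * side p)) \<le> ennreal Cs * ennreal (side p ^ ?n)" .
        qed
        finally have "ennreal l * vol star
            \<le> ennreal l * csum S (\<lambda>p. ennreal Cs * ennreal (side p ^ ?n))"
          by (intro mult_left_mono) auto
        also have "\<dots> = csum S (\<lambda>p. ennreal Cs * (ennreal l * ennreal (side p ^ ?n)))"
          by (subst nn_integral_cmult[symmetric]) (auto simp: mult_ac)
        also have "\<dots> \<le> csum S (\<lambda>p. ennreal Cs * ?J p)"
          by (intro nn_integral_mono mult_left_mono S(2)) auto
        also have "\<dots> = ennreal Cs * csum S ?J"
          by (intro nn_integral_cmult) auto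
        also have "\<dots> \<le> ennreal Cs * ?H" by (intro mult_left_mono sum_J) auto
        finally show ?thesis .
      qed
      \<comment> \<open>Chebyshev's inequality at level \<open>l^2 / 4\<close> meets an L^2 bound
        proportional to \<open>l\<close>; cancelling one \<open>l\<close> leaves the weak type
        form.\<close>
      have b2: "ennreal l * vol ZA \<le> ennreal (4 * C1 * (1 + 2 ^ ?n)) * ?H"
      proof -
        have "ennreal (l\<^sup>2 / 4) * vol ZA \<le> (\<integral>\<^sup>+x. A x \<partial>lebesgue)"
          using emeasure_superlevel_le[OF A_meas, of "l\<^sup>2 / 4"] l by (simp add: ZA_def)
        also have "\<dots> = csum I (\<lambda>i. (\<integral>\<^sup>+x. dsq (good_part S (u i)) x \<partial>lebesgue))"
          unfolding A_def by (intro nn_integral_count_space_nn_integral I) measurable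
        also have "\<dots> \<le> csum I (\<lambda>i. ennreal C1 * (\<integral>\<^sup>+x. ennreal ((good_part S (u i) x)\<^sup>2) \<partial>lebesgue))"
          by (intro nn_integral_mono C1 good_part_measurable S u) simp
        also have "\<dots> = ennreal C1 * csum I (\<lambda>i. (\<integral>\<^sup>+x. ennreal ((good_part S (u i) x)\<^sup>2) \<partial>lebesgue))"
          by (intro nn_integral_cmult) auto
        also have "csum I (\<lambda>i. (\<integral>\<^sup>+x. ennreal ((good_part S (u i) x)\<^sup>2) \<partial>lebesgue))
          = (\<integral>\<^sup>+x. csum I (\<lambda>i. ennreal ((good_part S (u i) x)\<^sup>2)) \<partial>lebesgue)"
          using good_part_measurable[OF S(1) u]
          by (intro nn_integral_count_space_nn_integral[symmetric] I) measurable
        also have "ennreal C1 * \<dots> \<le> ennreal C1 * (ennreal ((1 + 2 ^ ?n) * l) * ?H)"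
          by (intro mult_left_mono good_part_l2_le[OF uh l S(1,3,4)]) auto
        also have "\<dots> = ennreal (C1 * ((1 + 2 ^ ?n) * l)) * ?H"
          using C1(1) l by (subst ennreal_mult) (auto simp: mult.assoc)
        finally show ?thesis
          by (rule ennreal_rescale_le) (use C1(1) l in \<open>auto simp: power2_eq_square\<close>)
      qed
      \<comment> \<open>Chebyshev's inequality for first powers; after exchanging the sums, each
        cube \<open>p\<close> meets its total outer weight, at most \<open>Cb\<close>.\<close>
      have b3: "ennreal l * vol ZY \<le> ennreal (4 * Cb) * ?H"
      proof -
        have "ennreal (l / 2) * vol ZY \<le> (\<integral>\<^sup>+x. Y x \<partial>lebesgue)"
          using emeasure_superlevel_le[OF Y_meas, of "l / 2"] l by (simp add: ZY_def)
        also have "\<dots> = csum UNIV (\<lambda>q. (\<integral>\<^sup>+x. ?e q x * W q \<partial>lebesgue))"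
          unfolding Y_def by (intro nn_integral_count_space_nn_integral) auto
        also have "\<dots> = csum UNIV (\<lambda>q. vol (window q) * W q)"
          by (simp add: nn_integral_multc)
        also have "\<dots> = csum UNIV (\<lambda>q. csum S (\<lambda>p. outer_weight q p
            * vol (window q) * (2 * ?J p)))"
          unfolding W_def by (intro nn_integral_cong, subst nn_integral_cmult[symmetric]) (auto simp: mult_ac)
        also have "\<dots> = csum S (\<lambda>p. csum UNIV (\<lambda>q. outer_weight q p
            * vol (window q) * (2 * ?J p)))"
          by (intro nn_integral_count_space_nn_integral) auto
        also have "\<dots> = csum S (\<lambda>p. csum UNIV (\<lambda>q. outer_weight q p
            * vol (window q)) * (2 * ?J p))"
          by (intro nn_integral_cong nn_integral_multc) auto
        also have "\<dots> \<le> csum S (\<lambda>p. ennreal Cb * (2 * ?J p))"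
          unfolding Cb_def by (intro nn_integral_mono mult_right_mono bad_weight_sum_le) auto
        also have "\<dots> = ennreal (2 * Cb) * csum S ?J"
          using Cb by (subst nn_integral_cmult[symmetric]) (auto simp: ennreal_mult mult_ac)
        also have "\<dots> \<le> ennreal (2 * Cb) * ?H" by (intro mult_left_mono sum_J) auto
        finally show ?thesis
          by (rule ennreal_rescale_le) (use Cb l in auto)
      qed
      have "ennreal l * vol ?Z \<le> ennreal l * (vol star + (vol ZA + vol ZY))"
      proof (intro mult_left_mono)
        have "vol ?Z \<le> vol (star \<union> (ZA \<union> ZY))"
          using sub ZA_sets ZY_sets by (intro emeasure_mono) auto
        also have "\<dots> \<le> vol star + vol (ZA \<union> ZY)"
          using ZA_sets ZY_sets by (intro emeasure_subadditive) auto
        also have "\<dots> \<le> vol star + (vol ZA + vol ZY)"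
          using ZA_sets ZY_sets by (intro add_left_mono emeasure_subadditive) auto
        finally show "vol ?Z \<le> \<dots>" .
      qed simp
      also have "\<dots> = ennreal l * vol star + (ennreal l * vol ZA + ennreal l * vol ZY)"
        by (simp only: distrib_left)
      also have "\<dots> \<le> ennreal Cs * ?H + (ennreal (4 * C1 * (1 + 2 ^ ?n)) * ?H + ennreal (4 * Cb) * ?H)"
        by (intro add_mono b1 b2 b3)
      also have "\<dots> = ennreal ?C * ?H"
      proof -
        have "ennreal ?C = ennreal Cs + (ennreal (4 * C1 * (1 + 2 ^ ?n)) + ennreal (4 * Cb))"
          using Cs C1(1) Cb by (subst ennreal_plus, simp, simp)+ (simp add: add.assoc)
        then show ?thesis by (simp only: distrib_right)
      qed
      finally show ?thesis .
    qed
  qed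
qed

section \<open>Domination of the intrinsic square function\<close>

lemma norm_scaleR_inverse_le_1_iff:
  fixes x :: "'a::real_normed_vector"
  shows "t > 0 \<Longrightarrow> norm (x /\<^sub>R t) \<le> 1 \<longleftrightarrow> norm x \<le> t"
  by (simp add: inverse_eq_divide pos_divide_le_eq)

text \<open>A point of norm 3 is outside the support and within distance 4 of every point of the
  unit ball.\<close>

lemma holder_class_bounded:
  fixes \<phi> :: "real ^ 'n \<Rightarrow> 'b::{real_normed_field, euclidean_space}"
  assumes \<phi>: "\<phi> \<in> holder_class \<alpha>"
  shows "norm (\<phi> x) \<le> 4"
proof (cases "\<phi> x = 0")
  case False
  then have x: "norm x \<le> 1" using \<phi> by (auto simp: holder_class_def)
  obtain x' :: "real ^ 'n" where x': "norm x' = 3" using vector_choose_size[of 3] by auto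
  then have "\<phi> x' = 0" using \<phi> by (force simp: holder_class_def)
  then have "norm (\<phi> x) \<le> norm (x - x') powr \<alpha>"
    using \<phi> unfolding holder_class_def by (metis (mono_tags, lifting) diff_zero mem_Collect_eq)
  also have "\<dots> \<le> 4 powr \<alpha>"
    using \<alpha> x x' norm_triangle_ineq4[of x x'] by (intro powr_mono2) auto
  also have "\<dots> \<le> 4 powr 1" using \<alpha> by (intro powr_mono) auto
  finally show ?thesis by simp
qed simp

lemma holder_class_continuous:
  fixes \<phi> :: "real ^ 'n \<Rightarrow> 'b::{real_normed_field, euclidean_space}"
  assumes \<phi>: "\<phi> \<in> holder_class \<alpha>"
  shows "continuous_on A \<phi>"
  by (rule holder_continuous_on[OF \<alpha>(1), of _ 1]) (use \<phi> in \<open>auto simp: holder_class_def\<close>)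

lemma dilate_continuous_on:
  fixes \<phi> :: "real ^ 'n \<Rightarrow> 'b::{real_normed_field, euclidean_space}"
  assumes \<phi>: "\<phi> \<in> holder_class \<alpha>"
  shows "continuous_on UNIV (\<lambda>z. dilate t \<phi> (w - z))"
proof -
  have "continuous_on UNIV (\<lambda>z. \<phi> ((w - z) /\<^sub>R t))"
    by (intro continuous_on_compose2[OF holder_class_continuous[OF \<phi>, of UNIV]] continuous_intros) auto
  then show ?thesis unfolding dilate_def by (intro continuous_intros)
qed

text \<open>As \<open>t \<ge> side q / 2\<close>, replacing \<open>t\<close> by
  \<open>side q\<close> costs \<open>2 ^ n\<close> in the normalisation and at most 2 in the Hoelder
  quotient; this is the divisor \<open>2 ^ (n + 1)\<close>. The support lies within
  \<open>n * side q + t\<close> of the corner, hence in the window.\<close>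

lemma dilate_translate_bump:
  fixes \<phi> :: "real ^ 'n \<Rightarrow> 'b::{real_normed_field, euclidean_space}"
  assumes \<phi>: "\<phi> \<in> holder_class \<alpha>" and b: "b \<in> Basis"
    and y: "dist y (corner q) \<le> real CARD('n) * side q" and t: "side q / 2 \<le> t" "t \<le> side q"
  shows "(\<lambda>z. (dilate t \<phi> (y - z) \<bullet> b) / 2 ^ (CARD('n) + 1)) \<in> dbumps q"
proof -
  let ?n = "CARD('n)"
  let ?s = "side q"
  have t0: "t > 0" using t(1) side_pos[of q] by linarith
  let ?\<psi> = "\<lambda>z. dilate t \<phi> (y - z)"
  note cont = dilate_continuous_on[OF \<phi>]
  have supp: "z \<in> cball y t" if "?\<psi> z \<noteq> 0" for z
  proof -
    have "\<phi> ((y - z) /\<^sub>R t) \<noteq> 0" using that by (simp add: dilate_def)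
    then have "norm ((y - z) /\<^sub>R t) \<le> 1" using \<phi> by (auto simp: holder_class_def)
    then show ?thesis using t0 by (simp only: norm_scaleR_inverse_le_1_iff mem_cball dist_norm)
  qed
  have int: "integrable lebesgue ?\<psi>"
    using supp by (intro integrable_continuous_bounded_support[OF cont, of y t]) blast
  have "(LINT z|lebesgue. \<phi> z) = \<bar>- 1 / t\<bar> ^ DIM(real ^ 'n) *\<^sub>R (LINT z|lebesgue. \<phi> (y /\<^sub>R t + (- 1 / t) *\<^sub>R z))"
    using t0 by (intro integral_lebesgue_affine borel_measurable_continuous_onI holder_class_continuous[OF \<phi>]) auto
  also have "(\<lambda>z. y /\<^sub>R t + (- 1 / t) *\<^sub>R z) = (\<lambda>z. (y - z) /\<^sub>R t)"
    using t0 by (auto simp: fun_eq_iff scaleR_diff_right inverse_eq_divide)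
  finally have "(LINT z|lebesgue. \<phi> z) = \<bar>- 1 / t\<bar> ^ DIM(real ^ 'n) *\<^sub>R (LINT z|lebesgue. \<phi> ((y - z) /\<^sub>R t))"
    by (simp add: fun_eq_iff)
  then have "(LINT z|lebesgue. \<phi> ((y - z) /\<^sub>R t)) = 0"
    using \<phi> t0 by (auto simp: holder_class_def)
  then have "(LINT z|lebesgue. ?\<psi> z) = 0"
    by (simp add: dilate_def)
  then have zero: "(LINT z|lebesgue. ?\<psi> z \<bullet> b / 2 ^ (?n + 1)) = 0"
    using int by simp
  have holder: "\<bar>?\<psi> z \<bullet> b / 2 ^ (?n + 1) - ?\<psi> z' \<bullet> b / 2 ^ (?n + 1)\<bar> \<le> (norm (z - z') / ?s) powr \<alpha> / ?s ^ ?n" for z z'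
  proof -
    have "\<bar>?\<psi> z \<bullet> b - ?\<psi> z' \<bullet> b\<bar> \<le> norm (?\<psi> z - ?\<psi> z')"
      using Basis_le_norm[OF b, of "?\<psi> z - ?\<psi> z'"] by (simp add: inner_diff_left)
    also have "\<dots> = norm (\<phi> ((y - z) /\<^sub>R t) - \<phi> ((y - z') /\<^sub>R t)) / t ^ ?n"
      using t0 by (simp add: dilate_def scaleR_diff_right[symmetric])
    also have "\<dots> \<le> norm ((y - z) /\<^sub>R t - (y - z') /\<^sub>R t) powr \<alpha> / t ^ ?n"
      using \<phi> t0 by (intro divide_right_mono) (auto simp: holder_class_def)
    also have "(y - z) /\<^sub>R t - (y - z') /\<^sub>R t = (z' - z) /\<^sub>R t"
      by (simp add: scaleR_diff_right[symmetric])
    also have "norm ((z' - z) /\<^sub>R t) = norm (z - z') / t"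
      using t0 by (simp add: norm_minus_commute divide_inverse mult.commute)
    also have "(norm (z - z') / t) powr \<alpha> / t ^ ?n \<le> (2 * (norm (z - z') / ?s)) powr \<alpha> / (?s / 2) ^ ?n"
    proof (intro frac_le powr_mono2 power_mono)
      have "norm (z - z') / t \<le> norm (z - z') / (?s / 2)"
        using t(1) t0 by (intro divide_left_mono) auto
      then show "norm (z - z') / t \<le> 2 * (norm (z - z') / ?s)" by (simp add: mult.commute)
    qed (use \<alpha> t t0 in auto)
    also have "(2 * (norm (z - z') / ?s)) powr \<alpha> / (?s / 2) ^ ?n
        \<le> (2 powr 1 * (norm (z - z') / ?s) powr \<alpha>) / (?s / 2) ^ ?n"
      unfolding powr_mult using \<alpha> by (intro divide_right_mono mult_right_mono powr_mono) (auto simp: less_imp_le)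
    also have "(2 powr 1 * (norm (z - z') / ?s) powr \<alpha>) / (?s / 2) ^ ?n
        = 2 ^ (?n + 1) * ((norm (z - z') / ?s) powr \<alpha> / ?s ^ ?n)"
      by (simp add: power_divide)
    finally have "\<bar>?\<psi> z \<bullet> b - ?\<psi> z' \<bullet> b\<bar> \<le> 2 ^ (?n + 1) * ((norm (z - z') / ?s) powr \<alpha> / ?s ^ ?n)" .
    then show ?thesis by (simp add: diff_divide_distrib[symmetric] field_simps)
  qed
  have "z \<in> supp_ball (corner q) ?s" if "?\<psi> z \<bullet> b / 2 ^ (?n + 1) \<noteq> 0" for z
  proof -
    have "?\<psi> z \<noteq> 0" using that by auto
    then have "dist y z \<le> ?s" using supp[of z] t(2) by simp
    then have "dist (corner q) z \<le> real ?n * ?s + ?s"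
      using y dist_triangle[of "corner q" z y] by (simp add: dist_commute)
    then show ?thesis by (simp add: supp_ball_def distrib_right)
  qed
  then show ?thesis using zero holder unfolding bumps_def by blast
qed

text \<open>Each real component of the test function is a multiple of a bump, so the sum over its
  components repeats the same bound \<open>DIM('b)\<close> times.\<close>

lemma intrinsic_max_le_coef:
  fixes f :: "real ^ 'n \<Rightarrow> 'b::{real_normed_field, euclidean_space}"
  assumes f: "locally_integrable f"
    and y: "dist y (corner q) \<le> real CARD('n) * side q" and t: "side q / 2 \<le> t" "t \<le> side q"
  shows "intrinsic_max \<alpha> f y t
    \<le> ennreal (real DIM('b) * 2 ^ (CARD('n) + 1)) * (\<Sum>b\<in>Basis. dcoef q (\<lambda>z. f z \<bullet> b))"
  unfolding intrinsic_max_def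
proof (rule SUP_least)
  fix \<phi> :: "real ^ 'n \<Rightarrow> 'b" assume \<phi>: "\<phi> \<in> holder_class \<alpha>"
  let ?\<psi> = "\<lambda>z. dilate t \<phi> (y - z)"
  let ?K = "2 ^ (CARD('n) + 1) :: real"
  let ?I = "\<lambda>b b'. LINT z|lebesgue. (?\<psi> z \<bullet> b) * (f z \<bullet> b')"
  let ?J = "\<lambda>b b'. LINT z|lebesgue. (?\<psi> z \<bullet> b / ?K) * (f z \<bullet> b')"
  note bump = dilate_translate_bump[OF \<phi> _ y t]
  have int': "integrable lebesgue (\<lambda>z. (?\<psi> z \<bullet> b / ?K) * (f z \<bullet> b'))" if "b \<in> Basis" for b b'
    by (rule bumps_mult_integrable[OF bump[OF that] side_pos inner_locally_integrable[OF f]])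
  have int: "integrable lebesgue (\<lambda>z. (?\<psi> z \<bullet> b) * (f z \<bullet> b'))" if "b \<in> Basis" for b b'
    using integrable_mult_right[OF int'[OF that, of b'], of ?K] by simp
  have le: "ennreal \<bar>?I b b'\<bar>
    \<le> ennreal ?K * dcoef q (\<lambda>z. f z \<bullet> b')" if b: "b \<in> Basis" for b b'
  proof -
    have "?I b b' = (LINT z|lebesgue. ?K * ((?\<psi> z \<bullet> b / ?K) * (f z \<bullet> b')))"
      by simp
    also have "\<dots> = ?K * ?J b b'"
      by (rule integral_mult_right_zero)
    finally have "ennreal \<bar>?I b b'\<bar>
        = ennreal (?K * \<bar>?J b b'\<bar>)"
      by (simp add: abs_mult)
    also have "\<dots> = ennreal ?K * ennreal \<bar>?J b b'\<bar>"
      by (rule ennreal_mult) auto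
    also have "\<dots> \<le> ennreal ?K * dcoef q (\<lambda>z. f z \<bullet> b')"
      unfolding coef_def by (intro mult_left_mono SUP_upper bump[OF b]) auto
    finally show ?thesis .
  qed
  have "ennreal (norm (conv f (dilate t \<phi>) y))
    \<le> ennreal (\<Sum>b\<in>(Basis::'b set). \<Sum>b'\<in>(Basis::'b set). \<bar>?I b b'\<bar>)"
    unfolding conv_def by (intro ennreal_leI norm_integral_mult_le_components int)
  also have "\<dots> = (\<Sum>b\<in>(Basis::'b set). \<Sum>b'\<in>(Basis::'b set). ennreal \<bar>?I b b'\<bar>)"
    by (simp add: sum_ennreal sum_nonneg)
  also have "\<dots> \<le> (\<Sum>b\<in>(Basis::'b set). \<Sum>b'\<in>(Basis::'b set). ennreal ?K * dcoef q (\<lambda>z. f z \<bullet> b'))"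
    by (intro sum_mono le)
  also have "\<dots> = ennreal (real DIM('b) * ?K) * (\<Sum>b\<in>Basis. dcoef q (\<lambda>z. f z \<bullet> b))"
    by (simp add: sum_distrib_left[symmetric] ennreal_mult ennreal_of_nat_eq_real_of_nat mult.assoc)
  finally show "ennreal (norm (conv f (dilate t \<phi>) y)) \<le> \<dots>" .
qed

lemma intrinsic_square_power2:
  fixes f :: "real ^ 'n \<Rightarrow> 'b::{real_normed_field, euclidean_space}"
  shows "(intrinsic_square \<alpha> f x)\<^sup>2 = (\<integral>\<^sup>+p. (intrinsic_max \<alpha> f (fst p) (snd p))\<^sup>2
    * ennreal (1 / snd p ^ (CARD('n) + 1)) * indicator (upward_cone x) p \<partial>lebesgue)"
  unfolding intrinsic_square_def ennsqrt_power2 by (simp add: case_prod_beta)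

text \<open>The closed boxes may share faces. Only covering and an upper bound for the volume are
  asked of them.\<close>

definition whitney_box :: "int \<times> (int ^ 'n) \<Rightarrow> ((real ^ 'n) \<times> real) set" where
  "whitney_box q = cbox (corner q, side q / 2) (corner q + (\<chi> i. side q), side q)"

lemma whitney_box_sets[measurable, simp]: "whitney_box q \<in> sets lebesgue"
  by (simp add: whitney_box_def)

lemma emeasure_whitney_box_le:
  fixes q :: "int \<times> (int ^ 'n)"
  shows "vol (whitney_box q) \<le> ennreal (side q ^ (CARD('n) + 1))"
proof -
  have ne: "cbox (corner q) (corner q + (\<chi> i. side q)) \<noteq> {}"
    by (simp add: interval_ne_empty_cart less_imp_le)
  have "measure lborel (whitney_box q) = side q ^ CARD('n) * (side q / 2)"
    unfolding whitney_box_def content_Pair using ne by (simp add: content_cbox_if_cart less_imp_le)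
  also have "\<dots> \<le> side q ^ (CARD('n) + 1)" by (simp add: less_imp_le)
  finally have "ennreal (measure lborel (whitney_box q)) \<le> ennreal (side q ^ (CARD('n) + 1))"
    by (rule ennreal_leI)
  moreover have "vol (whitney_box q) = ennreal (measure lborel (whitney_box q))"
    by (simp add: whitney_box_def emeasure_eq_measure2)
  ultimately show ?thesis by simp
qed

text \<open>A point \<open>(y, t)\<close> of the cone lies in the box over the cube of
  \<open>y\<close> with \<open>side / 2 < t \<le> side\<close>, and \<open>x\<close>, being within
  \<open>t\<close> of \<open>y\<close>, lies in the window of that cube. On a box
  \<open>1 / t ^ (n + 1)\<close> is at most \<open>2 ^ (n + 1) / side ^ (n + 1)\<close>, which
  cancels the volume.\<close>

lemma intrinsic_square_le_dsq:
  fixes f :: "real ^ 'n \<Rightarrow> 'b::{real_normed_field, euclidean_space}"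
  assumes f: "locally_integrable f"
  shows "(intrinsic_square \<alpha> f x)\<^sup>2
    \<le> ennreal ((real DIM('b) * (real DIM('b) * 2 ^ (CARD('n) + 1)))\<^sup>2 * 2 ^ (CARD('n) + 1)) * (\<Sum>b\<in>Basis. dsq (\<lambda>z. f z \<bullet> b) x)"
proof -
  let ?n = "CARD('n)"
  let ?K = "ennreal ((real DIM('b) * (real DIM('b) * 2 ^ (?n + 1)))\<^sup>2)"
  let ?c = "\<lambda>q. \<Sum>b\<in>Basis. (dcoef q (\<lambda>z. f z \<bullet> b))\<^sup>2"
  let ?e = "\<lambda>q. indicator (window q) x :: ennreal"
  let ?v = "\<lambda>q. ennreal (2 ^ (?n + 1) / side q ^ (?n + 1))"
  let ?F = "\<lambda>q p. ?K * ?c q * ?v q * ?e q * indicator (whitney_box q) p"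
  have "(intrinsic_square \<alpha> f x)\<^sup>2
    \<le> (\<integral>\<^sup>+p. csum UNIV (\<lambda>q. ?F q p) \<partial>lebesgue)"
    unfolding intrinsic_square_power2
  proof (intro nn_integral_mono)
    fix p :: "(real ^ 'n) \<times> real"
    obtain y t where p: "p = (y, t)" by (cases p)
    show "(intrinsic_max \<alpha> f (fst p) (snd p))\<^sup>2 * ennreal (1 / snd p ^ (?n + 1)) * indicator (upward_cone x) p
      \<le> csum UNIV (\<lambda>q. ?F q p)"
    proof (cases "p \<in> upward_cone x")
      case True
      then have t: "t > 0" "norm (x - y) < t" by (auto simp: upward_cone_def p)
      obtain k :: int where k: "2 powi k / 2 < t" "t \<le> 2 powi k" by (rule ex_dyadic_scale[OF t(1)])
      let ?q = "cube_at k y"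
      have s: "side ?q / 2 \<le> t" "t \<le> side ?q" using k by auto
      have y: "dist y (corner ?q) \<le> real ?n * side ?q" by (rule cube_dist_corner_le[OF mem_cube_at])
      have "(y, t) \<in> whitney_box ?q"
        using s mem_cube_at[of y k] unfolding mem_cube_iff_bounds whitney_box_def cbox_Pair_eq
        by (auto simp: mem_box_cart less_imp_le)
      moreover have "x \<in> window ?q"
        using y t(2) s(2) dist_triangle[of "corner ?q" x y]
        by (simp add: supp_ball_def distrib_right dist_norm norm_minus_commute)
      ultimately have 1: "?K * ?c ?q * ?v ?q \<le> csum UNIV (\<lambda>q. ?F q p)"
        using nn_integral_ge_point[of ?q UNIV "\<lambda>q. ?F q p"]
        by (simp add: p)
      have 2: "(intrinsic_max \<alpha> f y t)\<^sup>2 \<le> ?K * ?c ?q"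
      proof -
        have "(intrinsic_max \<alpha> f y t)\<^sup>2
          \<le> (ennreal (real DIM('b) * 2 ^ (?n + 1)) * (\<Sum>b\<in>Basis. dcoef ?q (\<lambda>z. f z \<bullet> b)))\<^sup>2"
          by (intro power_mono intrinsic_max_le_coef f y s) auto
        also have "\<dots> \<le> (ennreal (real DIM('b) * 2 ^ (?n + 1)))\<^sup>2 * ((of_nat DIM('b))\<^sup>2 * ?c ?q)"
          unfolding power_mult_distrib by (intro mult_left_mono ennreal_sum_power2_le) auto
        also have "\<dots> = ?K * ?c ?q"
          by (simp add: ennreal_of_nat_eq_real_of_nat power_mult_distrib ennreal_mult ennreal_power[symmetric] mult_ac)
        finally show ?thesis .
      qed
      have 3: "ennreal (1 / t ^ (?n + 1)) \<le> ?v ?q"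
      proof (intro ennreal_leI)
        have "1 / t ^ (?n + 1) \<le> 1 / (side ?q / 2) ^ (?n + 1)"
          using s t(1) by (intro divide_left_mono power_mono) auto
        then show "1 / t ^ (?n + 1) \<le> 2 ^ (?n + 1) / side ?q ^ (?n + 1)"
          by (simp add: power_divide)
      qed
      show ?thesis
        using order_trans[OF mult_mono[OF 2 3] 1] True by (simp only: p fst_conv snd_conv indicator_simps mult_1_right) simp
    qed simp
  qed
  also have "\<dots> = csum UNIV (\<lambda>q. (\<integral>\<^sup>+p. ?F q p \<partial>lebesgue))"
    by (intro nn_integral_count_space_nn_integral) auto
  also have "\<dots> = csum UNIV (\<lambda>q. ?K * ?c q * ?v q * ?e q * vol (whitney_box q))"
    by (simp add: nn_integral_cmult_indicator)
  also have "\<dots> \<le> csum UNIV (\<lambda>q. ?K * ennreal (2 ^ (?n + 1)) * (?c q * ?e q))"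
  proof (intro nn_integral_mono)
    fix q :: "int \<times> (int ^ 'n)"
    have "?v q * vol (whitney_box q) \<le> ?v q * ennreal (side q ^ (?n + 1))"
      by (intro mult_left_mono emeasure_whitney_box_le) auto
    also have "\<dots> = ennreal (2 ^ (?n + 1) / side q ^ (?n + 1) * side q ^ (?n + 1))"
      by (intro ennreal_mult[symmetric]) (auto simp: less_imp_le)
    also have "2 ^ (?n + 1) / side q ^ (?n + 1) * side q ^ (?n + 1) = 2 ^ (?n + 1)"
      by simp
    finally have "(?K * ?c q * ?e q) * (?v q * vol (whitney_box q)) \<le> (?K * ?c q * ?e q) * ennreal (2 ^ (?n + 1))"
      by (intro mult_left_mono) auto
    then show "?K * ?c q * ?v q * ?e q * vol (whitney_box q) \<le> ?K * ennreal (2 ^ (?n + 1)) * (?c q * ?e q)"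
      by (simp only: mult_ac)
  qed
  also have "\<dots> = ?K * ennreal (2 ^ (?n + 1)) * csum UNIV (\<lambda>q. ?c q * ?e q)"
    by (intro nn_integral_cmult) auto
  also have "csum UNIV (\<lambda>q. ?c q * ?e q) = (\<Sum>b\<in>Basis. dsq (\<lambda>z. f z \<bullet> b) x)"
    unfolding dsq_def sum_distrib_right by (intro nn_integral_sum) auto
  also have "?K * ennreal (2 ^ (?n + 1)) = ennreal ((real DIM('b) * (real DIM('b) * 2 ^ (?n + 1)))\<^sup>2 * 2 ^ (?n + 1))"
    by (intro ennreal_mult[symmetric]) auto
  finally show ?thesis .
qed

text \<open>Dominated convergence: for parameters near \<open>(y, t)\<close> the kernels are
  supported in \<open>cball y (2 * t + 1)\<close> and bounded by \<open>4 / (t / 2) ^ n\<close>, and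
  \<open>f\<close> is integrable on that ball.\<close>

lemma conv_dilate_continuous:
  fixes f :: "real ^ 'n \<Rightarrow> 'b::{real_normed_field, euclidean_space}"
  assumes f: "locally_integrable f" and \<phi>: "\<phi> \<in> holder_class \<alpha>"
  shows "continuous_on {p. snd p > 0} (\<lambda>p. conv f (dilate (snd p) \<phi>) (fst p))"
proof (rule continuous_on_sequentiallyI)
  fix p :: "nat \<Rightarrow> (real ^ 'n) \<times> real" and a
  assume p: "\<forall>n. p n \<in> {p. snd p > 0}" "a \<in> {p. snd p > 0}" "p \<longlonglongrightarrow> a"
  let ?n = "CARD('n)"
  obtain y t where a: "a = (y, t)" by (cases a)
  have t: "t > 0" using p a by simp
  have lims: "(\<lambda>n. fst (p n)) \<longlonglongrightarrow> y" "(\<lambda>n. snd (p n)) \<longlonglongrightarrow> t"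
    using tendsto_fst[OF p(3)] tendsto_snd[OF p(3)] by (auto simp: a)
  have "\<forall>\<^sub>F n in sequentially. dist (fst (p n)) y < 1 \<and> dist (snd (p n)) t < t / 2"
    using t by (intro eventually_conj tendstoD[OF lims(1)] tendstoD[OF lims(2)]) auto
  then obtain k where k: "\<And>n. n \<ge> k \<Longrightarrow> dist (fst (p n)) y < 1 \<and> dist (snd (p n)) t < t / 2"
    unfolding eventually_sequentially by blast
  \<comment> \<open>Dropping the first \<open>k\<close> terms makes the closeness to
    \<open>(y, t)\<close>, and with it the dominating function, valid for every index.\<close>
  define Y where "Y n = fst (p (n + k))" for n
  define T where "T n = snd (p (n + k))" for n
  have Y: "Y \<longlonglongrightarrow> y" and T: "T \<longlonglongrightarrow> t"
    unfolding Y_def[abs_def] T_def[abs_def] using lims by (auto intro: LIMSEQ_ignore_initial_segment)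
  have near: "dist (Y n) y < 1" "t / 2 < T n" "T n < 2 * t" for n
    using k[of "n + k"] t by (auto simp: Y_def T_def dist_real_def abs_if split: if_splits)
  have meas: "(\<lambda>z. dilate \<tau> \<phi> (w - z) * f z) \<in> borel_measurable lebesgue" for \<tau> w
  proof -
    have "(\<lambda>z. dilate \<tau> \<phi> (w - z)) \<in> borel_measurable lebesgue"
      by (intro measurable_completion) (simp add: borel_measurable_continuous_onI dilate_continuous_on[OF \<phi>])
    then show ?thesis
      using locally_integrable_measurable[OF f] by (intro borel_measurable_times)
  qed
  have "(\<lambda>n. conv f (dilate (T n) \<phi>) (Y n)) \<longlonglongrightarrow> conv f (dilate t \<phi>) y"
    unfolding conv_def
  proof (rule integral_dominated_convergence)
    let ?w = "\<lambda>z. (4 / (t / 2) ^ ?n) * norm (indicator (cball y (2 * t + 1)) z *\<^sub>R f z)"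
    show "integrable lebesgue ?w"
      using set_integrable_cball[OF f] unfolding set_integrable_def
      by (intro integrable_mult_right integrable_norm)
    show "AE z in lebesgue. (\<lambda>n. dilate (T n) \<phi> (Y n - z) * f z) \<longlonglongrightarrow> dilate t \<phi> (y - z) * f z"
    proof (intro AE_I2 tendsto_mult tendsto_const)
      fix z
      have c: "isCont \<phi> x" for x
        using holder_class_continuous[OF \<phi>, of UNIV] by (simp add: continuous_on_eq_continuous_at)
      have "(\<lambda>n. (Y n - z) /\<^sub>R T n) \<longlonglongrightarrow> (y - z) /\<^sub>R t"
        using t by (intro tendsto_intros Y T) auto
      then have "(\<lambda>n. \<phi> ((Y n - z) /\<^sub>R T n)) \<longlonglongrightarrow> \<phi> ((y - z) /\<^sub>R t)"
        by (rule isCont_tendsto_compose[OF c])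
      then show "(\<lambda>n. dilate (T n) \<phi> (Y n - z)) \<longlonglongrightarrow> dilate t \<phi> (y - z)"
        unfolding dilate_def using t by (intro tendsto_intros T) auto
    qed
    show "AE z in lebesgue. norm (dilate (T n) \<phi> (Y n - z) * f z) \<le> ?w z" for n
    proof (intro AE_I2)
      fix z
      have T0: "T n > 0" using near(2)[of n] t by linarith
      show "norm (dilate (T n) \<phi> (Y n - z) * f z) \<le> ?w z"
      proof (cases "\<phi> ((Y n - z) /\<^sub>R T n) = 0")
        case False
        then have "norm ((Y n - z) /\<^sub>R T n) \<le> 1" using \<phi> by (auto simp: holder_class_def)
        then have "dist (Y n) z \<le> T n" using T0 by (simp only: norm_scaleR_inverse_le_1_iff dist_norm)
        then have "dist y z \<le> 2 * t + 1"
          using near[of n] dist_triangle[of y z "Y n"] by (simp add: dist_commute)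
        moreover have "norm (\<phi> ((Y n - z) /\<^sub>R T n)) / T n ^ ?n \<le> 4 / (t / 2) ^ ?n"
          using holder_class_bounded[OF \<phi>] near(2)[of n] t by (intro frac_le power_mono) auto
        then have "norm (\<phi> ((Y n - z) /\<^sub>R T n)) / T n ^ ?n * norm (f z) \<le> 4 / (t / 2) ^ ?n * norm (f z)"
          by (rule mult_right_mono) simp
        ultimately show ?thesis
          using T0 by (simp add: dilate_def norm_mult)
      next
        case True
        then show ?thesis using t by (simp add: dilate_def)
      qed
    qed
  qed (rule meas)+
  then have "(\<lambda>n. conv f (dilate (snd (p (n + k))) \<phi>) (fst (p (n + k)))) \<longlonglongrightarrow> conv f (dilate t \<phi>) y"
    by (simp add: T_def Y_def)
  then show "(\<lambda>n. conv f (dilate (snd (p n)) \<phi>) (fst (p n))) \<longlonglongrightarrow> conv f (dilate (snd a) \<phi>) (fst a)"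
    by (simp add: a) (rule LIMSEQ_offset)
qed

text \<open>
  The supremum over the uncountable Hoelder class is measurable because it is lower semicontinuous,
  as a supremum of continuous functions of \<open>(y, t)\<close>.
\<close>

lemma intrinsic_square_measurable:
  fixes f :: "real ^ 'n \<Rightarrow> 'b::{real_normed_field, euclidean_space}"
  assumes f: "locally_integrable f"
  shows "intrinsic_square \<alpha> f \<in> borel_measurable borel"
proof -
  let ?U = "{p :: (real ^ 'n) \<times> real. snd p > 0}"
  have U: "open ?U" by (intro open_Collect_less continuous_intros)
  define A where "A p = (if p \<in> ?U then intrinsic_max \<alpha> f (fst p) (snd p) else 0)" for p
  have A_meas[measurable]: "A \<in> borel_measurable borel"
  proof (rule borel_measurableI_greater)
    fix v
    let ?F = "\<lambda>\<phi> p. ennreal (norm (conv f (dilate (snd p) \<phi>) (fst p)))"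
    have "{p \<in> space borel. v < A p} = (\<Union>\<phi>\<in>holder_class \<alpha>. ?F \<phi> -` {v<..} \<inter> ?U)"
      by (auto simp: A_def intrinsic_max_def less_SUP_iff split: if_splits)
    moreover have "open (?F \<phi> -` {v<..} \<inter> ?U)" if "\<phi> \<in> holder_class \<alpha>" for \<phi>
    proof -
      have "continuous_on ?U (?F \<phi>)"
        by (intro continuous_on_ennreal continuous_on_norm conv_dilate_continuous[OF f that])
      then show ?thesis using continuous_on_open_vimage[OF U, of "?F \<phi>"] by simp
    qed
    then have "open (\<Union>\<phi>\<in>holder_class \<alpha>. ?F \<phi> -` {v<..} \<inter> ?U)"
      by (intro open_UN ballI)
    ultimately show "{p \<in> space borel. v < A p} \<in> sets borel"
      by (simp only: borel_open)
  qed
  \<comment> \<open>Membership in the cone is read as an open condition on the pair of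
    \<open>x\<close> and \<open>(y, t)\<close>; joint measurability then makes the integral over the
    cone measurable in \<open>x\<close>.\<close>
  define \<Gamma> where "\<Gamma> = {w :: (real ^ 'n) \<times> (real ^ 'n) \<times> real. 0 < snd (snd w) \<and> norm (fst w - fst (snd w)) < snd (snd w)}"
  have "open \<Gamma>" unfolding \<Gamma>_def
    by (intro open_Collect_conj open_Collect_less continuous_intros)
  moreover have "sets (borel \<Otimes>\<^sub>M lborel) = sets (borel :: ((real ^ 'n) \<times> (real ^ 'n) \<times> real) measure)"
    by (subst borel_prod[symmetric]) (intro sets_pair_measure_cong refl sets_lborel)
  ultimately have \<Gamma>[measurable]: "\<Gamma> \<in> sets (borel \<Otimes>\<^sub>M lborel)"
    by (simp only: borel_open)
  have eq: "(intrinsic_square \<alpha> f x)\<^sup>2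
    = (\<integral>\<^sup>+p. (A p)\<^sup>2 * ennreal (1 / snd p ^ (CARD('n) + 1)) * indicator \<Gamma> (x, p) \<partial>lborel)" for x
    unfolding intrinsic_square_power2 nn_integral_completion
    by (intro nn_integral_cong) (auto simp: indicator_def upward_cone_def \<Gamma>_def A_def)
  define B where "B p = (A p)\<^sup>2 * ennreal (1 / snd p ^ (CARD('n) + 1))" for p
  have [measurable]: "(snd :: (real ^ 'n) \<times> real \<Rightarrow> real) \<in> borel_measurable borel"
    by (intro borel_measurable_continuous_onI continuous_intros)
  have "B \<in> borel_measurable borel" unfolding B_def[abs_def] by measurable
  then have "(\<lambda>w. B (snd w) * indicator \<Gamma> w) \<in> borel_measurable (borel \<Otimes>\<^sub>M lborel)"
    by (intro borel_measurable_times_ennreal measurable_compose[OF measurable_snd] borel_measurable_indicator \<Gamma>) simp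
  then have "(\<lambda>(x, p). B p * indicator \<Gamma> (x, p)) \<in> borel_measurable (borel \<Otimes>\<^sub>M lborel)"
    by (simp add: case_prod_beta')
  then have m: "(\<lambda>x. (intrinsic_square \<alpha> f x)\<^sup>2) \<in> borel_measurable borel"
    unfolding eq B_def[symmetric] by (rule lborel.borel_measurable_nn_integral)
  have "intrinsic_square \<alpha> f = (\<lambda>x. ennsqrt ((intrinsic_square \<alpha> f x)\<^sup>2))"
    unfolding intrinsic_square_power2 by (simp add: fun_eq_iff intrinsic_square_def case_prod_beta)
  also have "\<dots> \<in> borel_measurable borel" using m by measurable
  finally show ?thesis .
qed

section \<open>Morrey spaces\<close>

lemma doubling_iterate:
  fixes \<Phi> :: "real \<Rightarrow> real"
  assumes dbl: "\<And>r. r > 0 \<Longrightarrow> \<Phi> (2 * r) \<le> D * \<Phi> r" and "0 \<le> D" "a > 0"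
  shows "\<Phi> (2 ^ j * a) \<le> D ^ j * \<Phi> a"
proof (induction j)
  case (Suc j)
  have "\<Phi> (2 ^ Suc j * a) = \<Phi> (2 * (2 ^ j * a))" by (simp add: mult.assoc)
  also have "\<dots> \<le> D * \<Phi> (2 ^ j * a)" using \<open>a > 0\<close> by (intro dbl) simp
  also have "\<dots> \<le> D * (D ^ j * \<Phi> a)" using Suc \<open>0 \<le> D\<close> by (intro mult_left_mono) auto
  finally show ?case by simp
qed simp

text \<open>\<open>k0\<close> is the dyadic scale of \<open>r / (2 * N)\<close>, the smallest that
  can occur. There \<open>4 * N * 2 powi k0 < 4 * r\<close>, so two doublings reach \<open>r\<close>
  and give \<open>D^2\<close>; each further scale costs \<open>D\<close> in the numerator and gains
  \<open>2 ^ n\<close> in the denominator.\<close>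

lemma doubling_dyadic_le:
  fixes \<Phi> :: "real \<Rightarrow> real" and n :: nat
  assumes pos: "\<And>r. r > 0 \<Longrightarrow> \<Phi> r > 0" and mono: "mono_on {0<..} \<Phi>"
    and dbl: "\<And>r. r > 0 \<Longrightarrow> \<Phi> (2 * r) \<le> D * \<Phi> r" and D: "1 \<le> D"
    and N: "N > 0" and r: "r > 0"
    and k0: "2 powi k0 / 2 < r / (2 * N)" "r / (2 * N) \<le> 2 powi k0" and k: "r / (2 * N) \<le> 2 powi k"
  shows "\<Phi> (4 * N * 2 powi k) / (2 powi k) ^ n
    \<le> D\<^sup>2 * (2 * N) ^ n * \<Phi> r / r ^ n * (D / 2 ^ n) ^ nat \<bar>k - k0\<bar>"
proof -
  have "k0 \<le> k"
  proof (rule ccontr)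
    assume "\<not> k0 \<le> k"
    then have "(2::real) powi k \<le> 2 powi (k0 - 1)" by (intro power_int_increasing) auto
    also have "\<dots> = 2 powi k0 / 2" by (simp add: power_int_diff)
    finally show False using k0(1) k by simp
  qed
  define j where "j = nat (k - k0)"
  have k_eq: "(2::real) powi k = 2 ^ j * 2 powi k0"
  proof -
    have "(2::real) powi k = 2 powi (int j + k0)" using \<open>k0 \<le> k\<close> by (simp add: j_def)
    then show ?thesis by (subst (asm) power_int_add) auto
  qed
  let ?a = "4 * N * 2 powi k0"
  have a: "?a > 0" "?a \<le> 2 * (2 * r)" using N k0(1) by (auto simp: field_simps)
  have "\<Phi> (4 * N * 2 powi k) = \<Phi> (2 ^ j * ?a)" by (simp add: k_eq mult_ac)
  also have "\<dots> \<le> D ^ j * \<Phi> ?a" using D a by (intro doubling_iterate dbl) auto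
  also have "\<dots> \<le> D ^ j * (D\<^sup>2 * \<Phi> r)"
  proof (intro mult_left_mono)
    have "\<Phi> ?a \<le> \<Phi> (2 * (2 * r))" using a r by (intro mono_onD[OF mono]) auto
    also have "\<dots> \<le> D * \<Phi> (2 * r)" using r by (intro dbl) auto
    also have "\<dots> \<le> D * (D * \<Phi> r)" using r D by (intro mult_left_mono dbl) auto
    finally show "\<Phi> ?a \<le> D\<^sup>2 * \<Phi> r" by (simp add: power2_eq_square)
  qed (use D in simp)
  finally have 1: "\<Phi> (4 * N * 2 powi k) \<le> D ^ j * (D\<^sup>2 * \<Phi> r)" .
  have "(r / (2 * N)) ^ n \<le> (2 powi k0) ^ n" using k0(2) r N by (intro power_mono) auto
  then have 2: "2 ^ (j * n) * (r / (2 * N)) ^ n \<le> (2 powi k) ^ n"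
    by (simp add: k_eq power_mult_distrib power_mult[symmetric])
  have "\<Phi> (4 * N * 2 powi k) / (2 powi k) ^ n \<le> D ^ j * (D\<^sup>2 * \<Phi> r) / (2 ^ (j * n) * (r / (2 * N)) ^ n)"
    using 1 2 r N D pos[OF r] by (intro frac_le) (auto intro!: mult_nonneg_nonneg simp: less_imp_le)
  also have "\<dots> = D\<^sup>2 * (2 * N) ^ n * \<Phi> r / r ^ n * (D / 2 ^ n) ^ j"
    using N by (simp add: power_divide power_mult[symmetric] power_mult_distrib mult_ac)
  also have "j = nat \<bar>k - k0\<bar>" using \<open>k0 \<le> k\<close> by (simp add: j_def)
  finally show ?thesis .
qed

text \<open>A window through \<open>x\<close> lies within \<open>2 * N * side q\<close> of
  \<open>x\<close>, so it misses the support of \<open>u i\<close> unless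
  \<open>side q \<ge> r / (2 * N)\<close>. On the remaining windows the size bound and Minkowski's
  inequality reduce the claim to masses of \<open>h\<close> over balls around
  \<open>x\<close>.\<close>

lemma dsq_far_le:
  fixes D :: real and \<Phi> :: "real \<Rightarrow> real"
  assumes pos: "\<And>r. r > 0 \<Longrightarrow> \<Phi> r > 0" and mono: "mono_on {0<..} \<Phi>"
    and dbl: "\<And>r. r > 0 \<Longrightarrow> \<Phi> (2 * r) \<le> D * \<Phi> r" and D: "1 \<le> D" "D < 2 ^ CARD('n)"
  obtains K :: real where "K > 0" and
    "\<And>(I :: 'i set) (u :: 'i \<Rightarrow> real ^ 'n \<Rightarrow> real) h x r M. l2_modulus I u h \<Longrightarrow> 0 < M \<Longrightarrow>
      (\<And>s. s > 0 \<Longrightarrow> (mass h (ball x s)) \<le> ennreal (M * \<Phi> s)) \<Longrightarrow> 0 < r \<Longrightarrow>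
      (\<And>i z. i \<in> I \<Longrightarrow> z \<in> ball x r \<Longrightarrow> u i z = 0) \<Longrightarrow>
      (csum I (\<lambda>i. dsq (u i) x)) \<le> (ennreal (K * (M * \<Phi> r) / r ^ CARD('n)))\<^sup>2"
proof -
  let ?n = "CARD('n)"
  define N where "N = real ?n + 1"
  have N: "N \<ge> 1" by (simp add: N_def)
  let ?\<rho> = "D / 2 ^ ?n"
  have \<rho>: "0 \<le> ?\<rho>" "?\<rho> < 1" using D by auto
  define K where "K = (2 * N + 1) ^ ?n * (3 * N) * (D\<^sup>2 * (2 * N) ^ ?n) * (2 / (1 - ?\<rho>))"
  show thesis
  proof (rule that[of K])
    show "K > 0" unfolding K_def using N D \<rho>
      by (intro mult_pos_pos zero_less_power divide_pos_pos) auto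
    fix I :: "'i set" and u :: "'i \<Rightarrow> real ^ 'n \<Rightarrow> real" and h x r and M :: real
    assume uh: "l2_modulus I u h" and M: "0 < M"
      and morrey: "\<And>s. s > 0 \<Longrightarrow> (mass h (ball x s)) \<le> ennreal (M * \<Phi> s)"
      and r: "0 < r" and zero: "\<And>i z. i \<in> I \<Longrightarrow> z \<in> ball x r \<Longrightarrow> u i z = 0"
    note I = l2_modulusD(1)[OF uh] and u[measurable] = l2_modulusD(2)[OF uh] and h[measurable] = l2_modulusD(3)[OF uh]
    let ?e = "\<lambda>q. indicator (window q) x :: ennreal"
    \<comment> \<open>The radius \<open>2 * N * side q\<close> would suffice for a closed ball;
      doubling it gives an open one, as in the Morrey condition.\<close>
    let ?B = "\<lambda>q :: int \<times> (int ^ 'n). ball x (4 * N * side q)"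
    define w where "w q = (if r / (2 * N) \<le> side q then ennreal (3 * N / side q ^ ?n) else 0)"
      for q :: "int \<times> (int ^ 'n)"
    let ?W = "\<lambda>i q. ?e q * w q * mass (\<lambda>z. ennreal \<bar>u i z\<bar>) (?B q)"
    let ?V = "\<lambda>q. ?e q * w q * mass h (?B q)"
    have coef_W: "(dcoef q (u i))\<^sup>2 * ?e q \<le> (?W i q)\<^sup>2" if i: "i \<in> I" for i q
    proof (cases "x \<in> window q")
      case True
      have sub: "dist x z \<le> 2 * N * side q" if "z \<in> window q" for z
        using True that dist_triangle[of x z "corner q"] by (simp add: supp_ball_def N_def dist_commute algebra_simps)
      have Ns: "N * side q > 0" using N by (intro mult_pos_pos) auto
      have "dcoef q (u i)
        \<le> ennreal (3 * N / side q ^ ?n) * mass (\<lambda>z. ennreal \<bar>u i z\<bar>) (window q)"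
        unfolding N_def by (intro coef_le_nn_integral side_pos u i)
      also have "\<dots> \<le> w q * mass (\<lambda>z. ennreal \<bar>u i z\<bar>) (?B q)"
      proof (cases "r / (2 * N) \<le> side q")
        case True
        have "window q \<subseteq> ?B q" using sub Ns by fastforce
        then show ?thesis using True unfolding w_def
          by (auto intro!: mult_left_mono nn_integral_mono simp: indicator_def)
      next
        case False
        then have "2 * N * side q < r" using N by (simp add: field_simps)
        then have "\<And>z. z \<in> window q \<Longrightarrow> u i z = 0"
          using sub zero[OF i] by (meson le_less_trans mem_ball)
        then have "ennreal \<bar>u i z\<bar> * indicator (window q) z = 0" for z
          by (auto simp: indicator_def)
        then show ?thesis by (simp only: nn_integral_const) simp
      qed
      finally show ?thesis using True by (simp add: power_mono)
    qed simp
    have W_V: "csum I (\<lambda>i. (?W i q)\<^sup>2) \<le> (?V q)\<^sup>2" for q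
    proof -
      have "csum I (\<lambda>i. (?W i q)\<^sup>2)
        = (?e q * w q)\<^sup>2 * csum I (\<lambda>i. (mass (\<lambda>z. ennreal \<bar>u i z\<bar>) (?B q))\<^sup>2)"
        by (subst nn_integral_cmult[symmetric]) (auto simp: power_mult_distrib)
      also have "\<dots> \<le> (?e q * w q)\<^sup>2 * (mass h (?B q))\<^sup>2"
        by (intro mult_left_mono l2_modulus_set_integral uh) auto
      finally show ?thesis by (simp add: power_mult_distrib)
    qed
    have "csum I (\<lambda>i. dsq (u i) x) \<le> csum I (\<lambda>i. csum UNIV (\<lambda>q. (?W i q)\<^sup>2))"
      unfolding dsq_def by (intro nn_integral_mono coef_W) simp
    also have "\<dots> \<le> csum I (\<lambda>i. (csum UNIV (\<lambda>q. ?W i q))\<^sup>2)"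
      by (intro nn_integral_mono nn_integral_count_space_power2_le)
    also have "\<dots> \<le> (csum UNIV (\<lambda>q. ?V q))\<^sup>2"
      by (intro nn_integral_minkowski_l2[OF I] W_V) auto
    also have "\<dots> \<le> (ennreal (K * (M * \<Phi> r) / r ^ ?n))\<^sup>2"
    proof (intro power_mono)
      obtain k0 :: int where k0: "2 powi k0 / 2 < r / (2 * N)" "r / (2 * N) \<le> 2 powi k0"
        using ex_dyadic_scale[of "r / (2 * N)"] r N by (metis divide_pos_pos less_le_trans mult_pos_pos zero_less_numeral zero_less_one)
      let ?s = "\<lambda>k. 2 powi k :: real"
      let ?A = "\<lambda>k. {m. dist (lattice_point (?s k) m) x \<le> N * ?s k}"
      define c where "c = 3 * N * M * (D\<^sup>2 * (2 * N) ^ ?n * \<Phi> r / r ^ ?n)"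
      have c: "0 \<le> c" unfolding c_def using N M D pos[OF r] r by (intro mult_nonneg_nonneg divide_nonneg_nonneg) auto
      have V_le: "?V (k, m) \<le> indicator (?A k) m * ennreal (c * ?\<rho> ^ nat \<bar>k - k0\<bar>)" for k m
      proof (cases "x \<in> window (k, m) \<and> r / (2 * N) \<le> ?s k")
        case True
        then have m: "m \<in> ?A k" by (simp add: supp_ball_def N_def corner_def side_def)
        have "?V (k, m) = ennreal (3 * N / ?s k ^ ?n) * mass h (ball x (4 * N * ?s k))"
          using True by (simp add: w_def side_def)
        also have "\<dots> \<le> ennreal (3 * N / ?s k ^ ?n) * ennreal (M * \<Phi> (4 * N * ?s k))"
          using N by (intro mult_left_mono morrey mult_pos_pos) auto
        also have "\<dots> = ennreal (3 * N * M * (\<Phi> (4 * N * ?s k) / ?s k ^ ?n))"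
          using N M pos[of "4 * N * ?s k"] by (subst ennreal_mult[symmetric]) (auto simp: less_imp_le mult_ac)
        also have "\<dots> \<le> ennreal (3 * N * M * (D\<^sup>2 * (2 * N) ^ ?n * \<Phi> r / r ^ ?n * ?\<rho> ^ nat \<bar>k - k0\<bar>))"
          using N M r True D(1) by (intro ennreal_leI mult_left_mono doubling_dyadic_le pos mono dbl k0) auto
        also have "\<dots> = ennreal (c * ?\<rho> ^ nat \<bar>k - k0\<bar>)"
          by (simp add: c_def mult.assoc)
        finally show ?thesis using m by simp
      qed (auto simp: w_def side_def)
      have "csum UNIV (\<lambda>q. ?V q) \<le> ennreal ((2 * N + 1) ^ ?n * c * (2 / (1 - ?\<rho>)))"
        by (rule sum_over_dyadic_le[where j = k0, OF V_le _ _ \<rho>]) (use N c \<rho> in \<open>auto simp: mult_ac\<close>)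
      also have "(2 * N + 1) ^ ?n * c * (2 / (1 - ?\<rho>)) = K * (M * \<Phi> r) / r ^ ?n"
        by (simp add: K_def c_def mult_ac)
      finally show "csum UNIV (\<lambda>q. ?V q) \<le> ennreal (K * (M * \<Phi> r) / r ^ ?n)" .
    qed simp
    finally show "csum I (\<lambda>i. dsq (u i) x) \<le> (ennreal (K * (M * \<Phi> r) / r ^ ?n))\<^sup>2" .
  qed
qed

lemma sum_intrinsic_square_le_dsq:
  fixes f :: "nat \<Rightarrow> real ^ 'n \<Rightarrow> 'b::{real_normed_field, euclidean_space}"
  assumes f: "\<And>j. locally_integrable (f j)"
  shows "(\<Sum>j. (intrinsic_square \<alpha> (f j) x)\<^sup>2)
    \<le> ennreal ((real DIM('b) * (real DIM('b) * 2 ^ (CARD('n) + 1)))\<^sup>2 * 2 ^ (CARD('n) + 1))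
      * csum (UNIV \<times> Basis) (\<lambda>(j, b). dsq (\<lambda>z. f j z \<bullet> b) x)"
proof -
  have "(\<Sum>j. (intrinsic_square \<alpha> (f j) x)\<^sup>2)
    \<le> (\<Sum>j. ennreal ((real DIM('b) * (real DIM('b) * 2 ^ (CARD('n) + 1)))\<^sup>2 * 2 ^ (CARD('n) + 1))
        * (\<Sum>b\<in>Basis. dsq (\<lambda>z. f j z \<bullet> b) x))"
    by (intro suminf_le intrinsic_square_le_dsq f) auto
  also have "\<dots> = ennreal ((real DIM('b) * (real DIM('b) * 2 ^ (CARD('n) + 1)))\<^sup>2 * 2 ^ (CARD('n) + 1))
      * (\<Sum>j. \<Sum>b\<in>Basis. dsq (\<lambda>z. f j z \<bullet> b) x)"
    by (rule ennreal_suminf_cmult)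
  finally show ?thesis
    by (simp add: nn_integral_count_space_times)
qed

text \<open>Cutting at radius \<open>2 * r\<close> ensures that for each \<open>x\<close> in
  \<open>ball x0 r\<close> the far part vanishes on \<open>ball x r\<close>, so that its square
  function has one bound on the whole ball.\<close>

lemma weak_distribution_estimate:
  fixes D :: real and \<Phi> :: "real \<Rightarrow> real"
  assumes pos: "\<And>r. r > 0 \<Longrightarrow> \<Phi> r > 0" and mono: "mono_on {0<..} \<Phi>"
    and dbl: "\<And>r. r > 0 \<Longrightarrow> \<Phi> (2 * r) \<le> D * \<Phi> r" and D: "1 \<le> D" "D < 2 ^ CARD('n)"
  obtains C :: real where "C > 0" and
    "\<And>(f :: nat \<Rightarrow> real ^ 'n \<Rightarrow> 'b::{real_normed_field, euclidean_space}) h M x0 r l.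
      (\<And>j. locally_integrable (f j)) \<Longrightarrow> h \<in> borel_measurable lebesgue \<Longrightarrow>
      (\<And>x. (\<Sum>j. (ennreal (norm (f j x)))\<^sup>2) = (h x)\<^sup>2) \<Longrightarrow> 0 < M \<Longrightarrow>
      (\<And>x s. s > 0 \<Longrightarrow> (mass h (ball x s)) \<le> ennreal (M * \<Phi> s)) \<Longrightarrow>
      0 < r \<Longrightarrow> 0 < l \<Longrightarrow>
      ennreal l * vol {x \<in> ball x0 r. ennreal (l\<^sup>2) < (\<Sum>j. (intrinsic_square \<alpha> (f j) x)\<^sup>2)}
      \<le> ennreal (C * (M * \<Phi> r))"
proof (rule dsq_weak_type[where 'i = "nat \<times> 'b" and 'n = 'n],
    rule dsq_far_le[where 'i = "nat \<times> 'b" and 'n = 'n, OF pos mono dbl D], goal_cases)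
  \<comment> \<open>Goals 1 and 2 stem from the premises of \<open>pos\<close> and \<open>dbl\<close> and are closed by the final qed.\<close>
  case (3 C K)
  note C = 3(2,3) and K = 3(4,5)
  let ?n = "CARD('n)"
  define \<kappa> where "\<kappa> = (real DIM('b) * (real DIM('b) * 2 ^ (?n + 1)))\<^sup>2 * 2 ^ (?n + 1)"
  have \<kappa>: "\<kappa> > 0" by (simp add: \<kappa>_def)
  define C' where "C' = 2 * sqrt \<kappa> * (C * D + 2 ^ ?n * K)"
  show thesis
  proof (rule that[of C'])
    show "C' > 0"
      unfolding C'_def using \<kappa> C(1) K(1) D by (intro mult_pos_pos add_pos_pos) auto
    fix f :: "nat \<Rightarrow> real ^ 'n \<Rightarrow> 'b" and h M r l and x0 :: "real ^ 'n"
    assume f: "\<And>j. locally_integrable (f j)" and h[measurable]: "h \<in> borel_measurable lebesgue"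
      and fh: "\<And>x. (\<Sum>j. (ennreal (norm (f j x)))\<^sup>2) = (h x)\<^sup>2" and M: "0 < (M::real)"
      and morrey: "\<And>x s. s > 0 \<Longrightarrow> (mass h (ball x s)) \<le> ennreal (M * \<Phi> s)"
      and r: "0 < (r::real)" and l: "0 < (l::real)"
    let ?V = "\<lambda>x. \<Sum>j. (intrinsic_square \<alpha> (f j) x)\<^sup>2"
    let ?I = "UNIV \<times> Basis :: (nat \<times> 'b) set"
    have I: "countable ?I" by (intro countable_SIGMA) (auto intro: countable_finite)
    define A where "A = ball x0 (2 * r)"
    have [measurable]: "A \<in> sets lebesgue" "- A \<in> sets lebesgue"
      by (auto simp: A_def intro!: borel_closed closed_Compl)
    define u where "u i z = f (fst i) z \<bullet> snd i" for i z
    define u1 where "u1 i z = u i z * indicator A z" for i z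
    define u2 where "u2 i z = u i z * indicator (- A) z" for i z
    define h1 where "h1 z = h z * indicator A z" for z
    define h2 where "h2 z = h z * indicator (- A) z" for z
    have u_loc: "locally_integrable (u i)" for i
      unfolding u_def[abs_def] by (rule inner_locally_integrable[OF f])
    have u1_loc: "locally_integrable (u1 i)" and u2_loc: "locally_integrable (u2 i)" for i
      unfolding u1_def[abs_def] u2_def[abs_def]
      by (auto intro!: locally_integrable_mult_indicator u_loc)
    have h12[measurable]: "h1 \<in> borel_measurable lebesgue" "h2 \<in> borel_measurable lebesgue"
      unfolding h1_def[abs_def] h2_def[abs_def] by measurable
    have uh: "csum ?I (\<lambda>i. ennreal ((u i z)\<^sup>2)) = (h z)\<^sup>2" for z
    proof -
      have "(\<Sum>b\<in>Basis. ennreal ((f j z \<bullet> b)\<^sup>2)) = (ennreal (norm (f j z)))\<^sup>2" for j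
      proof -
        have "(norm (f j z))\<^sup>2 = (\<Sum>b\<in>Basis. (f j z \<bullet> b)\<^sup>2)"
          using euclidean_inner[of "f j z" "f j z"] by (simp only: power2_norm_eq_inner) (simp add: power2_eq_square)
        then show ?thesis by (simp add: ennreal_power sum_ennreal)
      qed
      then show ?thesis by (simp add: nn_integral_count_space_times u_def fh)
    qed
    have uh1: "l2_modulus ?I u1 h1" and uh2: "l2_modulus ?I u2 h2"
      using uh I h12 locally_integrable_measurable[OF u1_loc] locally_integrable_measurable[OF u2_loc]
      by (auto simp: l2_modulus_def u1_def u2_def h1_def h2_def indicator_def)
    define T1 where "T1 x = csum ?I (\<lambda>i. dsq (u1 i) x)" for x
    define T2 where "T2 x = csum ?I (\<lambda>i. dsq (u2 i) x)" for x
    have T_meas[measurable]: "T1 \<in> borel_measurable lebesgue" "T2 \<in> borel_measurable lebesgue"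
      unfolding T1_def[abs_def] T2_def[abs_def] by (auto intro!: borel_measurable_nn_integral_count_space I)
    have V_le: "?V x \<le> ennreal \<kappa> * (2 * T1 x + 2 * T2 x)" for x
    proof -
      have "?V x \<le> ennreal \<kappa> * csum ?I (\<lambda>i. dsq (u i) x)"
        using sum_intrinsic_square_le_dsq[of f x] f by (simp add: \<kappa>_def u_def[abs_def] case_prod_beta')
      also have "\<dots> \<le> ennreal \<kappa> * csum ?I (\<lambda>i. 2 * dsq (u1 i) x + 2 * dsq (u2 i) x)"
      proof (intro mult_left_mono nn_integral_mono)
        fix i
        have "u i = (\<lambda>z. u1 i z + u2 i z)" by (auto simp: u1_def u2_def indicator_def)
        then show "dsq (u i) x \<le> 2 * dsq (u1 i) x + 2 * dsq (u2 i) x"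
          using dsq_add_le[OF u1_loc[of i] u2_loc[of i], of x] by simp
      qed simp
      also have "\<dots> = ennreal \<kappa> * (2 * T1 x + 2 * T2 x)"
        unfolding T1_def T2_def by (subst nn_integral_add) (auto simp: nn_integral_cmult)
      finally show ?thesis .
    qed
    \<comment> \<open>Chosen so that \<open>\<kappa> * (4 * \<mu>^2) = l^2\<close>: the factor
      \<open>\<kappa>\<close> is lost to the discrete square function, the 4 to splitting into two
      parts. This is the \<open>2 * sqrt \<kappa>\<close> of \<open>C'\<close>.\<close>
    define \<mu> where "\<mu> = l / (2 * sqrt \<kappa>)"
    have \<mu>: "\<mu> > 0" using l \<kappa> by (simp add: \<mu>_def)
    have \<mu>2: "\<kappa> * (4 * \<mu>\<^sup>2) = l\<^sup>2"
      using \<kappa> by (simp add: \<mu>_def power_divide power_mult_distrib)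
    let ?Z = "{x \<in> ball x0 r. ennreal (l\<^sup>2) < ?V x}"
    define Z1 where "Z1 = {x. ennreal (\<mu>\<^sup>2) < T1 x}"
    define Z2 where "Z2 = {x \<in> ball x0 r. ennreal (\<mu>\<^sup>2) < T2 x}"
    have Z_sets: "Z1 \<in> sets lebesgue" "Z2 \<in> sets lebesgue"
    proof -
      show "Z1 \<in> sets lebesgue" unfolding Z1_def by (intro superlevel_sets T_meas)
      have "Z2 = ball x0 r \<inter> {x. ennreal (\<mu>\<^sup>2) < T2 x}" by (auto simp: Z2_def)
      then show "Z2 \<in> sets lebesgue" by (auto intro: superlevel_sets T_meas)
    qed
    have sub: "?Z \<subseteq> Z1 \<union> Z2"
    proof
      fix x assume x: "x \<in> ?Z"
      have "ennreal (4 * \<mu>\<^sup>2) < 2 * T1 x + 2 * T2 x"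
      proof (rule ccontr)
        assume "\<not> ennreal (4 * \<mu>\<^sup>2) < 2 * T1 x + 2 * T2 x"
        then have "ennreal \<kappa> * (2 * T1 x + 2 * T2 x) \<le> ennreal \<kappa> * ennreal (4 * \<mu>\<^sup>2)"
          by (intro mult_left_mono) (simp_all add: not_less)
        also have "\<dots> = ennreal (\<kappa> * (4 * \<mu>\<^sup>2))" using \<kappa> by (intro ennreal_mult[symmetric]) auto
        finally have "?V x \<le> ennreal (l\<^sup>2)"
          using V_le[of x] unfolding \<mu>2 by (rule order_trans[rotated])
        then show False using x by (simp add: not_less[symmetric])
      qed
      then have "ennreal (\<mu>\<^sup>2) < T1 x \<or> ennreal (\<mu>\<^sup>2) < T2 x" by (rule ennreal_less_two_sum) simp
      then show "x \<in> Z1 \<union> Z2" using x by (auto simp: Z1_def Z2_def)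
    qed
    have MP: "0 \<le> M * \<Phi> r" using M pos[OF r] by (intro mult_nonneg_nonneg) auto
    have b1: "ennreal \<mu> * vol Z1 \<le> ennreal (C * D * (M * \<Phi> r))"
    proof -
      have "ennreal \<mu> * vol Z1 \<le> ennreal C * (\<integral>\<^sup>+x. h1 x \<partial>lebesgue)"
        unfolding Z1_def T1_def by (intro C(2) uh1 \<mu>)
      also have "\<dots> \<le> ennreal C * ennreal (M * \<Phi> (2 * r))"
        unfolding h1_def A_def using r by (intro mult_left_mono morrey) auto
      also have "\<dots> \<le> ennreal C * ennreal (M * (D * \<Phi> r))"
        using M r dbl by (intro mult_left_mono ennreal_leI) auto
      also have "\<dots> = ennreal (C * (M * (D * \<Phi> r)))"
        using C(1) M D pos[OF r] by (intro ennreal_mult[symmetric] mult_nonneg_nonneg) auto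
      finally show ?thesis by (simp add: mult_ac)
    qed
    have b2: "ennreal \<mu> * vol Z2 \<le> ennreal (2 ^ ?n * K * (M * \<Phi> r))"
    \<comment> \<open>A single point of \<open>Z2\<close> already bounds the level
      \<open>\<mu>\<close> by a multiple of \<open>M * \<Phi> r / r ^ n\<close>, and the volume of
      the ball removes the denominator.\<close>
    proof (cases "Z2 = {}")
      case False
      then obtain x where x: "x \<in> ball x0 r" "ennreal (\<mu>\<^sup>2) < T2 x" by (auto simp: Z2_def)
      have "T2 x \<le> (ennreal (K * (M * \<Phi> r) / r ^ ?n))\<^sup>2"
        unfolding T2_def
      proof (rule K(2)[OF uh2 M _ r])
        fix s :: real assume "s > 0"
        have "mass h2 (ball x s) \<le> mass h (ball x s)"
          by (intro nn_integral_mono) (auto simp: h2_def indicator_def)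
        also have "\<dots> \<le> ennreal (M * \<Phi> s)" by (rule morrey[OF \<open>s > 0\<close>])
        finally show "mass h2 (ball x s) \<le> ennreal (M * \<Phi> s)" .
      next
        fix i z assume "z \<in> ball x r"
        then have "z \<in> A" using x(1) dist_triangle[of x0 z x] by (simp add: A_def)
        then show "u2 i z = 0" by (simp add: u2_def)
      qed
      with x(2) have "ennreal (\<mu>\<^sup>2) \<le> (ennreal (K * (M * \<Phi> r) / r ^ ?n))\<^sup>2" by simp
      then have "(ennreal \<mu>)\<^sup>2 \<le> (ennreal (K * (M * \<Phi> r) / r ^ ?n))\<^sup>2" using \<mu> by (simp add: ennreal_power)
      then have "ennreal \<mu> \<le> ennreal (K * (M * \<Phi> r) / r ^ ?n)" by (simp only: ennreal_power2_le_iff)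
      moreover have "vol Z2 \<le> ennreal ((2 * r) ^ ?n)"
      proof -
        have "vol Z2 \<le> vol (cball x0 r)"
          by (intro emeasure_mono) (auto simp: Z2_def)
        also have "\<dots> \<le> ennreal ((2 * r) ^ ?n)" using r by (intro emeasure_cball_le) auto
        finally show ?thesis .
      qed
      ultimately have "ennreal \<mu> * vol Z2 \<le> ennreal (K * (M * \<Phi> r) / r ^ ?n) * ennreal ((2 * r) ^ ?n)"
        by (intro mult_mono) auto
      also have "\<dots> = ennreal (K * (M * \<Phi> r) / r ^ ?n * (2 * r) ^ ?n)"
        using K(1) MP r by (intro ennreal_mult[symmetric]) auto
      also have "K * (M * \<Phi> r) / r ^ ?n * (2 * r) ^ ?n = 2 ^ ?n * K * (M * \<Phi> r)"
        using r by (simp add: power_mult_distrib)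
      finally show ?thesis .
    qed simp
    have "ennreal \<mu> * vol ?Z \<le> ennreal \<mu> * (vol Z1 + vol Z2)"
    proof (intro mult_left_mono)
      have "vol ?Z \<le> vol (Z1 \<union> Z2)"
        using sub Z_sets by (intro emeasure_mono) auto
      also have "\<dots> \<le> vol Z1 + vol Z2"
        using Z_sets by (intro emeasure_subadditive)
      finally show "vol ?Z \<le> \<dots>" .
    qed simp
    also have "\<dots> \<le> ennreal (C * D * (M * \<Phi> r)) + ennreal (2 ^ ?n * K * (M * \<Phi> r))"
      unfolding distrib_left by (intro add_mono b1 b2)
    also have "\<dots> = ennreal (C * D * (M * \<Phi> r) + 2 ^ ?n * K * (M * \<Phi> r))"
      using C(1) D K(1) M pos[OF r] by (intro ennreal_plus[symmetric] mult_nonneg_nonneg) auto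
    also have "\<dots> = ennreal ((C * D + 2 ^ ?n * K) * (M * \<Phi> r)) * 1"
      by (simp add: distrib_right)
    finally have "ennreal l * vol ?Z \<le> ennreal (C' * (M * \<Phi> r)) * 1"
      by (rule ennreal_rescale_le) (use \<kappa> \<mu> l C(1) D K(1) M pos[OF r] in \<open>auto simp: C'_def \<mu>_def\<close>)
    then show "ennreal l * vol ?Z \<le> ennreal (C' * (M * \<Phi> r))" by simp
  qed
qed

end

theorem theorem1p4:
  fixes \<alpha> D :: real and \<Phi> :: "real \<Rightarrow> real"
  assumes "0 < \<alpha>" and "\<alpha> \<le> 1"
    and "\<And>r. r > 0 \<Longrightarrow> \<Phi> r > 0"
    and "mono_on {0<..} \<Phi>"
    and "\<And>r. r > 0 \<Longrightarrow> \<Phi> (2 * r) \<le> D * \<Phi> r"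
    and "1 \<le> D" and "D < 2 ^ CARD('n)"
  shows "\<exists>C::real. C > 0 \<and>
    (\<forall>f :: nat \<Rightarrow> real ^ 'n \<Rightarrow> 'b::{real_normed_field, euclidean_space}.
      (\<forall>j. locally_integrable (f j)) \<longrightarrow>
      weak_morrey_norm \<Phi> (\<lambda>x. ennsqrt (\<Sum>j. (intrinsic_square \<alpha> (f j) x)\<^sup>2))
        \<le> ennreal C * morrey_norm \<Phi> (\<lambda>x. ennsqrt (\<Sum>j. (ennreal (norm (f j x)))\<^sup>2)))"
proof (rule holder_exponent.weak_distribution_estimate[where 'n = 'n and 'b = 'b,
      OF holder_exponent.intro[OF assms(1,2)] assms(3-7)], goal_cases)
  case (3 C)
  note C = 3
  show ?thesis
  proof (intro exI[of _ C] conjI allI impI C(1))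
    fix f :: "nat \<Rightarrow> real ^ 'n \<Rightarrow> 'b" assume f: "\<forall>j. locally_integrable (f j)"
    let ?g = "\<lambda>x. ennsqrt (\<Sum>j. (intrinsic_square \<alpha> (f j) x)\<^sup>2)"
    let ?h = "\<lambda>x. ennsqrt (\<Sum>j. (ennreal (norm (f j x)))\<^sup>2)"
    have g: "?g \<in> borel_measurable lebesgue"
    proof -
      have [measurable]: "intrinsic_square \<alpha> (f j) \<in> borel_measurable borel" for j
        using f by (intro holder_exponent.intrinsic_square_measurable holder_exponent.intro assms(1,2)) simp
      have "?g \<in> borel_measurable borel" by measurable
      then show ?thesis by (intro measurable_completion) simp
    qed
    have le: "weak_morrey_norm \<Phi> ?g \<le> ennreal (C * M)" if M: "M > 0" "?h \<in> borel_measurable lebesgue"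
      "\<forall>x\<^sub>0. \<forall>r>0. (\<integral>\<^sup>+x\<in>ball x\<^sub>0 r. ?h x \<partial>lebesgue) \<le> ennreal (M * \<Phi> r)" for M
      unfolding weak_morrey_norm_def
    proof (rule Inf_lower, intro CollectI exI[of _ "C * M"] conjI refl g allI impI SUP_least)
      fix x0 :: "real ^ 'n" and r l :: real assume r: "0 < r" and l: "l \<in> {0<..}"
      have "ennreal l * vol {x \<in> ball x0 r. ennreal (l\<^sup>2) < (\<Sum>j. (intrinsic_square \<alpha> (f j) x)\<^sup>2)}
          \<le> ennreal (C * (M * \<Phi> r))"
        by (rule C(2)[of f ?h]) (use f M r l in \<open>auto simp: ennsqrt_power2\<close>)
      then show "ennreal l * vol {x \<in> ball x0 r. ennreal l < ?g x} \<le> ennreal (C * M * \<Phi> r)"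
        using l by (simp add: ennsqrt_less_iff mult.assoc)
    qed (use C(1) M(1) in simp)
    \<comment> \<open>Moving \<open>C\<close> to the left makes the claim a lower bound for an
      infimum, checked at each admissible \<open>M\<close>; if no constant is admissible, the
      infimum is \<open>top\<close>.\<close>
    have "ennreal (1 / C) * weak_morrey_norm \<Phi> ?g \<le> morrey_norm \<Phi> ?h"
      unfolding morrey_norm_def
    proof (rule Inf_greatest, elim CollectE exE conjE)
      fix v M assume v: "v = ennreal M" "0 < M" "?h \<in> borel_measurable lebesgue"
        "\<forall>x\<^sub>0. \<forall>r>0. (\<integral>\<^sup>+x\<in>ball x\<^sub>0 r. ?h x \<partial>lebesgue) \<le> ennreal (M * \<Phi> r)"
      have "ennreal (1 / C) * weak_morrey_norm \<Phi> ?g \<le> ennreal (1 / C) * ennreal (C * M)"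
        by (intro mult_left_mono le v) auto
      also have "\<dots> = ennreal (1 / C * (C * M))"
        using C(1) v(2) by (intro ennreal_mult[symmetric]) auto
      also have "1 / C * (C * M) = M" using C(1) by simp
      finally show "ennreal (1 / C) * weak_morrey_norm \<Phi> ?g \<le> v" by (simp add: v(1))
    qed
    then have "ennreal C * (ennreal (1 / C) * weak_morrey_norm \<Phi> ?g) \<le> ennreal C * morrey_norm \<Phi> ?h"
      by (intro mult_left_mono) auto
    also have "ennreal C * (ennreal (1 / C) * weak_morrey_norm \<Phi> ?g) = weak_morrey_norm \<Phi> ?g"
    proof -
      have "ennreal C * ennreal (1 / C) = ennreal (C * (1 / C))"
        using C(1) by (intro ennreal_mult[symmetric]) auto
      then have "ennreal C * ennreal (1 / C) = 1" using C(1) by simp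
      then show ?thesis by (simp only: mult.assoc[symmetric] mult_1_left)
    qed
    finally show "weak_morrey_norm \<Phi> ?g \<le> ennreal C * morrey_norm \<Phi> ?h" .
  qed
qed

end
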